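(* Let $\omega$ be a modulus of continuity. There exists an outer function $b:\mathbb{D} \to \mathbb{D}$ such that $$\Lambda^\omega_a \cap \mathcal{H}(b) = \{0\}.$$
   Context: $\mathbb{D} = \{z \in \mathbb{C} : |z|<1\}$ is the unit disk, $\overline{\mathbb{D}}$ its closure, $\mathbb{T}$ the unit circle, and $m$ the normalized Lebesgue measure on $\mathbb{T}$. A modulus of continuity is a function $\omega:[0,\infty) \to [0,\infty)$ which is continuous, increasing, satisfies $\omega(0)=0$, and for which $\omega(t)/t$ is a decreasing function (of $t>0$) with $\lim_{t \to 0^+} \omega(t)/t = \infty$. Monotonicity is understood in the non-strict sense. $\Lambda^\omega_a$ is the space of functions $f$ which are analytic in $\mathbb{D}$, extend continuously to $\overline{\mathbb{D}}$, and satisfy $$\sup_{z,w \in \overline{\mathbb{D}},\, z \neq w} \frac{|f(z)-f(w)|}{\omega(|z-w|)} < \infty.$$ A bounded analytic function $b$ on $\mathbb{D}$ is outer if $b(z) = \exp\big(\int_{\mathbb{T}} \frac{\zeta+z}{\zeta-z} \log|b(\zeta)|\, dm(\zeta)\big)$ for $z \in \mathbb{D}$, where $b(\zeta)$, $\zeta \in \mathbb{T}$, denotes the non-tangential boundary values and $\log|b| \in L^1(\mathbb{T})$. For an analytic function $b:\mathbb{D} \to \mathbb{D}$, the de Branges-Rovnyak space $\mathcal{H}(b)$ is the reproducing kernel Hilbert space of analytic functions on $\mathbb{D}$ with reproducing kernel $k_\lambda(z) = \frac{1-\overline{b(\lambda)}b(z)}{1-\overline{\lambda}z}$, $\lambda,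 z \in \mathbb{D}$. *)

theory Defs
  imports "HOL-Complex_Analysis.Complex_Analysis"
begin

text \<open>A function on a set \<open>X\<close> is represented by a total function that vanishes outside \<open>X\<close>,
  so that equality of functions on \<open>X\<close> is HOL equality and the zero function is \<open>\<lambda>_. 0\<close>.\<close>

definition modulus_of_continuity :: "(real \<Rightarrow> real) \<Rightarrow> bool" where
  "modulus_of_continuity \<omega> \<longleftrightarrow>
     continuous_on {0..} \<omega> \<and>
     (\<forall>t\<ge>0. \<omega> t \<ge> 0) \<and>
     mono_on {0..} \<omega> \<and>
     \<omega> 0 = 0 \<and>
     antimono_on {0<..} (\<lambda>t. \<omega> t / t) \<and>
     filterlim (\<lambda>t. \<omega> t / t) at_top (at_right 0)"

text \<open>Elements are functions on the open disk; \<open>g\<close> is the continuous extension to the closed disk.\<close>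

definition Lambda_a :: "(real \<Rightarrow> real) \<Rightarrow> (complex \<Rightarrow> complex) set" where
  "Lambda_a \<omega> = {f.
     (\<forall>z. z \<notin> ball 0 1 \<longrightarrow> f z = 0) \<and>
     f holomorphic_on ball 0 1 \<and>
     (\<exists>g. continuous_on (cball 0 1) g \<and>
          (\<forall>z\<in>ball 0 1. g z = f z) \<and>
          bdd_above {norm (g z - g w) / \<omega> (norm (z - w)) | z w.
                       z \<in> cball 0 1 \<and> w \<in> cball 0 1 \<and> z \<noteq> w})}"

definition circle_measure :: "complex measure" where
  "circle_measure = distr (uniform_measure lborel {0..2 * pi}) borel cis"

definition stolz_region :: "complex \<Rightarrow> real \<Rightarrow> complex set" where
  "stolz_region \<zeta> \<alpha> = {z \<in> ball 0 1. norm (z - \<zeta>) < \<alpha> * (1 - norm z)}"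

definition has_nontangential_limit ::
    "(complex \<Rightarrow> complex) \<Rightarrow> complex \<Rightarrow> complex \<Rightarrow> bool" where
  "has_nontangential_limit b l \<zeta> \<longleftrightarrow>
     (\<forall>\<alpha>>1. (b \<longlongrightarrow> l) (at \<zeta> within stolz_region \<zeta> \<alpha>))"

text \<open>The boundary function \<open>b'\<close> is determined up to a null set. Requiring it to be nonzero almost
  everywhere is part of \<open>log |b| \<in> L\<^sup>1\<close>: in HOL \<open>ln 0 = 0\<close> rather than \<open>-\<infinity>\<close>.\<close>

definition outer_function :: "(complex \<Rightarrow> complex) \<Rightarrow> bool" where
  "outer_function b \<longleftrightarrow>
     b holomorphic_on ball 0 1 \<and>
     bounded (b ` ball 0 1) \<and>
     (\<exists>b'. (AE \<zeta> in circle_measure. has_nontangential_limit b (b' \<zeta>) \<zeta>) \<and>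
           (AE \<zeta> in circle_measure. b' \<zeta> \<noteq> 0) \<and>
           integrable circle_measure (\<lambda>\<zeta>. ln (norm (b' \<zeta>))) \<and>
           (\<forall>z\<in>ball 0 1. b z =
              exp (\<integral>\<zeta>. (\<zeta> + z) / (\<zeta> - z) * of_real (ln (norm (b' \<zeta>))) \<partial>circle_measure)))"

locale function_hilbert_space =
  fixes X :: "'a set"
    and H :: "('a \<Rightarrow> complex) set"
    and ip :: "('a \<Rightarrow> complex) \<Rightarrow> ('a \<Rightarrow> complex) \<Rightarrow> complex"
  assumes vanishes_outside: "f \<in> H \<Longrightarrow> x \<notin> X \<Longrightarrow> f x = 0"
    and zero_mem: "(\<lambda>_. 0) \<in> H"
    and add_mem: "f \<in> H \<Longrightarrow> g \<in> H \<Longrightarrow> (\<lambda>x. f x + g x) \<in> H"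
    and scale_mem: "f \<in> H \<Longrightarrow> (\<lambda>x. c * f x) \<in> H"
    and ip_add_left: "f \<in> H \<Longrightarrow> g \<in> H \<Longrightarrow> h \<in> H \<Longrightarrow> ip (\<lambda>x. f x + g x) h = ip f h + ip g h"
    and ip_scale_left: "f \<in> H \<Longrightarrow> h \<in> H \<Longrightarrow> ip (\<lambda>x. c * f x) h = c * ip f h"
    and ip_cnj: "f \<in> H \<Longrightarrow> g \<in> H \<Longrightarrow> ip g f = cnj (ip f g)"
    and ip_pos: "f \<in> H \<Longrightarrow> f \<noteq> (\<lambda>_. 0) \<Longrightarrow> Re (ip f f) > 0"
    and complete:
      "(\<And>n. s n \<in> H) \<Longrightarrow>
       (\<And>e. e > 0 \<Longrightarrow> \<exists>N. \<forall>m\<ge>N. \<forall>n\<ge>N.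
          sqrt (Re (ip (\<lambda>x. s m x - s n x) (\<lambda>x. s m x - s n x))) < e) \<Longrightarrow>
       \<exists>f\<in>H. (\<lambda>n. sqrt (Re (ip (\<lambda>x. s n x - f x) (\<lambda>x. s n x - f x)))) \<longlonglongrightarrow> 0"

text \<open>\<open>K w\<close> is the kernel function at the point \<open>w\<close>; only its values on \<open>X\<close> matter.\<close>

locale reproducing_kernel_hilbert_space = function_hilbert_space X H ip
  for X :: "'a set"
    and H :: "('a \<Rightarrow> complex) set"
    and ip :: "('a \<Rightarrow> complex) \<Rightarrow> ('a \<Rightarrow> complex) \<Rightarrow> complex" +
  fixes K :: "'a \<Rightarrow> 'a \<Rightarrow> complex"
  assumes kernel_mem: "w \<in> X \<Longrightarrow> (\<lambda>x. if x \<in> X then K w x else 0) \<in> H"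
    and reproducing: "w \<in> X \<Longrightarrow> f \<in> H \<Longrightarrow> ip f (\<lambda>x. if x \<in> X then K w x else 0) = f w"

definition dbr_kernel :: "(complex \<Rightarrow> complex) \<Rightarrow> complex \<Rightarrow> complex \<Rightarrow> complex" where
  "dbr_kernel b w z = (1 - cnj (b w) * b z) / (1 - cnj w * z)"

text \<open>A reproducing kernel Hilbert space is uniquely determined by its kernel (Moore--Aronszajn),
  so at most one pair \<open>H\<close>, \<open>ip\<close> (up to values of \<open>ip\<close> off \<open>H\<close>) occurs here.\<close>

definition de_branges_rovnyak :: "(complex \<Rightarrow> complex) \<Rightarrow> (complex \<Rightarrow> complex) set" where
  "de_branges_rovnyak b = {f. \<exists>H ip.
     reproducing_kernel_hilbert_space (ball 0 1) H ip (dbr_kernel b) \<and>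
     (\<forall>h\<in>H. h holomorphic_on ball 0 1) \<and>
     f \<in> H}"

end

theory Submission
  imports Defs
begin

text \<open>
  Write \<open>b = exp (- F)\<close> with \<open>Re F = u \<ge> 0\<close> on the circle, and measure functions by their Taylor
  coefficients. A function \<open>f\<close> in \<open>H(b)\<close> pairs with \<open>b h\<close>, for \<open>h\<close> in the Hardy space, like a bounded
  functional of the defect: \<open>|<f, b h>|\<^sup>2 \<le> \<parallel>f\<parallel>\<^sup>2 (\<parallel>h\<parallel>\<^sup>2 - \<parallel>b h\<parallel>\<^sup>2)\<close> (\<open>dbr_pairing_le\<close>). With \<open>h = p / b\<close> the
  right-hand side is about the integral of \<open>(exp (2 u) - 1) |p|\<^sup>2\<close>, so it is small as soon as \<open>u |p|\<^sup>2\<close>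
  is small on the circle. If \<open>u\<close> is tiny near the \<open>N\<close>-th roots of unity, this can be arranged for a
  function \<open>p(z) = z\<^sup>k Q(z\<^sup>N)\<close> with \<open>Q(0) = 1\<close> that is large only there. But
  \<open>p = z\<^sup>k + O(z\<^sup>k\<^sup>+\<^sup>N)\<close>, so \<open><f, p>\<close> is the \<open>k\<close>-th coefficient of \<open>f\<close> plus a part seen only by
  the coefficients of \<open>f\<close> of order at least \<open>N\<close>.

  Smoothness enters only through this tail. For \<open>f\<close> with modulus of continuity \<open>\<omega>\<close> the square sum of the
  coefficients from \<open>N\<close> on is \<open>O(\<omega>(1/N)\<^sup>2)\<close> (\<open>Lambda_coeff_tail\<close>), while the norm of \<open>p\<close> does not depend on
  \<open>N\<close>. Hence, once \<open>Q\<close> is chosen, taking \<open>N\<close> large makes the unwanted part negligible, and the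
  \<open>k\<close>-th coefficient of \<open>f\<close> is forced to be \<open>0\<close> (\<open>dbr_coeff_le\<close>).

  It remains to find one \<open>u\<close> that is tiny near the \<open>N\<^sub>n\<close>-th roots of unity for a whole sequence
  \<open>N\<^sub>n\<close>. It is a Riesz product: \<open>u\<close> is the product of the factors \<open>Re \<psi>\<^sub>n(\<zeta>\<^bsup>N\<^sub>n\<^esup>)\<close>, with polynomials
  \<open>\<psi>\<^sub>n\<close> that have \<open>\<psi>\<^sub>n(0) = 1\<close>, nonnegative real part, almost vanish near \<open>1\<close> in real part and are close
  to \<open>1\<close> away from \<open>1\<close> (\<open>block_pair\<close>). If \<open>N\<^sub>n\<close> exceeds the degree of the polynomial \<open>F\<^sub>n\<close> whose
  real part is the \<open>n\<close>-th partial product, multiplication by the next factor is again the real part of a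
  polynomial \<open>F\<^sub>n\<^sub>+\<^sub>1\<close> (\<open>riesz_step\<close>), and \<open>F\<^sub>n\<^sub>+\<^sub>1 - F\<^sub>n\<close> is tiny except close to the
  \<open>N\<^sub>n\<close>-th roots of unity. So \<open>F = lim F\<^sub>n\<close> exists in the disk, and the Borel--Cantelli lemma gives
  uniform convergence on Stolz regions at almost every boundary point (\<open>AE_stolz_limit\<close>). This
  replaces Fatou's theorem: nontangential limits come for free, and since \<open>u\<close> is bounded, the Herglotz formula
  for \<open>F\<^sub>n\<close> passes to the limit, which says that \<open>b\<close> is outer (\<open>outer_exp_F_lim\<close>).

  Finally, that \<open>0\<close> belongs to \<open>H(b)\<close> means that this space exists at all: the kernel is positive and
  has a Hilbert space completion consisting of holomorphic functions
  (\<open>szego_form_mult_le\<close>, \<open>Moore_Aronszajn\<close>).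
\<close>

section \<open>Normalized Lebesgue measure on the circle\<close>

lemma circle_integral_lborel:
  fixes f :: "complex \<Rightarrow> 'b::{banach,second_countable_topology}"
  assumes f: "f \<in> borel_measurable borel"
  shows "(\<integral>\<zeta>. f \<zeta> \<partial>circle_measure)
    = (1 / (2 * pi)) *\<^sub>R (\<integral>t. indicat_real {0..2*pi} t *\<^sub>R f (cis t) \<partial>lborel)"
proof -
  have cis: "cis \<in> measurable borel borel"
    by (intro borel_measurable_continuous_onI continuous_intros)
  have U: "uniform_measure lborel {0..2*pi}
      = density lborel (\<lambda>x. ennreal (indicat_real {0..2*pi} x / (2 * pi)))"
    unfolding uniform_measure_def
    by (intro density_cong) (auto simp: indicator_def divide_ennreal ennreal_1[symmetric] simp del: ennreal_1)
  have "(\<integral>\<zeta>. f \<zeta> \<partial>circle_measure)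
      = (\<integral>t. f (cis t) \<partial>uniform_measure lborel {0..2*pi})"
    unfolding circle_measure_def using cis f by (intro integral_distr) (auto simp: uniform_measure_def)
  also have "\<dots> = (\<integral>t. (indicat_real {0..2*pi} t / (2 * pi)) *\<^sub>R f (cis t) \<partial>lborel)"
    unfolding U using measurable_compose[OF cis f] by (intro integral_density) auto
  also have "\<dots> = (\<integral>t. (1 / (2 * pi)) *\<^sub>R (indicat_real {0..2*pi} t *\<^sub>R f (cis t)) \<partial>lborel)"
    by (intro Bochner_Integration.integral_cong) auto
  also have "\<dots> = (1 / (2 * pi)) *\<^sub>R (\<integral>t. indicat_real {0..2*pi} t *\<^sub>R f (cis t) \<partial>lborel)"
    by (rule integral_scaleR_right)
  finally show ?thesis .
qed

lemma sets_circle_measure [measurable_cong, simp]: "sets circle_measure = sets borel"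
  and space_circle_measure [simp]: "space circle_measure = UNIV"
  by (simp_all add: circle_measure_def)

lemma emeasure_circle_UNIV: "emeasure circle_measure UNIV = 1"
proof -
  have cis: "cis \<in> measurable borel borel"
    by (intro borel_measurable_continuous_onI continuous_intros)
  have "emeasure circle_measure UNIV = emeasure (uniform_measure lborel {0..2*pi}) UNIV"
    unfolding circle_measure_def using cis by (subst emeasure_distr) (auto simp: uniform_measure_def)
  also have "\<dots> = 1"
    by (simp add: ennreal_1[symmetric] divide_ennreal del: ennreal_1)
  finally show ?thesis .
qed

interpretation circle: finite_measure circle_measure
  by standard (simp add: emeasure_circle_UNIV)

lemma measure_circle_UNIV [simp]: "measure circle_measure UNIV = 1"
  by (simp add: measure_def emeasure_circle_UNIV)

lemma AE_circle_norm: "AE \<zeta> in circle_measure. norm \<zeta> = 1"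
proof -
  have cis: "cis \<in> measurable borel borel"
    by (intro borel_measurable_continuous_onI continuous_intros)
  have "{\<zeta>::complex. norm \<zeta> = 1} \<in> sets borel"
    by (intro borel_closed closed_Collect_eq continuous_intros)
  then show ?thesis
    unfolding circle_measure_def using cis
    by (subst AE_distr_iff) (auto simp: uniform_measure_def)
qed

lemma circle_integrable:
  fixes f :: "complex \<Rightarrow> 'b::{banach,second_countable_topology}"
  assumes "f \<in> borel_measurable borel" and "\<And>\<zeta>. norm \<zeta> = 1 \<Longrightarrow> norm (f \<zeta>) \<le> B"
  shows "integrable circle_measure f"
  using assms AE_circle_norm by (intro circle.integrable_const_bound[of _ B]) auto

lemma circle_integrable_continuous:
  fixes f :: "complex \<Rightarrow> 'b::{banach,second_countable_topology}"
  assumes "continuous_on UNIV f"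
  shows "integrable circle_measure f"
proof -
  have "compact (f ` sphere 0 1)"
    using assms by (intro compact_continuous_image) (auto intro: continuous_on_subset)
  then obtain B where "\<And>y. y \<in> f ` sphere 0 1 \<Longrightarrow> norm y \<le> B"
    by (meson bounded_iff compact_imp_bounded)
  then show ?thesis
    using assms by (intro circle_integrable[of f B] borel_measurable_continuous_onI) auto
qed

lemma circle_integral_bound:
  fixes f :: "complex \<Rightarrow> 'b::{banach,second_countable_topology}"
  assumes "AE \<zeta> in circle_measure. norm (f \<zeta>) \<le> B" "0 \<le> B"
  shows "norm (\<integral>\<zeta>. f \<zeta> \<partial>circle_measure) \<le> B"
proof (cases "integrable circle_measure f")
  case True
  have "norm (\<integral>\<zeta>. f \<zeta> \<partial>circle_measure) \<le> (\<integral>\<zeta>. norm (f \<zeta>) \<partial>circle_measure)"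
    by (rule integral_norm_bound)
  also have "\<dots> \<le> (\<integral>\<zeta>. B \<partial>circle_measure)"
    using assms True by (intro integral_mono_AE) auto
  finally show ?thesis by simp
qed (use assms in \<open>simp add: not_integrable_integral_eq\<close>)

lemma circle_orthonormal:
  "(\<integral>\<zeta>. \<zeta> ^ m * cnj \<zeta> ^ n \<partial>circle_measure) = (if m = n then 1 else 0)"
proof -
  define k where "k = real m - real n"
  have e: "cis t ^ m * cnj (cis t) ^ n = cis (k * t)" for t
    by (simp add: cis_cnj Complex.DeMoivre cis_mult k_def algebra_simps)
  have "(\<integral>\<zeta>. \<zeta> ^ m * cnj \<zeta> ^ n \<partial>circle_measure)
     = (1 / (2 * pi)) *\<^sub>R (\<integral>t. indicat_real {0..2*pi} t *\<^sub>R cis (k * t) \<partial>lborel)"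
    by (subst circle_integral_lborel) (auto simp: e intro!: borel_measurable_continuous_onI continuous_intros)
  also have "\<dots> = (if m = n then 1 else 0)"
  proof (cases "m = n")
    case True
    then show ?thesis by (simp add: k_def scaleR_conv_of_real)
  next
    case False
    then have k: "k \<noteq> 0" by (simp add: k_def)
    have "(\<integral>t. indicat_real {0..2*pi} t *\<^sub>R cis (k * t) \<partial>lborel)
        = cis (k * (2*pi)) / (\<i> * k) - cis (k * 0) / (\<i> * k)"
    proof (intro integral_FTC_Icc)
      show "((\<lambda>t. cis (k * t) / (\<i> * k)) has_vector_derivative cis (k * t)) (at t within {0..2*pi})" for t
      proof -
        have "((\<lambda>x. exp (\<i> * k * x) / (\<i> * k)) has_field_derivative exp (\<i> * k * complex_of_real t)) (at (of_real t))"
          using k by (auto intro!: derivative_eq_intros)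
        from has_vector_derivative_real_field[OF this] show ?thesis
          by (simp add: cis_conv_exp mult.assoc)
      qed
    qed (auto intro!: continuous_intros)
    moreover have "cis (k * (2*pi)) = 1"
    proof -
      have "k \<in> \<int>" by (simp add: k_def)
      then show ?thesis
        by (metis Ints_cases cis_multiple_2pi mult.commute Ints_of_int)
    qed
    ultimately show ?thesis using False by simp
  qed
  finally show ?thesis .
qed

lemma circle_integral_norm_poly:
  assumes "finite A"
  shows "(\<integral>\<zeta>. (norm (\<Sum>m\<in>A. c m * \<zeta> ^ m))\<^sup>2 \<partial>circle_measure) = (\<Sum>m\<in>A. (norm (c m))\<^sup>2)"
proof -
  have "complex_of_real (\<integral>\<zeta>. (norm (\<Sum>m\<in>A. c m * \<zeta> ^ m))\<^sup>2 \<partial>circle_measure)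
     = (\<integral>\<zeta>. (\<Sum>m\<in>A. \<Sum>n\<in>A. (c m * cnj (c n)) * (\<zeta> ^ m * cnj \<zeta> ^ n)) \<partial>circle_measure)"
    unfolding integral_complex_of_real[symmetric] complex_norm_square
    by (intro Bochner_Integration.integral_cong) (auto simp: sum_product algebra_simps)
  also have "\<dots> = (\<Sum>m\<in>A. \<Sum>n\<in>A. (c m * cnj (c n)) * (if m = n then 1 else 0))"
    by (subst Bochner_Integration.integral_sum Bochner_Integration.integral_sum,
        (intro Bochner_Integration.integrable_sum circle_integrable_continuous continuous_intros)[1])+
       (simp add: circle_orthonormal)
  also have "\<dots> = complex_of_real (\<Sum>m\<in>A. (norm (c m))\<^sup>2)"
    using assms by (simp add: if_distrib[of "\<lambda>x. _ * x"] complex_norm_square[symmetric] sum.delta' cong: if_cong)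
  finally show ?thesis by (simp only: of_real_eq_iff)
qed


text \<open>Parseval's identity, in the only form that is needed: a pointwise comparison of two functions on a circle
becomes a comparison of coefficient sums. Comparing avoids integrals of the functions themselves
and so any question of their measurability off the circle; only integrals of partial sums occur.\<close>

lemma parseval_compare:
  fixes a b :: "nat \<Rightarrow> complex" and f g :: "complex \<Rightarrow> complex"
  assumes f: "\<And>z. norm z < R \<Longrightarrow> (\<lambda>m. a m * z ^ m) sums f z"
    and g: "\<And>z. norm z < R \<Longrightarrow> (\<lambda>m. b m * z ^ m) sums g z"
    and \<rho>: "0 \<le> \<rho>" "\<rho> < R"
    and le: "\<And>z. norm z = \<rho> \<Longrightarrow> (norm (f z))\<^sup>2 \<le> (norm (g z))\<^sup>2 + C"
  shows "summable (\<lambda>m. (norm (a m))\<^sup>2 * \<rho> ^ (2 * m))"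
    and "summable (\<lambda>m. (norm (b m))\<^sup>2 * \<rho> ^ (2 * m))"
    and "(\<Sum>m. (norm (a m))\<^sup>2 * \<rho> ^ (2 * m)) \<le> (\<Sum>m. (norm (b m))\<^sup>2 * \<rho> ^ (2 * m)) + C"
proof -
  have *: "summable (\<lambda>m. norm (c m) * \<rho> ^ m)"
     "summable (\<lambda>m. (norm (c m))\<^sup>2 * \<rho> ^ (2 * m))"
     "\<exists>\<tau>. \<tau> \<longlonglongrightarrow> 0 \<and> (\<forall>n. \<forall>z::complex. norm z = 1 \<longrightarrow>
         \<bar>(norm (\<Sum>m<n. (c m * of_real \<rho> ^ m) * z ^ m))\<^sup>2 - (norm (h (\<rho> * z)))\<^sup>2\<bar> \<le> \<tau> n)"
    if h: "\<And>z. norm z < R \<Longrightarrow> (\<lambda>m. c m * z ^ m) sums h z" for c :: "nat \<Rightarrow> complex" and h :: "complex \<Rightarrow> complex"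
  proof -
    define r where "r = (\<rho> + R) / 2"
    have r: "\<rho> < r" "r < R" using \<rho> by (auto simp: r_def field_simps)
    have "summable (\<lambda>m. c m * of_real r ^ m)"
      using h[of "of_real r"] r \<rho> by (auto simp: sums_iff)
    from powser_insidea[OF this, of "of_real \<rho>"] show sm: "summable (\<lambda>m. norm (c m) * \<rho> ^ m)"
      using r \<rho> by (simp add: norm_mult norm_power)
    have "summable (\<lambda>m. norm (c m) * \<rho> ^ m * (norm (c m) * \<rho> ^ m))"
    proof (rule summable_comparison_test_ev[OF _ sm])
      have "eventually (\<lambda>m. norm (c m) * \<rho> ^ m < 1) sequentially"
        using summable_LIMSEQ_zero[OF sm] by (rule order_tendstoD) simp
      then show "eventually (\<lambda>m. norm (norm (c m) * \<rho> ^ m * (norm (c m) * \<rho> ^ m)) \<le> norm (c m) * \<rho> ^ m) sequentially"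
        by eventually_elim (use \<rho> in \<open>auto simp: abs_mult intro!: mult_left_le\<close>)
    qed
    then show "summable (\<lambda>m. (norm (c m))\<^sup>2 * \<rho> ^ (2 * m))"
      by (simp add: power2_eq_square power_mult power_mult_distrib mult_ac)
    define B where "B = (\<Sum>m. norm (c m) * \<rho> ^ m)"
    define \<tau> where "\<tau> = (\<lambda>n. B - (\<Sum>m<n. norm (c m) * \<rho> ^ m))"
    have \<tau>: "\<tau> \<longlonglongrightarrow> 0"
      unfolding \<tau>_def B_def using summable_LIMSEQ[OF sm] by (auto intro!: tendsto_eq_intros)
    define S where "S = (\<lambda>n z. \<Sum>m<n. (c m * of_real \<rho> ^ m) * z ^ m)"
    have hz: "(\<lambda>m. (c m * of_real \<rho> ^ m) * z ^ m) sums h (\<rho> * z)" if "norm z = 1" for z :: complex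
      using h[of "\<rho> * z"] that \<rho> by (simp add: norm_mult power_mult_distrib mult.assoc)
    have tail: "norm (h (\<rho> * z) - S n z) \<le> \<tau> n" if z: "norm z = 1" for z :: complex and n
    proof -
      have nm: "norm ((c m * of_real \<rho> ^ m) * z ^ m) = norm (c m) * \<rho> ^ m" for m
        using z \<rho> by (simp add: norm_mult norm_power)
      have "h (\<rho> * z) - S n z = (\<Sum>m. (c (m + n) * of_real \<rho> ^ (m + n)) * z ^ (m + n))"
        unfolding S_def using sums_split_initial_segment[OF hz[OF z], of n] by (simp add: sums_iff)
      also have "norm \<dots> \<le> (\<Sum>m. norm (c (m + n)) * \<rho> ^ (m + n))"
        using sm summable_norm[of "\<lambda>m. (c (m + n) * of_real \<rho> ^ (m + n)) * z ^ (m + n)"]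
          summable_iff_shift[of "\<lambda>m. norm (c m) * \<rho> ^ m" n] by (simp add: nm)
      also have "\<dots> = \<tau> n" unfolding \<tau>_def B_def using suminf_split_initial_segment[OF sm, of n] by simp
      finally show ?thesis .
    qed
    have \<tau>B: "\<tau> n \<le> B" for n
      unfolding \<tau>_def using \<rho> by (auto intro!: sum_nonneg)
    have hB: "norm (h (\<rho> * z)) \<le> B" if "norm z = 1" for z :: complex
      using tail[OF that, of 0] by (simp add: S_def \<tau>_def)
    have "\<bar>(norm (S n z))\<^sup>2 - (norm (h (\<rho> * z)))\<^sup>2\<bar> \<le> \<tau> n * (3 * B)" if z: "norm z = 1" for n and z :: complex
    proof -
      have "norm (S n z) \<le> 2 * B"
        using tail[OF z, of n] \<tau>B[of n] hB[OF z] norm_triangle_ineq4[of "h (\<rho> * z)" "h (\<rho> * z) - S n z"] by simp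
      moreover have "\<bar>norm (S n z) - norm (h (\<rho> * z))\<bar> \<le> \<tau> n"
        using tail[OF z, of n] norm_triangle_ineq3[of "S n z" "h (\<rho> * z)"] by (simp add: norm_minus_commute)
      ultimately show ?thesis
        using hB[OF z] unfolding square_diff_square_factored[of "norm (S n z)", folded power2_eq_square] abs_mult
        by (subst mult.commute) (intro mult_mono, auto)
    qed
    moreover have "(\<lambda>n. \<tau> n * (3 * B)) \<longlonglongrightarrow> 0" using \<tau> by (auto intro!: tendsto_eq_intros)
    ultimately show "\<exists>\<tau>. \<tau> \<longlonglongrightarrow> 0 \<and> (\<forall>n. \<forall>z::complex. norm z = 1 \<longrightarrow>
         \<bar>(norm (\<Sum>m<n. (c m * of_real \<rho> ^ m) * z ^ m))\<^sup>2 - (norm (h (\<rho> * z)))\<^sup>2\<bar> \<le> \<tau> n)"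
      unfolding S_def by blast
  qed
  show sa: "summable (\<lambda>m. (norm (a m))\<^sup>2 * \<rho> ^ (2 * m))"
    and sb: "summable (\<lambda>m. (norm (b m))\<^sup>2 * \<rho> ^ (2 * m))"
    using *(2)[of a f, OF f] *(2)[of b g, OF g] by auto
  define S where "S = (\<lambda>c n z. \<Sum>m<n. (c m * complex_of_real \<rho> ^ m) * z ^ m)"
  obtain \<tau> where \<tau>: "\<tau> \<longlonglongrightarrow> 0" "\<And>n (z::complex). norm z = 1 \<Longrightarrow> \<bar>(norm (S a n z))\<^sup>2 - (norm (f (\<rho> * z)))\<^sup>2\<bar> \<le> \<tau> n"
    using *(3)[of a f, OF f] unfolding S_def by blast
  obtain \<sigma> where \<sigma>: "\<sigma> \<longlonglongrightarrow> 0" "\<And>n (z::complex). norm z = 1 \<Longrightarrow> \<bar>(norm (S b n z))\<^sup>2 - (norm (g (\<rho> * z)))\<^sup>2\<bar> \<le> \<sigma> n"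
    using *(3)[of b g, OF g] unfolding S_def by blast
  have I: "(\<integral>\<zeta>. (norm (S c n \<zeta>))\<^sup>2 \<partial>circle_measure) = (\<Sum>m<n. (norm (c m))\<^sup>2 * \<rho> ^ (2 * m))" for c n
    unfolding S_def using \<rho>
    by (subst circle_integral_norm_poly) (auto simp: norm_mult norm_power power_mult_distrib power_mult[symmetric] mult.commute)
  have ci: "integrable circle_measure (\<lambda>\<zeta>. (norm (S c n \<zeta>))\<^sup>2)" for c n
    unfolding S_def by (intro circle_integrable_continuous continuous_intros)
  have le': "(\<Sum>m<n. (norm (a m))\<^sup>2 * \<rho> ^ (2 * m)) \<le> (\<Sum>m<n. (norm (b m))\<^sup>2 * \<rho> ^ (2 * m)) + (C + \<tau> n + \<sigma> n)" for n
  proof -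
    have "(\<integral>\<zeta>. (norm (S a n \<zeta>))\<^sup>2 \<partial>circle_measure) \<le> (\<integral>\<zeta>. (norm (S b n \<zeta>))\<^sup>2 + (C + \<tau> n + \<sigma> n) \<partial>circle_measure)"
    proof (rule integral_mono_AE)
      show "AE \<zeta> in circle_measure. (norm (S a n \<zeta>))\<^sup>2 \<le> (norm (S b n \<zeta>))\<^sup>2 + (C + \<tau> n + \<sigma> n)"
        using AE_circle_norm
      proof eventually_elim
        case (elim \<zeta>)
        then have "(norm (f (\<rho> * \<zeta>)))\<^sup>2 \<le> (norm (g (\<rho> * \<zeta>)))\<^sup>2 + C"
          using \<rho> by (intro le) (simp add: norm_mult)
        then show ?case using \<tau>(2)[OF elim, of n] \<sigma>(2)[OF elim, of n] by linarith
      qed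
    qed (auto intro: ci)
    then show ?thesis using I ci by (simp add: I)
  qed
  have "(\<lambda>n. (\<Sum>m<n. (norm (b m))\<^sup>2 * \<rho> ^ (2 * m)) + (C + \<tau> n + \<sigma> n)) \<longlonglongrightarrow>
     (\<Sum>m. (norm (b m))\<^sup>2 * \<rho> ^ (2 * m)) + C"
    using \<tau>(1) \<sigma>(1) summable_LIMSEQ[OF sb] by (auto intro!: tendsto_eq_intros)
  then show "(\<Sum>m. (norm (a m))\<^sup>2 * \<rho> ^ (2 * m)) \<le> (\<Sum>m. (norm (b m))\<^sup>2 * \<rho> ^ (2 * m)) + C"
    using summable_LIMSEQ[OF sa] le' by (intro LIMSEQ_le) auto
qed

section \<open>Completion of a positive kernel\<close>

text \<open>Used three times: for the finitely supported coefficient functions, for the completed space, and for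
an arbitrary given reproducing kernel Hilbert space.\<close>

locale semi_inner_product =
  fixes V :: "('a \<Rightarrow> complex) set"
    and B :: "('a \<Rightarrow> complex) \<Rightarrow> ('a \<Rightarrow> complex) \<Rightarrow> complex"
  assumes add_closed: "f \<in> V \<Longrightarrow> g \<in> V \<Longrightarrow> (\<lambda>x. f x + g x) \<in> V"
    and scale_closed: "f \<in> V \<Longrightarrow> (\<lambda>x. c * f x) \<in> V"
    and add_left: "f \<in> V \<Longrightarrow> g \<in> V \<Longrightarrow> h \<in> V \<Longrightarrow> B (\<lambda>x. f x + g x) h = B f h + B g h"
    and scale_left: "f \<in> V \<Longrightarrow> h \<in> V \<Longrightarrow> B (\<lambda>x. c * f x) h = c * B f h"
    and hermitian: "f \<in> V \<Longrightarrow> g \<in> V \<Longrightarrow> B g f = cnj (B f g)"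
    and nonneg: "f \<in> V \<Longrightarrow> 0 \<le> Re (B f f)"
begin

definition snorm :: "('a \<Rightarrow> complex) \<Rightarrow> real" where "snorm f = sqrt (Re (B f f))"

lemma snorm_nonneg: "f \<in> V \<Longrightarrow> 0 \<le> snorm f"
  by (simp add: snorm_def nonneg)

lemma snorm_square: "f \<in> V \<Longrightarrow> (snorm f)\<^sup>2 = Re (B f f)"
  by (simp add: snorm_def nonneg)

lemma add_right: "f \<in> V \<Longrightarrow> g \<in> V \<Longrightarrow> h \<in> V \<Longrightarrow> B h (\<lambda>x. f x + g x) = B h f + B h g"
  by (simp add: hermitian[of _ h] add_closed add_left)

lemma scale_right: "f \<in> V \<Longrightarrow> h \<in> V \<Longrightarrow> B h (\<lambda>x. c * f x) = cnj c * B h f"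
  by (simp add: hermitian[of _ h] scale_closed scale_left)

lemma diff_closed: "f \<in> V \<Longrightarrow> g \<in> V \<Longrightarrow> (\<lambda>x. f x - g x) \<in> V"
  using add_closed[of f "\<lambda>x. (-1) * g x"] scale_closed[of g "-1"] by simp

lemma diff_left: "f \<in> V \<Longrightarrow> g \<in> V \<Longrightarrow> h \<in> V \<Longrightarrow> B (\<lambda>x. f x - g x) h = B f h - B g h"
  using add_left[of f "\<lambda>x. (-1) * g x" h] scale_closed[of g "-1"] scale_left[of g h "-1"] by simp

lemma diff_right: "f \<in> V \<Longrightarrow> g \<in> V \<Longrightarrow> h \<in> V \<Longrightarrow> B h (\<lambda>x. f x - g x) = B h f - B h g"
  by (simp add: hermitian[of _ h] diff_closed diff_left)

lemma expand_square:
  assumes "f \<in> V" "g \<in> V"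
  shows "Re (B (\<lambda>x. f x + t * g x) (\<lambda>x. f x + t * g x))
    = Re (B f f) + 2 * Re (cnj t * B f g) + (norm t)\<^sup>2 * Re (B g g)"
proof -
  have "B (\<lambda>x. f x + t * g x) (\<lambda>x. f x + t * g x)
     = B f f + cnj t * B f g + (t * B g f + t * cnj t * B g g)"
    using assms by (simp add: add_closed scale_closed add_left add_right scale_left scale_right algebra_simps)
  moreover have "Re (t * B g f) = Re (cnj t * B f g)"
    using assms by (simp add: hermitian[of f g])
  moreover have "t * cnj t = of_real ((norm t)\<^sup>2)"
    by (simp only: complex_norm_square)
  ultimately show ?thesis by simp
qed

text \<open>The form may be degenerate. Then the quadratic polynomial in \<open>s\<close> below is linear, and being
nonnegative for all \<open>s\<close> it has slope \<open>0\<close>.\<close>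

lemma Cauchy_Schwarz_square:
  assumes f: "f \<in> V" and g: "g \<in> V"
  shows "(norm (B f g))\<^sup>2 \<le> Re (B f f) * Re (B g g)"
proof -
  define x where "x = (norm (B f g))\<^sup>2"
  have q: "0 \<le> Re (B f f) - 2 * s * x + s\<^sup>2 * x * Re (B g g)" for s :: real
  proof -
    define t where "t = - of_real s * B f g"
    have "cnj t * B f g = of_real (- s * x)"
      unfolding t_def x_def of_real_mult complex_norm_square by simp
    then have "Re (cnj t * B f g) = - s * x" by simp
    moreover have "(norm t)\<^sup>2 = s\<^sup>2 * x"
      by (simp add: t_def x_def norm_mult power_mult_distrib)
    ultimately show ?thesis
      using nonneg[of "\<lambda>x. f x + t * g x"] f g
      by (simp add: add_closed scale_closed expand_square)
  qed
  have x: "0 \<le> x" by (simp add: x_def)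
  show ?thesis
  proof (cases "Re (B g g) = 0")
    case True
    have "x = 0"
    proof (rule ccontr)
      assume "x \<noteq> 0"
      then show False using q[of "(Re (B f f) + 1) / (2 * x)"] True x by (simp add: field_simps)
    qed
    then show ?thesis using True by (simp add: x_def)
  next
    case False
    then have "0 < Re (B g g)" using nonneg[OF g] by simp
    then show ?thesis
      using q[of "1 / Re (B g g)"] unfolding x_def[symmetric] by (simp add: field_simps power2_eq_square)
  qed
qed

lemma Cauchy_Schwarz: "f \<in> V \<Longrightarrow> g \<in> V \<Longrightarrow> norm (B f g) \<le> snorm f * snorm g"
  unfolding snorm_def real_sqrt_mult[symmetric]
  by (intro real_le_rsqrt Cauchy_Schwarz_square)

lemma snorm_triangle:
  assumes "f \<in> V" "g \<in> V"
  shows "snorm (\<lambda>x. f x + g x) \<le> snorm f + snorm g"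
proof (rule power2_le_imp_le)
  have "(snorm (\<lambda>x. f x + g x))\<^sup>2 = (snorm f)\<^sup>2 + 2 * Re (B f g) + (snorm g)\<^sup>2"
    using expand_square[OF assms, of 1] assms by (simp add: snorm_square add_closed)
  also have "Re (B f g) \<le> snorm f * snorm g"
    using Cauchy_Schwarz[OF assms] complex_Re_le_cmod[of "B f g"] by linarith
  finally show "(snorm (\<lambda>x. f x + g x))\<^sup>2 \<le> (snorm f + snorm g)\<^sup>2" by (simp add: power2_sum)
  show "0 \<le> snorm f + snorm g" using assms by (simp add: snorm_nonneg)
qed

lemma snorm_scale: "f \<in> V \<Longrightarrow> snorm (\<lambda>x. c * f x) = norm c * snorm f"
proof -
  assume f: "f \<in> V"
  have "B (\<lambda>x. c * f x) (\<lambda>x. c * f x) = of_real ((norm c)\<^sup>2) * B f f"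
    using f by (simp add: scale_closed scale_left scale_right mult.assoc[symmetric] del: of_real_power)
      (metis complex_norm_square)
  then show ?thesis by (simp add: snorm_def real_sqrt_mult)
qed

lemma snorm_diff_commute: "f \<in> V \<Longrightarrow> g \<in> V \<Longrightarrow> snorm (\<lambda>x. f x - g x) = snorm (\<lambda>x. g x - f x)"
  using snorm_scale[of "\<lambda>x. f x - g x" "-1"] by (simp add: diff_closed)

lemma snorm_diff_triangle:
  assumes "f \<in> V" "g \<in> V" "h \<in> V"
  shows "snorm (\<lambda>x. f x - h x) \<le> snorm (\<lambda>x. f x - g x) + snorm (\<lambda>x. g x - h x)"
  using snorm_triangle[of "\<lambda>x. f x - g x" "\<lambda>x. g x - h x"] assms by (simp add: diff_closed)

definition snorm_Cauchy :: "(nat \<Rightarrow> 'a \<Rightarrow> complex) \<Rightarrow> bool" where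
  "snorm_Cauchy c \<longleftrightarrow> (\<forall>n. c n \<in> V) \<and>
     (\<forall>e>0. \<exists>M. \<forall>m\<ge>M. \<forall>n\<ge>M. snorm (\<lambda>x. c m x - c n x) < e)"

lemma snorm_Cauchy_bounded:
  assumes "snorm_Cauchy c" obtains C where "0 < C" "\<And>n. snorm (c n) \<le> C"
proof -
  from assms obtain M where M: "\<And>m n. m \<ge> M \<Longrightarrow> n \<ge> M \<Longrightarrow> snorm (\<lambda>x. c m x - c n x) < 1"
    unfolding snorm_Cauchy_def by (meson zero_less_one)
  have V: "c n \<in> V" for n using assms by (simp add: snorm_Cauchy_def)
  have "snorm (c n) \<le> 1 + (\<Sum>m\<le>M. snorm (c m))" for n
  proof (cases "n \<le> M")
    case True
    then have "snorm (c n) \<le> (\<Sum>m\<le>M. snorm (c m))"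
      using V by (intro member_le_sum) (auto simp: snorm_nonneg)
    then show ?thesis by simp
  next
    case False
    have "snorm (c n) \<le> snorm (\<lambda>x. c n x - c M x) + snorm (c M)"
      using snorm_triangle[of "\<lambda>x. c n x - c M x" "c M"] V by (simp add: diff_closed)
    moreover have "snorm (c M) \<le> (\<Sum>m\<le>M. snorm (c m))"
      using V by (intro member_le_sum) (auto simp: snorm_nonneg)
    ultimately show ?thesis using M[of n M] False by simp
  qed
  moreover have "0 < 1 + (\<Sum>m\<le>M. snorm (c m))"
    using V by (intro add_pos_nonneg sum_nonneg) (auto simp: snorm_nonneg)
  ultimately show ?thesis using that by blast
qed

lemma snorm_Cauchy_add: 
  assumes "snorm_Cauchy c" "snorm_Cauchy d" 
  shows "snorm_Cauchy (\<lambda>n x. c n x + d n x)"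
  unfolding snorm_Cauchy_def
proof (intro conjI allI impI)
  have V: "c n \<in> V" "d n \<in> V" for n using assms by (auto simp: snorm_Cauchy_def)
  show "(\<lambda>x. c n x + d n x) \<in> V" for n using V by (intro add_closed)
  fix e :: real assume "e > 0"
  then have "e / 2 > 0" by simp
  then obtain M1 M2 where M: "\<And>m n. m \<ge> M1 \<Longrightarrow> n \<ge> M1 \<Longrightarrow> snorm (\<lambda>x. c m x - c n x) < e/2"
     "\<And>m n. m \<ge> M2 \<Longrightarrow> n \<ge> M2 \<Longrightarrow> snorm (\<lambda>x. d m x - d n x) < e/2"
    using assms unfolding snorm_Cauchy_def by meson
  have "snorm (\<lambda>x. (c m x + d m x) - (c n x + d n x)) < e" if "m \<ge> max M1 M2" "n \<ge> max M1 M2" for m n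
    using snorm_triangle[of "\<lambda>x. c m x - c n x" "\<lambda>x. d m x - d n x"] M(1)[of m n] M(2)[of m n] that V
    by (simp add: diff_closed algebra_simps)
  then show "\<exists>M. \<forall>m\<ge>M. \<forall>n\<ge>M. snorm (\<lambda>x. (c m x + d m x) - (c n x + d n x)) < e" by blast
qed

lemma snorm_Cauchy_scale:
  assumes "snorm_Cauchy c" shows "snorm_Cauchy (\<lambda>n x. a * c n x)"
  unfolding snorm_Cauchy_def
proof (intro conjI allI impI)
  have V: "c n \<in> V" for n using assms by (auto simp: snorm_Cauchy_def)
  show "(\<lambda>x. a * c n x) \<in> V" for n using V by (intro scale_closed)
  fix e :: real assume "e > 0"
  then have "e / (norm a + 1) > 0" by (simp add: add_nonneg_pos)
  then obtain M where M: "\<And>m n. m \<ge> M \<Longrightarrow> n \<ge> M \<Longrightarrow> snorm (\<lambda>x. c m x - c n x) < e / (norm a + 1)"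
    using assms unfolding snorm_Cauchy_def by meson
  have "snorm (\<lambda>x. a * c m x - a * c n x) < e" if "m \<ge> M" "n \<ge> M" for m n
  proof -
    have "snorm (\<lambda>x. a * c m x - a * c n x) = norm a * snorm (\<lambda>x. c m x - c n x)"
      using snorm_scale[of "\<lambda>x. c m x - c n x" a] V by (simp add: diff_closed algebra_simps)
    also have "\<dots> \<le> (norm a + 1) * snorm (\<lambda>x. c m x - c n x)"
      using V by (simp add: diff_closed snorm_nonneg algebra_simps)
    also have "\<dots> < e"
      using M[OF that] pos_less_divide_eq[of "norm a + 1"] by (simp add: mult.commute add_nonneg_pos)
    finally show ?thesis .
  qed
  then show "\<exists>M. \<forall>m\<ge>M. \<forall>n\<ge>M. snorm (\<lambda>x. a * c m x - a * c n x) < e" by blast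
qed

lemma snorm_Cauchy_diff:
  assumes "snorm_Cauchy c" "snorm_Cauchy d" shows "snorm_Cauchy (\<lambda>n x. c n x - d n x)"
  using snorm_Cauchy_add[OF assms(1) snorm_Cauchy_scale[OF assms(2), of "-1"]] by simp

lemma snorm_Cauchy_B_convergent:
  assumes "snorm_Cauchy c" "snorm_Cauchy d"
  shows "convergent (\<lambda>n. B (c n) (d n))"
proof -
  have V: "c n \<in> V" "d n \<in> V" for n using assms by (auto simp: snorm_Cauchy_def)
  obtain C where C: "C > 0" "\<And>n. snorm (c n) \<le> C" using snorm_Cauchy_bounded[OF assms(1)] by blast
  obtain D where D: "D > 0" "\<And>n. snorm (d n) \<le> D" using snorm_Cauchy_bounded[OF assms(2)] by blast
  have "Cauchy (\<lambda>n. B (c n) (d n))"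
  proof (rule CauchyI)
    fix e :: real assume e: "e > 0"
    have "e / (2 * D) > 0" "e / (2 * C) > 0" using e C D by auto
    then have "\<exists>M. \<forall>m\<ge>M. \<forall>n\<ge>M. snorm (\<lambda>x. c m x - c n x) < e / (2 * D)"
      "\<exists>M. \<forall>m\<ge>M. \<forall>n\<ge>M. snorm (\<lambda>x. d m x - d n x) < e / (2 * C)"
      using assms unfolding snorm_Cauchy_def by simp_all
    then obtain M1 M2 where M: "\<And>m n. m \<ge> M1 \<Longrightarrow> n \<ge> M1 \<Longrightarrow> snorm (\<lambda>x. c m x - c n x) < e / (2 * D)"
       "\<And>m n. m \<ge> M2 \<Longrightarrow> n \<ge> M2 \<Longrightarrow> snorm (\<lambda>x. d m x - d n x) < e / (2 * C)"
      by blast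
    have "norm (B (c m) (d m) - B (c n) (d n)) < e" if mn: "m \<ge> max M1 M2" "n \<ge> max M1 M2" for m n
    proof -
      have eq: "B (c m) (d m) - B (c n) (d n) = B (\<lambda>x. c m x - c n x) (d m) + B (c n) (\<lambda>x. d m x - d n x)"
        using V by (simp add: diff_left diff_right)
      have "norm (B (c m) (d m) - B (c n) (d n)) \<le> snorm (\<lambda>x. c m x - c n x) * snorm (d m) + snorm (c n) * snorm (\<lambda>x. d m x - d n x)"
        unfolding eq by (rule order_trans[OF norm_triangle_ineq add_mono[OF Cauchy_Schwarz Cauchy_Schwarz]])
           (use V in \<open>simp_all add: diff_closed\<close>)
      also have "\<dots> < e"
      proof -
        have "snorm (\<lambda>x. c m x - c n x) * snorm (d m) \<le> snorm (\<lambda>x. c m x - c n x) * D"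
          using D(2) V by (intro mult_left_mono snorm_nonneg diff_closed)
        also have "\<dots> < e / (2 * D) * D"
          using M(1)[of m n] mn D(1) by (intro mult_strict_right_mono) auto
        also have "\<dots> = e / 2" using D(1) by simp
        finally have 1: "snorm (\<lambda>x. c m x - c n x) * snorm (d m) < e / 2" .
        have "snorm (c n) * snorm (\<lambda>x. d m x - d n x) \<le> C * snorm (\<lambda>x. d m x - d n x)"
          using C(2) V by (intro mult_right_mono snorm_nonneg diff_closed)
        also have "\<dots> < C * (e / (2 * C))"
          using M(2)[of m n] mn C(1) by (intro mult_strict_left_mono) auto
        also have "\<dots> = e / 2" using C(1) by simp
        finally show ?thesis using 1 by linarith
      qed
      finally show ?thesis .
    qed
    then show "\<exists>M. \<forall>m\<ge>M. \<forall>n\<ge>M. norm (B (c m) (d m) - B (c n) (d n)) < e" by blast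
  qed
  then show ?thesis by (simp add: Cauchy_convergent_iff)
qed

lemma snorm_Cauchy_null_B:
  assumes "snorm_Cauchy c" "snorm_Cauchy d" "(\<lambda>n. snorm (c n)) \<longlonglongrightarrow> 0"
  shows "(\<lambda>n. B (c n) (d n)) \<longlonglongrightarrow> 0" "(\<lambda>n. B (d n) (c n)) \<longlonglongrightarrow> 0"
proof -
  have V: "c n \<in> V" "d n \<in> V" for n using assms by (auto simp: snorm_Cauchy_def)
  obtain D where D: "D > 0" "\<And>n. snorm (d n) \<le> D" using snorm_Cauchy_bounded[OF assms(2)] by blast
  have le: "norm (B (c n) (d n)) \<le> snorm (c n) * D" for n
    using Cauchy_Schwarz[of "c n" "d n"] V D mult_left_mono[OF D(2), of "snorm (c n)" n] by (simp add: snorm_nonneg)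
  have lim: "(\<lambda>n. snorm (c n) * D) \<longlonglongrightarrow> 0" using assms(3) by (auto intro!: tendsto_eq_intros)
  show "(\<lambda>n. B (c n) (d n)) \<longlonglongrightarrow> 0"
    by (rule Lim_null_comparison[OF _ lim]) (simp add: le)
  show "(\<lambda>n. B (d n) (c n)) \<longlonglongrightarrow> 0"
    by (rule Lim_null_comparison[OF _ lim]) (simp add: le V hermitian[of "c _" "d _"])
qed

end

sublocale function_hilbert_space \<subseteq> semi_inner_product H ip
proof
  show "0 \<le> Re (ip f f)" if "f \<in> H" for f
  proof (cases "f = (\<lambda>_. 0)")
    case True
    then show ?thesis using ip_scale_left[OF zero_mem zero_mem, of 0] by simp
  qed (use ip_pos[OF that] in simp)
qed (rule add_mem scale_mem ip_add_left ip_scale_left ip_cnj; assumption)+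

locale positive_kernel =
  fixes X :: "'a set" and K :: "'a \<Rightarrow> 'a \<Rightarrow> complex"
  assumes kernel_hermitian: "w \<in> X \<Longrightarrow> z \<in> X \<Longrightarrow> K z w = cnj (K w z)"
    and kernel_positive: "finite S \<Longrightarrow> S \<subseteq> X \<Longrightarrow> 0 \<le> Re (\<Sum>w\<in>S. \<Sum>z\<in>S. c w * cnj (c z) * K w z)"
begin

definition supp :: "('a \<Rightarrow> complex) \<Rightarrow> 'a set" where "supp c = {x. c x \<noteq> 0}"

definition coeffs :: "('a \<Rightarrow> complex) set" where
  "coeffs = {c. finite (supp c) \<and> supp c \<subseteq> X}"

text \<open>The coefficient function \<open>c\<close> stands for the formal sum of the kernel functions at \<open>w\<close> with weights
\<open>c w\<close>. Working with \<open>c\<close> instead of the function it induces makes the form below well defined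
although different \<open>c\<close> can induce the same function.\<close>

definition comb :: "('a \<Rightarrow> complex) \<Rightarrow> 'a \<Rightarrow> complex" where
  "comb c z = (if z \<in> X then \<Sum>w\<in>supp c. c w * K w z else 0)"

definition form :: "('a \<Rightarrow> complex) \<Rightarrow> ('a \<Rightarrow> complex) \<Rightarrow> complex" where
  "form c d = (\<Sum>z\<in>supp d. cnj (d z) * comb c z)"

lemma comb_eq: "finite S \<Longrightarrow> supp c \<subseteq> S \<Longrightarrow> z \<in> X \<Longrightarrow> comb c z = (\<Sum>w\<in>S. c w * K w z)"
  unfolding comb_def by (auto intro!: sum.mono_neutral_left simp: supp_def)

lemma form_eq:
  "finite S \<Longrightarrow> supp d \<subseteq> S \<Longrightarrow> form c d = (\<Sum>z\<in>S. cnj (d z) * comb c z)"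
  unfolding form_def by (auto intro!: sum.mono_neutral_left simp: supp_def)

lemma form_double:
  assumes "finite S" "supp c \<subseteq> S" "supp d \<subseteq> S" "S \<subseteq> X"
  shows "form c d = (\<Sum>w\<in>S. \<Sum>z\<in>S. c w * cnj (d z) * K w z)"
proof -
  have "form c d = (\<Sum>z\<in>S. \<Sum>w\<in>S. c w * cnj (d z) * K w z)"
    unfolding form_eq[OF assms(1,3)] using assms
    by (intro sum.cong refl) (auto simp: comb_eq[of S] sum_distrib_left mult_ac)
  then show ?thesis by (subst sum.swap)
qed

lemma supp_add: "supp (\<lambda>x. c x + d x) \<subseteq> supp c \<union> supp d"
  and supp_scale: "supp (\<lambda>x. a * c x) \<subseteq> supp c"
  by (auto simp: supp_def)

lemma comb_add:
  assumes "c \<in> coeffs" "d \<in> coeffs"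
  shows "comb (\<lambda>x. c x + d x) z = comb c z + comb d z"
proof (cases "z \<in> X")
  case True
  let ?S = "supp c \<union> supp d"
  have f: "finite ?S" using assms by (auto simp: coeffs_def)
  show ?thesis
    using comb_eq[OF f supp_add True] comb_eq[OF f _ True, of c] comb_eq[OF f _ True, of d]
    by (simp add: sum.distrib algebra_simps)
qed (simp add: comb_def)

lemma comb_scale:
  assumes "c \<in> coeffs" shows "comb (\<lambda>x. a * c x) z = a * comb c z"
proof (cases "z \<in> X")
  case True
  have f: "finite (supp c)" using assms by (auto simp: coeffs_def)
  show ?thesis
    using comb_eq[OF f supp_scale True] comb_eq[OF f _ True, of c] by (simp add: sum_distrib_left mult_ac)
qed (simp add: comb_def)

sublocale coeff: semi_inner_product coeffs form
proof
  fix c d e :: "'a \<Rightarrow> complex" and a :: complex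
  assume c: "c \<in> coeffs"
  show "(\<lambda>x. a * c x) \<in> coeffs"
    using c supp_scale[of a c] by (auto simp: coeffs_def intro: finite_subset)
  show "0 \<le> Re (form c c)"
    using c kernel_positive[of "supp c" c] form_double[of "supp c" c c] by (simp add: coeffs_def)
  assume d: "d \<in> coeffs"
  show "(\<lambda>x. c x + d x) \<in> coeffs"
    using c d supp_add[of c d] unfolding coeffs_def by (auto intro: finite_subset)
  show "form (\<lambda>x. a * c x) d = a * form c d"
    using c by (simp add: form_def comb_scale sum_distrib_left mult_ac)
  show "form d c = cnj (form c d)"
  proof -
    let ?S = "supp c \<union> supp d"
    have f: "finite ?S" "?S \<subseteq> X" using c d by (auto simp: coeffs_def)
    have "form d c = (\<Sum>w\<in>?S. \<Sum>z\<in>?S. d w * cnj (c z) * K w z)"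
      using f by (intro form_double) auto
    also have "\<dots> = (\<Sum>w\<in>?S. \<Sum>z\<in>?S. d w * cnj (c z) * cnj (K z w))"
      by (intro sum.cong refl, subst kernel_hermitian) (use f in auto)
    also have "\<dots> = (\<Sum>z\<in>?S. \<Sum>w\<in>?S. d w * cnj (c z) * cnj (K z w))"
      by (rule sum.swap)
    also have "\<dots> = cnj (form c d)"
      using form_double[of ?S c d] f by (simp add: mult_ac)
    finally show ?thesis .
  qed
  assume "e \<in> coeffs"
  show "form (\<lambda>x. c x + d x) e = form c e + form d e"
    using c d by (simp add: form_def comb_add sum.distrib algebra_simps)
qed

definition represents :: "(nat \<Rightarrow> 'a \<Rightarrow> complex) \<Rightarrow> ('a \<Rightarrow> complex) \<Rightarrow> bool" where
  "represents c f \<longleftrightarrow> coeff.snorm_Cauchy c \<and> (\<forall>z. (\<lambda>n. comb (c n) z) \<longlonglongrightarrow> f z)"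

definition kernel_space :: "('a \<Rightarrow> complex) set" where
  "kernel_space = {f. \<exists>c. represents c f}"

definition kernel_inner :: "('a \<Rightarrow> complex) \<Rightarrow> ('a \<Rightarrow> complex) \<Rightarrow> complex" where
  "kernel_inner f g = lim (\<lambda>n. form ((SOME c. represents c f) n) ((SOME d. represents d g) n))"

text \<open>The crucial point of the completion: the norm is determined by the pointwise limit. Pairing the tail of the
sequence with one fixed combination only evaluates the functions at finitely many points, so these
pairings tend to \<open>0\<close>.\<close>

lemma represents_zero_null:
  assumes r: "represents c (\<lambda>_. 0)"
  shows "(\<lambda>n. coeff.snorm (c n)) \<longlonglongrightarrow> 0"
proof (rule LIMSEQ_I)
  fix e :: real assume e: "e > 0"
  have Ca: "coeff.snorm_Cauchy c" and z: "\<And>z. (\<lambda>n. comb (c n) z) \<longlonglongrightarrow> 0"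
    using r by (auto simp: represents_def)
  have V: "c n \<in> coeffs" for n using Ca by (auto simp: coeff.snorm_Cauchy_def)
  obtain C where C: "C > 0" "\<And>n. coeff.snorm (c n) \<le> C" using coeff.snorm_Cauchy_bounded[OF Ca] by blast
  have "e\<^sup>2 / (2 * C) > 0" using e C by simp
  then obtain M where M: "\<And>m n. m \<ge> M \<Longrightarrow> n \<ge> M \<Longrightarrow> coeff.snorm (\<lambda>x. c m x - c n x) < e\<^sup>2 / (2 * C)"
    using Ca unfolding coeff.snorm_Cauchy_def by meson
  have "coeff.snorm (c n) < e" if n: "n \<ge> M" for n
  proof -
    have lim: "(\<lambda>m. form (c m) (c n)) \<longlonglongrightarrow> 0"
      unfolding form_def by (rule tendsto_eq_intros | rule z | simp)+
    have bound: "norm (form (c n) (c n) - form (c m) (c n)) \<le> e\<^sup>2 / 2" if m: "m \<ge> M" for m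
    proof -
      have "norm (form (c n) (c n) - form (c m) (c n)) = norm (form (\<lambda>x. c n x - c m x) (c n))"
        using V by (simp add: coeff.diff_left)
      also have "\<dots> \<le> coeff.snorm (\<lambda>x. c n x - c m x) * coeff.snorm (c n)"
        using V by (intro coeff.Cauchy_Schwarz coeff.diff_closed)
      also have "\<dots> \<le> (e\<^sup>2 / (2 * C)) * C"
        using M[OF n m] C V by (intro mult_mono) (auto simp: coeff.snorm_nonneg coeff.diff_closed)
      finally show ?thesis using C by simp
    qed
    have "(\<lambda>m. norm (form (c n) (c n) - form (c m) (c n))) \<longlonglongrightarrow> norm (form (c n) (c n) - 0)"
      by (intro tendsto_intros lim)
    then have "norm (form (c n) (c n)) \<le> e\<^sup>2 / 2"
      using bound by (intro tendsto_upperbound[of "\<lambda>m. norm (form (c n) (c n) - form (c m) (c n))"])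
        (auto simp: eventually_sequentially intro!: exI[of _ M])
    then have "(coeff.snorm (c n))\<^sup>2 \<le> e\<^sup>2 / 2"
      using complex_Re_le_cmod[of "form (c n) (c n)"] V[of n] by (simp add: coeff.snorm_square)
    moreover have "e\<^sup>2 / 2 < e\<^sup>2" using e by simp
    ultimately show ?thesis using e by (meson le_less_trans power_less_imp_less_base less_imp_le)
  qed
  then show "\<exists>M. \<forall>n\<ge>M. norm (coeff.snorm (c n) - 0) < e"
    using V coeff.snorm_nonneg by (auto intro!: exI[of _ M])
qed

lemma represents_add: "represents c f \<Longrightarrow> represents d g \<Longrightarrow> represents (\<lambda>n x. c n x + d n x) (\<lambda>x. f x + g x)"
  unfolding represents_def
  by (auto simp: coeff.snorm_Cauchy_add comb_add coeff.snorm_Cauchy_def[of c] coeff.snorm_Cauchy_def[of d] intro!: tendsto_add)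

lemma represents_scale: "represents c f \<Longrightarrow> represents (\<lambda>n x. a * c n x) (\<lambda>x. a * f x)"
  unfolding represents_def
  by (auto simp: coeff.snorm_Cauchy_scale comb_scale coeff.snorm_Cauchy_def[of c] intro!: tendsto_mult)

lemma represents_diff: "represents c f \<Longrightarrow> represents d g \<Longrightarrow> represents (\<lambda>n x. c n x - d n x) (\<lambda>x. f x - g x)"
  using represents_add[OF _ represents_scale[of d g "-1"], of c f] by simp

lemma represents_const: "c \<in> coeffs \<Longrightarrow> represents (\<lambda>_. c) (comb c)"
proof -
  assume c: "c \<in> coeffs"
  have "coeff.snorm (\<lambda>x. c x - c x) = 0" using coeff.snorm_scale[OF c, of 0] by simp
  then show ?thesis using c by (auto simp: represents_def coeff.snorm_Cauchy_def)
qed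

text \<open>The inner product, defined through arbitrarily chosen representing sequences, can be computed with any of them.\<close>

lemma inner_represents:
  assumes c: "represents c f" and d: "represents d g"
  shows "(\<lambda>n. form (c n) (d n)) \<longlonglongrightarrow> kernel_inner f g"
proof -
  define c' where "c' = (SOME c. represents c f)"
  define d' where "d' = (SOME d. represents d g)"
  have c': "represents c' f" and d': "represents d' g"
    unfolding c'_def d'_def using c d by (metis someI_ex)+
  note cs = c[unfolded represents_def, THEN conjunct1] d[unfolded represents_def, THEN conjunct1]
    c'[unfolded represents_def, THEN conjunct1] d'[unfolded represents_def, THEN conjunct1]
  have V: "c n \<in> coeffs" "d n \<in> coeffs" "c' n \<in> coeffs" "d' n \<in> coeffs" for n
    using cs by (auto simp: coeff.snorm_Cauchy_def)
  have lim: "(\<lambda>n. form (c' n) (d' n)) \<longlonglongrightarrow> kernel_inner f g"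
    using coeff.snorm_Cauchy_B_convergent[OF cs(3,4)]
    unfolding kernel_inner_def c'_def[symmetric] d'_def[symmetric] by (simp add: convergent_LIMSEQ_iff)
  have n1: "(\<lambda>n. coeff.snorm (\<lambda>x. c n x - c' n x)) \<longlonglongrightarrow> 0"
    using represents_diff[OF c c'] by (intro represents_zero_null) simp
  have n2: "(\<lambda>n. coeff.snorm (\<lambda>x. d n x - d' n x)) \<longlonglongrightarrow> 0"
    using represents_diff[OF d d'] by (intro represents_zero_null) simp
  have "(\<lambda>n. form (\<lambda>x. c n x - c' n x) (d n) + form (c' n) (\<lambda>x. d n x - d' n x) + form (c' n) (d' n))
      \<longlonglongrightarrow> 0 + 0 + kernel_inner f g"
    by (intro tendsto_add lim coeff.snorm_Cauchy_null_B(1)[OF coeff.snorm_Cauchy_diff[OF cs(1,3)] cs(2) n1]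
         coeff.snorm_Cauchy_null_B(2)[OF coeff.snorm_Cauchy_diff[OF cs(2,4)] cs(3) n2])
  then show ?thesis using V by (simp add: coeff.diff_left coeff.diff_right)
qed

lemma inner_eqI: "represents c f \<Longrightarrow> represents d g \<Longrightarrow> (\<lambda>n. form (c n) (d n)) \<longlonglongrightarrow> L \<Longrightarrow> kernel_inner f g = L"
  using inner_represents LIMSEQ_unique by blast

lemma space_obtain:
  assumes "f \<in> kernel_space" obtains c where "represents c f" "\<And>n. c n \<in> coeffs"
  using assms unfolding kernel_space_def represents_def coeff.snorm_Cauchy_def by auto

sublocale space: semi_inner_product kernel_space kernel_inner
proof
  fix f g h :: "'a \<Rightarrow> complex" and a :: complex
  assume f: "f \<in> kernel_space"
  obtain c where c: "represents c f" "\<And>n. c n \<in> coeffs" using space_obtain[OF f] by blast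
  show "(\<lambda>x. a * f x) \<in> kernel_space"
    using represents_scale[OF c(1)] by (auto simp: kernel_space_def)
  show "0 \<le> Re (kernel_inner f f)"
    using tendsto_Re[OF inner_represents[OF c(1) c(1)]] coeff.nonneg[OF c(2)]
    by (intro tendsto_lowerbound[of _ _ sequentially]) auto
  assume g: "g \<in> kernel_space"
  obtain d where d: "represents d g" "\<And>n. d n \<in> coeffs" using space_obtain[OF g] by blast
  show "(\<lambda>x. f x + g x) \<in> kernel_space"
    using represents_add[OF c(1) d(1)] by (auto simp: kernel_space_def)
  show "kernel_inner (\<lambda>x. a * f x) g = a * kernel_inner f g"
    by (rule inner_eqI[OF represents_scale[OF c(1)] d(1)])
       (use c d in \<open>simp add: coeff.scale_left tendsto_mult_left inner_represents\<close>)
  show "kernel_inner g f = cnj (kernel_inner f g)"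
    by (rule inner_eqI[OF d(1) c(1)])
       (use c d in \<open>simp add: coeff.hermitian[of "c _" "d _"] tendsto_cnj inner_represents\<close>)
  assume h: "h \<in> kernel_space"
  obtain e where e: "represents e h" "\<And>n. e n \<in> coeffs" using space_obtain[OF h] by blast
  show "kernel_inner (\<lambda>x. f x + g x) h = kernel_inner f h + kernel_inner g h"
    by (rule inner_eqI[OF represents_add[OF c(1) d(1)] e(1)])
       (use c d e in \<open>simp add: coeff.add_left tendsto_add inner_represents\<close>)
qed

lemma comb_mem: "c \<in> coeffs \<Longrightarrow> comb c \<in> kernel_space"
  using represents_const by (auto simp: kernel_space_def)

lemma inner_comb:
  assumes f: "f \<in> kernel_space" and c: "c \<in> coeffs"
  shows "kernel_inner f (comb c) = (\<Sum>z\<in>supp c. cnj (c z) * f z)"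
proof -
  obtain d where d: "represents d f" using space_obtain[OF f] by blast
  then have "(\<lambda>n. comb (d n) z) \<longlonglongrightarrow> f z" for z by (simp add: represents_def)
  then show ?thesis
    by (intro inner_eqI[OF d represents_const[OF c]]) (auto simp: form_def intro!: tendsto_intros)
qed

lemma kernel_section:
  assumes w: "w \<in> X"
  shows "(\<lambda>x. if x \<in> X then K w x else 0) \<in> kernel_space"
    and "f \<in> kernel_space \<Longrightarrow> kernel_inner f (\<lambda>x. if x \<in> X then K w x else 0) = f w"
proof -
  define c where "c = (\<lambda>x. if x = w then 1 else 0 :: complex)"
  have s: "supp c = {w}" by (auto simp: supp_def c_def)
  have c: "c \<in> coeffs" using w by (simp add: coeffs_def s)
  have comb: "comb c = (\<lambda>x. if x \<in> X then K w x else 0)"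
    by (auto simp: comb_def s fun_eq_iff) (simp add: c_def)
  show "(\<lambda>x. if x \<in> X then K w x else 0) \<in> kernel_space" using comb_mem[OF c] comb by simp
  show "kernel_inner f (\<lambda>x. if x \<in> X then K w x else 0) = f w" if "f \<in> kernel_space"
    using inner_comb[OF that c] comb by (simp add: s) (simp add: c_def)
qed

lemma evaluation_bound:
  assumes f: "f \<in> kernel_space" and w: "w \<in> X"
  shows "norm (f w) \<le> space.snorm f * sqrt (Re (K w w))"
proof -
  let ?k = "\<lambda>x. if x \<in> X then K w x else 0"
  have "norm (f w) \<le> space.snorm f * space.snorm ?k"
    using space.Cauchy_Schwarz[OF f kernel_section(1)[OF w]] kernel_section(2)[OF w f] by simp
  moreover have "space.snorm ?k = sqrt (Re (K w w))"
    unfolding space.snorm_def kernel_section(2)[OF w kernel_section(1)[OF w]] using w by simp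
  ultimately show ?thesis by simp
qed

lemma space_vanishes_outside: "f \<in> kernel_space \<Longrightarrow> x \<notin> X \<Longrightarrow> f x = 0"
proof -
  assume f: "f \<in> kernel_space" and x: "x \<notin> X"
  obtain c where c: "represents c f" using space_obtain[OF f] by blast
  then have "(\<lambda>n. comb (c n) x) \<longlonglongrightarrow> f x" by (simp add: represents_def)
  then show "f x = 0" using x by (simp add: comb_def LIMSEQ_const_iff)
qed

lemma represents_dist:
  assumes c: "represents c f"
  shows "(\<lambda>m. space.snorm (\<lambda>x. f x - comb (c m) x)) \<longlonglongrightarrow> 0"
proof (rule LIMSEQ_I)
  fix e :: real assume e: "e > 0"
  have Ca: "coeff.snorm_Cauchy c" using c by (simp add: represents_def)
  have V: "c n \<in> coeffs" for n using Ca by (auto simp: coeff.snorm_Cauchy_def)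
  have f: "f \<in> kernel_space" using c by (auto simp: kernel_space_def)
  have "e / 2 > 0" using e by simp
  then obtain M where M: "\<And>m n. m \<ge> M \<Longrightarrow> n \<ge> M \<Longrightarrow> coeff.snorm (\<lambda>x. c m x - c n x) < e / 2"
    using Ca unfolding coeff.snorm_Cauchy_def by meson
  have "space.snorm (\<lambda>x. f x - comb (c m) x) \<le> e / 2" if m: "m \<ge> M" for m
  proof -
    have r: "represents (\<lambda>k x. c k x - c m x) (\<lambda>x. f x - comb (c m) x)"
      using represents_diff[OF c represents_const[OF V]] .
    have "(\<lambda>k. coeff.snorm (\<lambda>x. c k x - c m x)) \<longlonglongrightarrow> space.snorm (\<lambda>x. f x - comb (c m) x)"
      unfolding coeff.snorm_def space.snorm_def by (intro tendsto_intros inner_represents r)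
    then show ?thesis
      using M[OF _ m] by (intro tendsto_upperbound[of "\<lambda>k. coeff.snorm (\<lambda>x. c k x - c m x)"])
        (auto simp: eventually_sequentially intro!: exI[of _ M] less_imp_le)
  qed
  then have "norm (space.snorm (\<lambda>x. f x - comb (c m) x) - 0) < e" if "m \<ge> M" for m
    using that e space.snorm_nonneg[OF space.diff_closed[OF f comb_mem[OF V[of m]]]] by fastforce
  then show "\<exists>M. \<forall>m\<ge>M. norm (space.snorm (\<lambda>x. f x - comb (c m) x) - 0) < e" by blast
qed

lemma combs_dense:
  assumes f: "f \<in> kernel_space" and e: "e > 0"
  obtains c where "c \<in> coeffs" "space.snorm (\<lambda>x. f x - comb c x) < e"
proof -
  obtain c where c: "represents c f" "\<And>n. c n \<in> coeffs" using space_obtain[OF f] by blast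
  have "eventually (\<lambda>m. space.snorm (\<lambda>x. f x - comb (c m) x) < e) sequentially"
    using represents_dist[OF c(1)] e by (rule order_tendstoD)
  then obtain m where "space.snorm (\<lambda>x. f x - comb (c m) x) < e"
    by (auto simp: eventually_sequentially)
  then show ?thesis using that[OF c(2)] by blast
qed

text \<open>For completeness, a Cauchy sequence is replaced by kernel combinations that approximate its members;
these converge pointwise, because evaluations are bounded, and so represent the limit.\<close>

lemma Moore_Aronszajn:
  "reproducing_kernel_hilbert_space X kernel_space kernel_inner K"
proof
  show zero: "(\<lambda>_. 0) \<in> kernel_space"
  proof -
    have "comb (\<lambda>_. 0) = (\<lambda>_. 0)" by (simp add: comb_def fun_eq_iff)
    then show ?thesis using comb_mem[of "\<lambda>_. 0"] by (simp add: coeffs_def supp_def)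
  qed
  show "0 < Re (kernel_inner f f)" if f: "f \<in> kernel_space" "f \<noteq> (\<lambda>_. 0)" for f
  proof (rule ccontr)
    assume "\<not> 0 < Re (kernel_inner f f)"
    then have "space.snorm f = 0" using space.nonneg[OF f(1)] by (simp add: space.snorm_def)
    then have "f x = 0" for x
      using evaluation_bound[OF f(1), of x] space_vanishes_outside[OF f(1), of x] by (cases "x \<in> X") auto
    then show False using f(2) by auto
  qed
  fix s :: "nat \<Rightarrow> 'a \<Rightarrow> complex"
  assume s: "\<And>n. s n \<in> kernel_space"
    and "\<And>e. e > 0 \<Longrightarrow> \<exists>M. \<forall>m\<ge>M. \<forall>n\<ge>M.
          sqrt (Re (kernel_inner (\<lambda>x. s m x - s n x) (\<lambda>x. s m x - s n x))) < e"
  then have sC: "\<exists>M. \<forall>m\<ge>M. \<forall>n\<ge>M. space.snorm (\<lambda>x. s m x - s n x) < e" if "e > 0" for e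
    using that by (simp add: space.snorm_def)
  have "\<exists>c. c \<in> coeffs \<and> space.snorm (\<lambda>x. s n x - comb c x) < 1 / real (Suc n)" for n
    using combs_dense[OF s, of "1 / real (Suc n)" n] by auto
  then obtain c where c: "\<And>n. c n \<in> coeffs" "\<And>n. space.snorm (\<lambda>x. s n x - comb (c n) x) < 1 / real (Suc n)"
    by metis
  have comb: "comb (c n) \<in> kernel_space" for n using c by (intro comb_mem)
  have NT: "space.snorm (\<lambda>x. comb (c m) x - comb (c n) x) = coeff.snorm (\<lambda>x. c m x - c n x)" for m n
  proof -
    have "represents (\<lambda>_ x. c m x - c n x) (\<lambda>x. comb (c m) x - comb (c n) x)"
      by (intro represents_diff represents_const c)
    then show ?thesis
      unfolding space.snorm_def coeff.snorm_def by (subst inner_eqI) auto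
  qed
  have inv: "(\<lambda>n. 1 / real (Suc n)) \<longlonglongrightarrow> 0" using LIMSEQ_Suc[OF lim_1_over_n] by simp
  have Ca: "coeff.snorm_Cauchy c"
    unfolding coeff.snorm_Cauchy_def
  proof (intro conjI allI impI c)
    fix e :: real assume e: "e > 0"
    then have e3: "e / 3 > 0" by simp
    obtain M1 where M1: "\<And>m n. m \<ge> M1 \<Longrightarrow> n \<ge> M1 \<Longrightarrow> space.snorm (\<lambda>x. s m x - s n x) < e / 3"
      using sC[OF e3] by blast
    obtain M2 where M2: "\<And>n. n \<ge> M2 \<Longrightarrow> 1 / real (Suc n) < e / 3"
      using order_tendstoD(2)[OF inv e3] by (auto simp: eventually_sequentially)
    have "coeff.snorm (\<lambda>x. c m x - c n x) < e" if "m \<ge> max M1 M2" "n \<ge> max M1 M2" for m n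
    proof -
      have "space.snorm (\<lambda>x. comb (c m) x - comb (c n) x) \<le> space.snorm (\<lambda>x. comb (c m) x - s m x) + space.snorm (\<lambda>x. s m x - comb (c n) x)"
        by (intro space.snorm_diff_triangle comb s)
      moreover have "space.snorm (\<lambda>x. s m x - comb (c n) x) \<le> space.snorm (\<lambda>x. s m x - s n x) + space.snorm (\<lambda>x. s n x - comb (c n) x)"
        by (intro space.snorm_diff_triangle comb s)
      moreover have "space.snorm (\<lambda>x. comb (c m) x - s m x) = space.snorm (\<lambda>x. s m x - comb (c m) x)"
        by (intro space.snorm_diff_commute comb s)
      ultimately show ?thesis
        using c(2)[of m] c(2)[of n] M1[of m n] M2[of m] M2[of n] that unfolding NT by simp
    qed
    then show "\<exists>M. \<forall>m\<ge>M. \<forall>n\<ge>M. coeff.snorm (\<lambda>x. c m x - c n x) < e" by blast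
  qed
  define f where "f = (\<lambda>z. lim (\<lambda>n. comb (c n) z))"
  have "(\<lambda>n. comb (c n) z) \<longlonglongrightarrow> f z" for z
  proof (cases "z \<in> X")
    case True
    have "Cauchy (\<lambda>n. comb (c n) z)"
    proof (rule CauchyI)
      fix e :: real assume e: "e > 0"
      define k where "k = sqrt (Re (K z z)) + 1"
      have "Re (K z z) \<ge> 0" using kernel_positive[of "{z}" "\<lambda>_. 1"] True by simp
      then have k: "k > 0" by (simp add: k_def add_nonneg_pos)
      then obtain M where M: "\<And>m n. m \<ge> M \<Longrightarrow> n \<ge> M \<Longrightarrow> coeff.snorm (\<lambda>x. c m x - c n x) < e / k"
        using Ca e unfolding coeff.snorm_Cauchy_def by (meson divide_pos_pos)
      have "norm (comb (c m) z - comb (c n) z) < e" if "m \<ge> M" "n \<ge> M" for m n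
      proof -
        have "norm (comb (c m) z - comb (c n) z) \<le> space.snorm (\<lambda>x. comb (c m) x - comb (c n) x) * sqrt (Re (K z z))"
          using evaluation_bound[OF space.diff_closed[OF comb comb] True, of m n] by simp
        also have "\<dots> \<le> space.snorm (\<lambda>x. comb (c m) x - comb (c n) x) * k"
          by (intro mult_left_mono space.snorm_nonneg space.diff_closed comb) (simp add: k_def)
        also have "\<dots> < e" using M[OF that] k by (simp add: NT field_simps)
        finally show ?thesis .
      qed
      then show "\<exists>M. \<forall>m\<ge>M. \<forall>n\<ge>M. norm (comb (c m) z - comb (c n) z) < e" by blast
    qed
    then show ?thesis unfolding f_def by (simp add: Cauchy_convergent_iff convergent_LIMSEQ_iff)
  qed (simp add: comb_def f_def)
  then have r: "represents c f" using Ca by (simp add: represents_def)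
  then have f: "f \<in> kernel_space" by (auto simp: kernel_space_def)
  have "(\<lambda>n. space.snorm (\<lambda>x. s n x - f x)) \<longlonglongrightarrow> 0"
  proof (rule tendsto_sandwich[of "\<lambda>_. 0"])
    show "\<forall>\<^sub>F n in sequentially. 0 \<le> space.snorm (\<lambda>x. s n x - f x)"
      by (intro always_eventually allI space.snorm_nonneg space.diff_closed s f)
    have "space.snorm (\<lambda>x. s n x - f x) \<le> 1 / real (Suc n) + space.snorm (\<lambda>x. f x - comb (c n) x)" for n
    proof -
      have "space.snorm (\<lambda>x. s n x - f x) \<le> space.snorm (\<lambda>x. s n x - comb (c n) x) + space.snorm (\<lambda>x. comb (c n) x - f x)"
        by (intro space.snorm_diff_triangle comb s f)
      moreover have "space.snorm (\<lambda>x. comb (c n) x - f x) = space.snorm (\<lambda>x. f x - comb (c n) x)"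
        by (intro space.snorm_diff_commute comb f)
      ultimately show ?thesis using c(2)[of n] by linarith
    qed
    then show "\<forall>\<^sub>F n in sequentially. space.snorm (\<lambda>x. s n x - f x) \<le> 1 / real (Suc n) + space.snorm (\<lambda>x. f x - comb (c n) x)"
      by simp
    show "(\<lambda>n. 1 / real (Suc n) + space.snorm (\<lambda>x. f x - comb (c n) x)) \<longlonglongrightarrow> 0"
      using tendsto_add[OF inv represents_dist[OF r]] by simp
  qed simp
  then show "\<exists>f\<in>kernel_space. (\<lambda>n. sqrt (Re (kernel_inner (\<lambda>x. s n x - f x) (\<lambda>x. s n x - f x)))) \<longlonglongrightarrow> 0"
    unfolding space.snorm_def by (rule bexI[OF _ f])
qed (rule space_vanishes_outside space.add_closed space.scale_closed space.add_left space.scale_left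
    space.hermitian kernel_section; assumption)+

end

section \<open>The Szego form and de Branges--Rovnyak spaces\<close>

lemma power_series_coeffs:
  fixes g :: "complex \<Rightarrow> complex"
  assumes "g holomorphic_on ball 0 R"
  obtains a where "\<And>z. norm z < R \<Longrightarrow> (\<lambda>m. a m * z ^ m) sums g z"
proof (rule that)
  fix z :: complex assume "norm z < R"
  then show "(\<lambda>m. (deriv ^^ m) g 0 / fact m * z ^ m) sums g z"
    using holomorphic_power_series[OF assms, of z] by simp
qed

lemma sum_le_of_radii:
  fixes x :: "nat \<Rightarrow> real"
  assumes x: "\<And>m. 0 \<le> x m"
    and le: "\<And>\<rho>. 0 < \<rho> \<Longrightarrow> \<rho> < 1 \<Longrightarrow> summable (\<lambda>m. x m * \<rho> ^ (2 * m)) \<and> (\<Sum>m. x m * \<rho> ^ (2 * m)) \<le> B"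
  shows "(\<Sum>m<M. x m) \<le> B"
proof -
  have "((\<lambda>\<rho>. \<Sum>m<M. x m * \<rho> ^ (2 * m)) \<longlongrightarrow> (\<Sum>m<M. x m * 1 ^ (2 * m))) (at_left (1::real))"
    by (intro tendsto_intros)
  moreover have "\<forall>\<^sub>F \<rho> in at_left (1::real). (\<Sum>m<M. x m * \<rho> ^ (2 * m)) \<le> B"
    using eventually_at_left_real[of 0 "1::real", simplified]
  proof eventually_elim
    case (elim \<rho>)
    then have "(\<Sum>m<M. x m * \<rho> ^ (2 * m)) \<le> (\<Sum>m. x m * \<rho> ^ (2 * m))"
      using le[of \<rho>] x by (intro sum_le_suminf) auto
    then show ?case using le[of \<rho>] elim by auto
  qed
  ultimately have "(\<Sum>m<M. x m * 1 ^ (2 * m)) \<le> B"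
    by (intro tendsto_upperbound[of _ _ "at_left (1::real)"]) auto
  then show ?thesis by simp
qed

definition moment :: "complex set \<Rightarrow> (complex \<Rightarrow> complex) \<Rightarrow> nat \<Rightarrow> complex" where
  "moment S c m = (\<Sum>w\<in>S. c w * w ^ m)"

definition szego_form :: "complex set \<Rightarrow> (complex \<Rightarrow> complex) \<Rightarrow> real" where
  "szego_form S c = (\<Sum>m. (norm (moment S c m))\<^sup>2)"

lemma szego_denominator:
  fixes w z :: complex
  assumes "norm w < 1" "norm z < 1"
  shows "norm (cnj w * z) < 1" and "1 - cnj w * z \<noteq> 0"
proof -
  show 1: "norm (cnj w * z) < 1"
    using mult_strict_mono'[OF assms] by (simp add: norm_mult)
  show "1 - cnj w * z \<noteq> 0"
    using 1 by (metis eq_iff_diff_eq_0 norm_one less_irrefl)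
qed

text \<open>The Szego kernel is the sum of the products \<open>w\<^sup>m cnj(z)\<^sup>m\<close>, so its quadratic form is a sum of squared moments:
the squared Hardy space norm of the functional with weights \<open>c\<close> on the points of \<open>S\<close>.\<close>

lemma szego_form_sums:
  assumes S: "finite S" "S \<subseteq> ball 0 1"
  shows "(\<lambda>m. (norm (moment S c m))\<^sup>2) sums szego_form S c"
    and "of_real (szego_form S c) = (\<Sum>w\<in>S. \<Sum>z\<in>S. c w * cnj (c z) / (1 - cnj z * w))"
proof -
  have geo: "(\<lambda>m. (cnj z * w) ^ m) sums (1 / (1 - cnj z * w))" if "w \<in> S" "z \<in> S" for w z
  proof -
    have "norm w < 1" "norm z < 1" using S that by auto
    then show ?thesis by (intro geometric_sums szego_denominator)
  qed
  have "(\<lambda>m. \<Sum>w\<in>S. \<Sum>z\<in>S. (c w * cnj (c z)) * (cnj z * w) ^ m)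
     sums (\<Sum>w\<in>S. \<Sum>z\<in>S. (c w * cnj (c z)) * (1 / (1 - cnj z * w)))"
    by (intro sums_sum sums_mult geo)
  moreover have "(\<Sum>w\<in>S. \<Sum>z\<in>S. (c w * cnj (c z)) * (cnj z * w) ^ m) = of_real ((norm (moment S c m))\<^sup>2)" for m
    unfolding complex_norm_square moment_def
    by (simp add: sum_product power_mult_distrib mult_ac)
  ultimately have s: "(\<lambda>m. of_real ((norm (moment S c m))\<^sup>2))
     sums (\<Sum>w\<in>S. \<Sum>z\<in>S. c w * cnj (c z) / (1 - cnj z * w))" by simp
  have "summable (\<lambda>m. (norm (moment S c m))\<^sup>2)"
    using sums_summable[OF sums_Re[OF s]] by simp
  then show 1: "(\<lambda>m. (norm (moment S c m))\<^sup>2) sums szego_form S c"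
    unfolding szego_form_def by (rule summable_sums)
  then show "of_real (szego_form S c) = (\<Sum>w\<in>S. \<Sum>z\<in>S. c w * cnj (c z) / (1 - cnj z * w))"
    using s sums_of_real[OF 1, where ?'a=complex] sums_unique2 by blast
qed

lemma moment_pairing:
  assumes S: "finite S" "S \<subseteq> ball 0 1"
    and g: "\<And>z. norm z < 1 \<Longrightarrow> (\<lambda>m. a m * z ^ m) sums g z"
  shows "(\<lambda>m. a m * moment S c m) sums (\<Sum>w\<in>S. c w * g w)"
proof -
  have "(\<lambda>m. \<Sum>w\<in>S. c w * (a m * w ^ m)) sums (\<Sum>w\<in>S. c w * g w)"
    using S by (intro sums_sum sums_mult g) auto
  then show ?thesis by (simp add: moment_def sum_distrib_left mult_ac)
qed

lemma norm_sum_mult_le: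
  fixes x y :: "nat \<Rightarrow> complex"
  shows "(norm (\<Sum>m<M. x m * y m))\<^sup>2 \<le> (\<Sum>m<M. (norm (x m))\<^sup>2) * (\<Sum>m<M. (norm (y m))\<^sup>2)"
proof -
  have "(norm (\<Sum>m<M. x m * y m))\<^sup>2 \<le> (\<Sum>m<M. norm (x m) * norm (y m))\<^sup>2"
    by (intro power_mono sum_norm_le) (auto simp: norm_mult)
  also have "\<dots> \<le> (\<Sum>m<M. (norm (x m))\<^sup>2) * (\<Sum>m<M. (norm (y m))\<^sup>2)"
    by (rule Cauchy_Schwarz_ineq_sum)
  finally show ?thesis .
qed

lemma evaluation_le_szego_form:
  assumes S: "finite S" "S \<subseteq> ball 0 1"
    and g: "\<And>z. norm z < 1 \<Longrightarrow> (\<lambda>m. a m * z ^ m) sums g z"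
    and a: "\<And>M. (\<Sum>m<M. (norm (a m))\<^sup>2) \<le> B"
  shows "(norm (\<Sum>w\<in>S. c w * g w))\<^sup>2 \<le> B * szego_form S c"
proof -
  have "(\<lambda>M. (norm (\<Sum>m<M. a m * moment S c m))\<^sup>2) \<longlonglongrightarrow> (norm (\<Sum>w\<in>S. c w * g w))\<^sup>2"
    using moment_pairing[OF S g] unfolding sums_def by (intro tendsto_intros)
  moreover have "(norm (\<Sum>m<M. a m * moment S c m))\<^sup>2 \<le> B * szego_form S c" for M
  proof -
    have "(norm (\<Sum>m<M. a m * moment S c m))\<^sup>2
       \<le> (\<Sum>m<M. (norm (a m))\<^sup>2) * (\<Sum>m<M. (norm (moment S c m))\<^sup>2)"
      by (rule norm_sum_mult_le)
    also have "\<dots> \<le> B * szego_form S c"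
    proof (rule mult_mono[OF a])
      show "(\<Sum>m<M. (norm (moment S c m))\<^sup>2) \<le> szego_form S c"
        using szego_form_sums(1)[OF S, of c] sum_le_suminf[of "\<lambda>m. (norm (moment S c m))\<^sup>2" "{..<M}"]
        by (simp add: sums_iff)
    qed (use a[of 0] in \<open>auto intro: sum_nonneg\<close>)
    finally show ?thesis .
  qed
  ultimately show ?thesis by (intro LIMSEQ_le_const2) auto
qed

text \<open>Multiplication by \<open>b\<close> is a contraction of the Hardy space, hence so is its adjoint, which takes the kernel
function at \<open>w\<close> to \<open>cnj (b w)\<close> times itself. Concretely, \<open>h\<close> below represents the functional with weights
\<open>c b\<close>; evaluating this functional at \<open>h\<close> gives the square of its norm, and it is also the functional with
weights \<open>c\<close> evaluated at \<open>b h\<close>.\<close>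

lemma szego_form_mult_le:
  assumes S: "finite S" "S \<subseteq> ball 0 1"
    and b: "b holomorphic_on ball 0 1" "\<And>z. norm z < 1 \<Longrightarrow> norm (b z) \<le> 1"
  shows "szego_form S (\<lambda>w. c w * b w) \<le> szego_form S c"
proof -
  let ?Q = "szego_form S (\<lambda>w. c w * b w)"
  define a where "a = (\<lambda>m. cnj (moment S (\<lambda>w. c w * b w) m))"
  define h where "h = (\<lambda>z. \<Sum>w\<in>S. cnj (c w * b w) / (1 - cnj w * z))"
  have nz: "1 - cnj w * z \<noteq> 0" if "w \<in> S" "norm z < 1" for w z
    using that S by (intro szego_denominator) auto
  have h: "(\<lambda>m. a m * z ^ m) sums h z" if z: "norm z < 1" for z
  proof -
    have "(\<lambda>m. (cnj w * z) ^ m) sums (1 / (1 - cnj w * z))" if "w \<in> S" for w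
      using S that z by (intro geometric_sums szego_denominator) auto
    then have "(\<lambda>m. \<Sum>w\<in>S. cnj (c w * b w) * (cnj w * z) ^ m) sums (\<Sum>w\<in>S. cnj (c w * b w) * (1 / (1 - cnj w * z)))"
      by (intro sums_sum sums_mult) auto
    then show ?thesis by (simp add: a_def h_def moment_def sum_distrib_left power_mult_distrib mult_ac)
  qed
  have hh: "h holomorphic_on ball 0 1"
    unfolding h_def using nz by (intro holomorphic_intros) auto
  then have "(\<lambda>z. b z * h z) holomorphic_on ball 0 1" by (intro holomorphic_intros b)
  then obtain p where p: "\<And>z. norm z < 1 \<Longrightarrow> (\<lambda>m. p m * z ^ m) sums (b z * h z)"
    using power_series_coeffs by blast
  have a: "(\<lambda>m. (norm (a m))\<^sup>2) sums ?Q" unfolding a_def using szego_form_sums(1)[OF S] by simp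
  have "(\<Sum>m<M. (norm (p m))\<^sup>2) \<le> ?Q" for M
  proof (rule sum_le_of_radii)
    fix \<rho> :: real assume \<rho>: "0 < \<rho>" "\<rho> < 1"
    have "(norm (b z * h z))\<^sup>2 \<le> (norm (h z))\<^sup>2 + 0" if "norm z = \<rho>" for z
      using b(2)[of z] that \<rho> by (auto simp: norm_mult intro!: power_mono mult_left_le_one_le)
    then have *: "summable (\<lambda>m. (norm (p m))\<^sup>2 * \<rho> ^ (2 * m))" "summable (\<lambda>m. (norm (a m))\<^sup>2 * \<rho> ^ (2 * m))"
       "(\<Sum>m. (norm (p m))\<^sup>2 * \<rho> ^ (2 * m)) \<le> (\<Sum>m. (norm (a m))\<^sup>2 * \<rho> ^ (2 * m)) + 0"
      using parseval_compare[of 1 p "\<lambda>z. b z * h z" a h \<rho> 0] p h \<rho> by auto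
    have "(\<Sum>m. (norm (a m))\<^sup>2 * \<rho> ^ (2 * m)) \<le> (\<Sum>m. (norm (a m))\<^sup>2)"
      using \<rho> a *(2) by (intro suminf_le) (auto simp: sums_iff mult_left_le power_le_one)
    then show "summable (\<lambda>m. (norm (p m))\<^sup>2 * \<rho> ^ (2 * m)) \<and> (\<Sum>m. (norm (p m))\<^sup>2 * \<rho> ^ (2 * m)) \<le> ?Q"
      using *(1,3) \<rho> a by (simp add: sums_iff)
  qed simp
  from evaluation_le_szego_form[OF S p this, of c]
  have "(norm (\<Sum>w\<in>S. c w * (b w * h w)))\<^sup>2 \<le> ?Q * szego_form S c" .
  moreover have "(\<Sum>w\<in>S. c w * (b w * h w)) = of_real ?Q"
  proof -
    have "(\<lambda>m. a m * moment S (\<lambda>w. c w * b w) m) sums (\<Sum>w\<in>S. (c w * b w) * h w)"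
      by (rule moment_pairing[OF S h])
    moreover have "(\<lambda>m. of_real ((norm (a m))\<^sup>2)) sums (of_real ?Q :: complex)"
      using a by (rule sums_of_real)
    moreover have "of_real ((norm (a m))\<^sup>2) = a m * moment S (\<lambda>w. c w * b w) m" for m
      unfolding complex_norm_square by (simp add: a_def)
    ultimately show ?thesis using sums_unique2 by (fastforce simp: mult.assoc)
  qed
  ultimately have "?Q * ?Q \<le> ?Q * szego_form S c" by (simp add: power2_eq_square)
  moreover have "0 \<le> ?Q" "0 \<le> szego_form S c"
    using szego_form_sums(1)[OF S] by (auto simp: sums_iff szego_form_def intro!: suminf_nonneg)
  ultimately show ?thesis by (cases "?Q = 0") (auto simp: mult_le_cancel_left)
qed

lemma dbr_form:
  assumes S: "finite S" "S \<subseteq> ball 0 1"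
  shows "(\<Sum>w\<in>S. \<Sum>z\<in>S. c w * cnj (c z) * dbr_kernel b z w)
    = of_real (szego_form S c - szego_form S (\<lambda>w. c w * b w))"
  unfolding of_real_diff szego_form_sums(2)[OF S] sum_subtractf[symmetric]
  by (intro sum.cong refl) (simp add: dbr_kernel_def diff_divide_distrib algebra_simps)

text \<open>The members of the completion are holomorphic, because convergence in norm is uniform where the
diagonal of the kernel is bounded, hence on compact sets.\<close>

lemma zero_mem_de_branges_rovnyak:
  assumes b: "b holomorphic_on ball 0 1" "b ` ball 0 1 \<subseteq> ball 0 1"
  shows "(\<lambda>_. 0) \<in> de_branges_rovnyak b"
proof -
  have b1: "norm (b z) \<le> 1" if "norm z < 1" for z
    using b(2) that by (force intro: less_imp_le)
  interpret positive_kernel "ball 0 1" "dbr_kernel b"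
  proof
    show "dbr_kernel b z w = cnj (dbr_kernel b w z)" for w z
      by (simp add: dbr_kernel_def mult.commute)
    fix S :: "complex set" and c :: "complex \<Rightarrow> complex" assume S: "finite S" "S \<subseteq> ball 0 1"
    have "(\<Sum>w\<in>S. \<Sum>z\<in>S. c w * cnj (c z) * dbr_kernel b w z)
       = (\<Sum>z\<in>S. \<Sum>w\<in>S. cnj (c z) * cnj (cnj (c w)) * dbr_kernel b w z)"
      by (subst sum.swap) (simp add: mult_ac)
    also have "\<dots> = of_real (szego_form S (\<lambda>w. cnj (c w)) - szego_form S (\<lambda>w. cnj (c w) * b w))"
      by (rule dbr_form[OF S])
    finally show "0 \<le> Re (\<Sum>w\<in>S. \<Sum>z\<in>S. c w * cnj (c z) * dbr_kernel b w z)"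
      using szego_form_mult_le[OF S b(1) b1, of "\<lambda>w. cnj (c w)"] by simp
  qed
  have "f holomorphic_on ball 0 1" if f: "f \<in> kernel_space" for f
  proof -
    have "\<exists>c. c \<in> coeffs \<and> space.snorm (\<lambda>x. f x - comb c x) < 1 / real (Suc n)" for n
      using combs_dense[OF f, of "1 / real (Suc n)"] by auto
    then obtain c where c: "\<And>n. c n \<in> coeffs" "\<And>n. space.snorm (\<lambda>x. f x - comb (c n) x) < 1 / real (Suc n)"
      by metis
    show ?thesis
    proof (rule holomorphic_uniform_sequence[of _ "\<lambda>n. comb (c n)"])
      have "(\<lambda>z. \<Sum>w\<in>supp (c n). c n w * dbr_kernel b w z) holomorphic_on ball 0 1" for n
      proof -
        have "1 - cnj w * z \<noteq> 0" if "w \<in> supp (c n)" "norm z < 1" for w z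
          using c(1)[of n] that by (intro szego_denominator) (auto simp: coeffs_def)
        then show ?thesis unfolding dbr_kernel_def by (intro holomorphic_intros b) auto
      qed
      then show "comb (c n) holomorphic_on ball 0 1" for n
        by (rule holomorphic_transform) (simp add: comb_def)
    next
      fix x :: complex assume x: "x \<in> ball 0 1"
      then obtain d where d: "d > 0" "cball x d \<subseteq> ball 0 1" by (metis open_ball open_contains_cball)
      have cont: "continuous_on (cball x d) (\<lambda>z. Re (dbr_kernel b z z))"
      proof -
        have "continuous_on (cball x d) b"
          using b(1) d by (meson holomorphic_on_imp_continuous_on holomorphic_on_subset)
        moreover have "1 - cnj z * z \<noteq> 0" if "z \<in> cball x d" for z
        proof -
          have "norm z < 1" using d that by (meson mem_ball_0 subsetD)
          then show ?thesis by (intro szego_denominator)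
        qed
        ultimately show ?thesis unfolding dbr_kernel_def by (intro continuous_intros) auto
      qed
      then have "bounded ((\<lambda>z. Re (dbr_kernel b z z)) ` cball x d)"
        by (intro compact_imp_bounded compact_continuous_image compact_cball)
      then obtain C where "\<And>z. z \<in> cball x d \<Longrightarrow> \<bar>Re (dbr_kernel b z z)\<bar> \<le> C"
        unfolding bounded_iff by fastforce
      then have C: "Re (dbr_kernel b z z) \<le> C" if "z \<in> cball x d" for z
        using that abs_le_D1 by blast
      have "uniform_limit (cball x d) (\<lambda>n. comb (c n)) f sequentially"
      proof (rule metric_uniform_limit_imp_uniform_limit)
        show "uniform_limit (cball x d) (\<lambda>n z. 1 / real (Suc n) * sqrt \<bar>C\<bar>) (\<lambda>_. 0) sequentially"
        proof (rule uniform_limit_null_comparison[of _ "\<lambda>n _. 1 / real (Suc n) * sqrt \<bar>C\<bar>"])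
          have "(\<lambda>n. 1 / real (Suc n) * sqrt \<bar>C\<bar>) \<longlonglongrightarrow> 0"
            using tendsto_mult_left_zero[OF LIMSEQ_Suc[OF lim_1_over_n]] by simp
          then show "uniform_limit (cball x d) (\<lambda>n z. 1 / real (Suc n) * sqrt \<bar>C\<bar>) (\<lambda>_. 0) sequentially"
            by (simp add: uniform_limit_iff tendsto_iff)
        qed simp
        have "dist (comb (c n) z) (f z) \<le> 1 / real (Suc n) * sqrt \<bar>C\<bar>" if z: "z \<in> cball x d" for n z
        proof -
          have "norm (f z - comb (c n) z) \<le> space.snorm (\<lambda>x. f x - comb (c n) x) * sqrt (Re (dbr_kernel b z z))"
            using evaluation_bound[OF space.diff_closed[OF f comb_mem[OF c(1)]]] z d by blast
          also have "\<dots> \<le> space.snorm (\<lambda>x. f x - comb (c n) x) * sqrt \<bar>C\<bar>"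
            using C[OF z] by (intro mult_left_mono space.snorm_nonneg space.diff_closed f comb_mem c) simp
          also have "\<dots> \<le> 1 / real (Suc n) * sqrt \<bar>C\<bar>"
            using c(2)[of n] by (intro mult_right_mono) auto
          finally show ?thesis by (simp add: dist_norm norm_minus_commute)
        qed
        then show "\<forall>\<^sub>F n in sequentially. \<forall>z\<in>cball x d. dist (comb (c n) z) (f z) \<le> dist (1 / real (Suc n) * sqrt \<bar>C\<bar>) 0"
          by (simp add: dist_norm)
      qed
      then show "\<exists>d>0. cball x d \<subseteq> ball 0 1 \<and> uniform_limit (cball x d) (\<lambda>n. comb (c n)) f sequentially"
        using d by blast
    qed simp
  qed
  then show ?thesis
    unfolding de_branges_rovnyak_def using Moore_Aronszajn
      function_hilbert_space.zero_mem[OF reproducing_kernel_hilbert_space.axioms(1)[OF Moore_Aronszajn]]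
    by blast
qed

lemma sum_roots_of_unity_power:
  assumes L: "0 < L"
  shows "(\<Sum>\<zeta> | \<zeta> ^ L = 1. \<zeta> ^ k) = (if L dvd k then of_nat L else (0::complex))"
proof -
  define \<omega> where "\<omega> = cis (2 * pi / L)"
  have \<omega>: "\<omega> ^ j = cis (2 * pi * j / L)" for j
    by (simp add: \<omega>_def Complex.DeMoivre mult_ac)
  have "(\<Sum>\<zeta> | \<zeta> ^ L = 1. \<zeta> ^ k) = (\<Sum>j<L. (\<omega> ^ j) ^ k)"
    unfolding \<omega> by (rule sum.reindex_bij_betw[OF Complex.bij_betw_roots_unity[OF L], symmetric])
  also have "\<dots> = (\<Sum>j<L. (\<omega> ^ k) ^ j)"
    by (simp add: power_mult[symmetric] mult.commute)
  also have "\<dots> = (if L dvd k then of_nat L else 0)"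
  proof (cases "L dvd k")
    case True
    then obtain q where "k = L * q" by blast
    moreover have "\<omega> ^ L = 1" using L by (simp add: \<omega>)
    ultimately show ?thesis by (simp add: power_mult)
  next
    case False
    have "\<omega> ^ k \<noteq> 1"
    proof
      assume "\<omega> ^ k = 1"
      then have "cis (2 * pi * k / L) = 1" by (simp add: \<omega>)
      then obtain i :: int where "2 * pi * k / L = 2 * pi * i"
        unfolding cis_conv_exp exp_eq_1 by (auto simp: mult_ac)
      then have "real k = i * real L" using L by (simp add: field_simps)
      then have "int k = i * int L" by (metis of_int_eq_iff of_int_mult of_int_of_nat_eq)
      then show False using False by (metis dvd_triv_right int_dvd_int_iff)
    qed
    moreover have "(\<omega> ^ k) ^ L = 1"
    proof -
      have "\<omega> ^ L = 1" using L by (simp add: \<omega>)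
      then show ?thesis by (metis mult.commute power_mult power_one)
    qed
    ultimately show ?thesis using False by (simp add: geometric_sum)
  qed
  finally show ?thesis .
qed

text \<open>The pairing with a polynomial is a limit of finite combinations of point evaluations whose Hardy space
norms converge as well. With the \<open>L\<close>-th roots of unity scaled by \<open>1/2\<close> the first \<open>L\<close> moments come out exactly, and
the aliased ones carry factors \<open>2 powr (- L)\<close>.\<close>

lemma pairing_functional:
  fixes p :: "nat \<Rightarrow> complex"
  shows "\<exists>S c. (\<forall>l::nat. finite (S l) \<and> S l \<subseteq> ball 0 1) \<and>
    (\<lambda>l. szego_form (S l) (c l)) \<longlonglongrightarrow> (\<Sum>m<M. (norm (p m))\<^sup>2) \<and>
    (\<forall>g a. (\<forall>z. norm z < 1 \<longrightarrow> (\<lambda>m. a m * z ^ m) sums g z) \<longrightarrow>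
       (\<lambda>l. \<Sum>w\<in>S l. c l w * g w) \<longlonglongrightarrow> (\<Sum>m<M. a m * cnj (p m)))"
proof -
  define L where "L = (\<lambda>l. Suc (M + l))"
  define S where "S = (\<lambda>l. (\<lambda>\<zeta>. \<zeta> / 2) ` {\<zeta>::complex. \<zeta> ^ L l = 1})"
  define c where "c = (\<lambda>l w. (\<Sum>m<M. cnj (p m) * (2 ^ m * (2 * w) ^ (L l - m))) / of_nat (L l))"
  have fin: "finite {\<zeta>::complex. \<zeta> ^ L l = 1}" for l
    by (rule finite_roots_unity) (simp add: L_def)
  have S: "finite (S l)" "S l \<subseteq> ball 0 1" for l
  proof -
    show "finite (S l)" unfolding S_def using fin by simp
    have "norm \<zeta> = 1" if "\<zeta> ^ L l = 1" for \<zeta> :: complex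
      using power_eq_imp_eq_norm[of \<zeta> "L l" 1] that by (simp add: L_def)
    then show "S l \<subseteq> ball 0 1" unfolding S_def by (auto simp: norm_divide)
  qed
  \<comment> \<open>in the sum over the roots of unity only the exponents divisible by \<open>L\<close> survive\<close>
  have mom: "moment (S l) (c l) n
      = (\<Sum>m<M. if L l dvd (L l - m + n) then cnj (p m) * 2 ^ m / 2 ^ n else 0)" for l n
  proof -
    have "moment (S l) (c l) n = (\<Sum>\<zeta> | \<zeta> ^ L l = 1. c l (\<zeta> / 2) * (\<zeta> / 2) ^ n)"
      unfolding moment_def S_def by (subst sum.reindex) (auto simp: inj_on_def)
    also have "\<dots> = (\<Sum>\<zeta> | \<zeta> ^ L l = 1. \<Sum>m<M. (cnj (p m) * 2 ^ m / 2 ^ n / of_nat (L l)) * \<zeta> ^ (L l - m + n))"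
      by (intro sum.cong refl)
         (simp add: c_def sum_distrib_left sum_distrib_right sum_divide_distrib power_divide power_add mult_ac)
    also have "\<dots> = (\<Sum>m<M. (cnj (p m) * 2 ^ m / 2 ^ n / of_nat (L l)) * (\<Sum>\<zeta> | \<zeta> ^ L l = 1. \<zeta> ^ (L l - m + n)))"
      by (subst sum.swap) (simp add: sum_distrib_left)
    also have "\<dots> = (\<Sum>m<M. if L l dvd (L l - m + n) then cnj (p m) * 2 ^ m / 2 ^ n else 0)"
      by (intro sum.cong refl, subst sum_roots_of_unity_power) (auto simp: L_def simp del: of_nat_Suc)
    finally show ?thesis .
  qed
  have mom_small: "moment (S l) (c l) n = (if n < M then cnj (p n) else 0)" if "n < L l" for l n
  proof -
    have "L l dvd (L l - m + n) \<longleftrightarrow> m = n" if m: "m < M" for m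
    proof
      assume "L l dvd (L l - m + n)"
      then obtain q where q: "L l - m + n = L l * q" by blast
      have b: "0 < L l - m + n" "L l - m + n < L l * 2"
        using m \<open>n < L l\<close> by (auto simp: L_def)
      then have "q = 1" unfolding q by (cases q) auto
      then show "m = n" using q m by (simp add: L_def)
    qed (use that in \<open>auto simp: L_def\<close>)
    then have "moment (S l) (c l) n = (\<Sum>m<M. if m = n then cnj (p m) * 2 ^ m / 2 ^ n else 0)"
      unfolding mom by (intro sum.cong refl) auto
    then show ?thesis by (simp add: sum.delta)
  qed
  define P where "P = (\<Sum>m<M. norm (p m) * 2 ^ m)"
  have mom_le: "norm (moment (S l) (c l) n) \<le> P * (1/2) ^ n" for l n
  proof -
    have "norm (moment (S l) (c l) n) \<le> (\<Sum>m<M. norm (p m) * 2 ^ m * (1/2) ^ n)"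
      unfolding mom
      by (intro sum_norm_le) (auto simp: norm_mult norm_divide norm_power power_one_over divide_simps)
    then show ?thesis by (simp add: P_def sum_distrib_right)
  qed
  have P0: "0 \<le> P" by (simp add: P_def sum_nonneg)
  have mom_lim: "(\<lambda>l. moment (S l) (c l) n) \<longlonglongrightarrow> (if n < M then cnj (p n) else 0)" for n
  proof (rule tendsto_eventually)
    show "\<forall>\<^sub>F l in sequentially. moment (S l) (c l) n = (if n < M then cnj (p n) else 0)"
      using eventually_gt_at_top[of n] by eventually_elim (intro mom_small, simp add: L_def)
  qed
  show ?thesis
  proof (intro exI[of _ S] exI[of _ c] conjI allI impI S)
    have "(\<lambda>l. \<Sum>n. (norm (moment (S l) (c l) n))\<^sup>2) \<longlonglongrightarrow> (\<Sum>n. (norm (if n < M then cnj (p n) else 0))\<^sup>2)"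
    proof (rule tannerys_theorem[of _ _ _ "\<lambda>n. (P * (1/2) ^ n)\<^sup>2", THEN conjunct2, THEN conjunct2])
      show "(\<lambda>l. (norm (moment (S l) (c l) n))\<^sup>2) \<longlonglongrightarrow> (norm (if n < M then cnj (p n) else 0))\<^sup>2" for n
        by (intro tendsto_intros mom_lim)
      show "\<forall>\<^sub>F (n, l) in sequentially \<times>\<^sub>F sequentially. norm ((norm (moment (S l) (c l) n))\<^sup>2) \<le> (P * (1/2) ^ n)\<^sup>2"
        using mom_le by (intro always_eventually) (auto intro!: power_mono)
      have "summable (\<lambda>n. P\<^sup>2 * (1/4) ^ n)" by (intro summable_mult summable_geometric) simp
      moreover have "((1/2::real) ^ n)\<^sup>2 = (1/4) ^ n" for n
        by (simp add: power2_eq_square power_mult_distrib[symmetric])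
      ultimately show "summable (\<lambda>n. (P * (1/2) ^ n)\<^sup>2)"
        by (simp add: power_mult_distrib)
    qed simp
    also have "(\<Sum>n. (norm (if n < M then cnj (p n) else 0))\<^sup>2) = (\<Sum>n<M. (norm (p n))\<^sup>2)"
      by (subst suminf_finite[of "{..<M}"]) auto
    finally show "(\<lambda>l. szego_form (S l) (c l)) \<longlonglongrightarrow> (\<Sum>m<M. (norm (p m))\<^sup>2)"
      by (simp add: szego_form_def)
  next
    fix g :: "complex \<Rightarrow> complex" and a
    assume "\<forall>z. norm z < 1 \<longrightarrow> (\<lambda>m. a m * z ^ m) sums g z"
    then have g: "(\<lambda>m. a m * z ^ m) sums g z" if "norm z < 1" for z using that by blast
    have "summable (\<lambda>m. a m * (3/4) ^ m)" using g[of "3/4"] by (simp add: sums_iff)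
    from powser_insidea[OF this, of "1/2"] have sm: "summable (\<lambda>m. norm (a m) * (1/2) ^ m)"
      by (simp add: norm_mult norm_power norm_divide)
    have "(\<lambda>l. \<Sum>n. a n * moment (S l) (c l) n) \<longlonglongrightarrow> (\<Sum>n. a n * (if n < M then cnj (p n) else 0))"
    proof (rule tannerys_theorem[of _ _ _ "\<lambda>n. P * (norm (a n) * (1/2) ^ n)", THEN conjunct2, THEN conjunct2])
      show "(\<lambda>l. a n * moment (S l) (c l) n) \<longlonglongrightarrow> a n * (if n < M then cnj (p n) else 0)" for n
        by (intro tendsto_intros mom_lim)
      show "\<forall>\<^sub>F (n, l) in sequentially \<times>\<^sub>F sequentially. norm (a n * moment (S l) (c l) n) \<le> P * (norm (a n) * (1/2) ^ n)"
      proof (intro always_eventually allI, clarify)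
        fix n l show "norm (a n * moment (S l) (c l) n) \<le> P * (norm (a n) * (1/2) ^ n)"
          using mult_left_mono[OF mom_le[of l n], of "norm (a n)"] by (simp add: norm_mult mult_ac)
      qed
      show "summable (\<lambda>n. P * (norm (a n) * (1/2) ^ n))" by (intro summable_mult sm)
    qed simp
    also have "(\<Sum>n. a n * (if n < M then cnj (p n) else 0)) = (\<Sum>n<M. a n * cnj (p n))"
      by (subst suminf_finite[of "{..<M}"]) auto
    also have "(\<lambda>l. \<Sum>n. a n * moment (S l) (c l) n) = (\<lambda>l. \<Sum>w\<in>S l. c l w * g w)"
      using moment_pairing[OF S g] by (simp add: sums_iff)
    finally show "(\<lambda>l. \<Sum>w\<in>S l. c l w * g w) \<longlonglongrightarrow> (\<Sum>m<M. a m * cnj (p m))" .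
  qed
qed

text \<open>Cauchy--Schwarz for \<open>f\<close> and the combination of kernel functions that represents the functional with weights \<open>c\<close>.\<close>

lemma dbr_evaluation_le:
  assumes R: "reproducing_kernel_hilbert_space (ball 0 1) H ip (dbr_kernel b)"
    and f: "f \<in> H" and S: "finite S" "S \<subseteq> ball 0 1"
  shows "(norm (\<Sum>w\<in>S. c w * f w))\<^sup>2
    \<le> Re (ip f f) * (szego_form S c - szego_form S (\<lambda>w. c w * b w))"
proof -
  interpret reproducing_kernel_hilbert_space "ball 0 1" H ip "dbr_kernel b" by (rule R)
  define k where "k = (\<lambda>w x. if x \<in> ball 0 1 then dbr_kernel b w x else 0)"
  have k: "k w \<in> H" if "w \<in> S" for w
    using kernel_mem[of w] S that by (auto simp: k_def)
  have rep: "ip u (k w) = u w" if "u \<in> H" "w \<in> S" for u w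
    using reproducing[of w u] S that by (auto simp: k_def)
  have comb: "(\<lambda>x. \<Sum>w\<in>A. cnj (c w) * k w x) \<in> H \<and>
      (\<forall>u\<in>H. ip u (\<lambda>x. \<Sum>w\<in>A. cnj (c w) * k w x) = (\<Sum>w\<in>A. c w * u w))"
    if "finite A" "A \<subseteq> S" for A
    using that
  proof (induction A rule: finite_induct)
    case empty
    have "ip u (\<lambda>x. 0) = 0" if "u \<in> H" for u
      using scale_right[OF zero_mem that, of 0] by simp
    then show ?case using zero_mem by simp
  next
    case (insert w A)
    then have IH: "(\<lambda>x. \<Sum>w\<in>A. cnj (c w) * k w x) \<in> H"
      "\<And>u. u \<in> H \<Longrightarrow> ip u (\<lambda>x. \<Sum>w\<in>A. cnj (c w) * k w x) = (\<Sum>w\<in>A. c w * u w)" and w: "w \<in> S"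
      by auto
    have sc: "(\<lambda>x. cnj (c w) * k w x) \<in> H" by (rule scale_mem[OF k[OF w]])
    have e: "(\<lambda>x. \<Sum>w\<in>insert w A. cnj (c w) * k w x) = (\<lambda>x. cnj (c w) * k w x + (\<Sum>w\<in>A. cnj (c w) * k w x))"
      using insert by simp
    show ?case
      unfolding e using insert.hyps add_mem[OF sc IH(1)]
      by (auto simp: add_right[OF sc IH(1)] scale_right[OF k[OF w]] rep[OF _ w] IH(2))
  qed
  define u where "u = (\<lambda>x. \<Sum>w\<in>S. cnj (c w) * k w x)"
  have u: "u \<in> H" "\<And>v. v \<in> H \<Longrightarrow> ip v u = (\<Sum>w\<in>S. c w * v w)"
    using comb[OF S(1) order_refl] by (auto simp: u_def)
  have "ip u u = (\<Sum>w\<in>S. \<Sum>z\<in>S. c w * cnj (c z) * dbr_kernel b z w)"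
    unfolding u(2)[OF u(1)] using S
    by (intro sum.cong refl) (auto simp: u_def k_def sum_distrib_left mult_ac intro!: sum.cong)
  also have "\<dots> = of_real (szego_form S c - szego_form S (\<lambda>w. c w * b w))"
    by (rule dbr_form[OF S])
  finally have "Re (ip u u) = szego_form S c - szego_form S (\<lambda>w. c w * b w)" by simp
  then show ?thesis
    using Cauchy_Schwarz_square[OF f u(1)] u(2)[OF f] by simp
qed

text \<open>For a functional with weights \<open>c\<close> close to the pairing with \<open>p = b h\<close>, the Szego form of \<open>c\<close> is near
\<open>\<sigma>\<close>, the square sum of the coefficients of \<open>p\<close>. The form of \<open>c b\<close>, which is subtracted, is at least \<open>\<sigma>\<^sup>2 / B\<close>: test it on
\<open>h\<close>. What remains is \<open>\<sigma> - \<sigma>\<^sup>2 / B \<le> B - \<sigma>\<close>.\<close>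

lemma dbr_pairing_le:
  assumes R: "reproducing_kernel_hilbert_space (ball 0 1) H ip (dbr_kernel b)"
    and f: "f \<in> H" "\<And>z. norm z < 1 \<Longrightarrow> (\<lambda>m. a m * z ^ m) sums f z"
    and h: "\<And>z. norm z < 1 \<Longrightarrow> (\<lambda>m. e m * z ^ m) sums h z" "\<And>M. (\<Sum>m<M. (norm (e m))\<^sup>2) \<le> B"
    and p: "\<And>z. norm z < 1 \<Longrightarrow> (\<lambda>m. p m * z ^ m) sums (b z * h z)"
  shows "(norm (\<Sum>m<M. a m * cnj (p m)))\<^sup>2 \<le> Re (ip f f) * (B - (\<Sum>m<M. (norm (p m))\<^sup>2))"
proof -
  define \<sigma> where "\<sigma> = (\<Sum>m<M. (norm (p m))\<^sup>2)"
  define x where "x = (norm (\<Sum>m<M. a m * cnj (p m)))\<^sup>2"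
  have \<sigma>0: "0 \<le> \<sigma>" by (simp add: \<sigma>_def sum_nonneg)
  have B0: "0 \<le> B" using h(2)[of 0] by simp
  interpret reproducing_kernel_hilbert_space "ball 0 1" H ip "dbr_kernel b" by (rule R)
  have A0: "0 \<le> Re (ip f f)" by (rule nonneg[OF f(1)])
  obtain S c where S': "\<forall>l::nat. finite (S l) \<and> S l \<subseteq> ball 0 1"
    and Q: "(\<lambda>l. szego_form (S l) (c l)) \<longlonglongrightarrow> \<sigma>"
    and ev': "\<forall>g a. (\<forall>z. norm z < 1 \<longrightarrow> (\<lambda>m. a m * z ^ m) sums g z) \<longrightarrow>
       (\<lambda>l. \<Sum>w\<in>S l. c l w * g w) \<longlonglongrightarrow> (\<Sum>m<M. a m * cnj (p m))"
    using pairing_functional[of p M, folded \<sigma>_def] by (elim exE conjE) (rule that)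
  have S: "finite (S l)" "S l \<subseteq> ball 0 1" for l using S' by auto
  have ev: "(\<lambda>l. \<Sum>w\<in>S l. c l w * g w) \<longlonglongrightarrow> (\<Sum>m<M. a m * cnj (p m))"
    if "\<And>z. norm z < 1 \<Longrightarrow> (\<lambda>m. a m * z ^ m) sums g z" for g a
    using ev' that by blast
  have pp: "(\<Sum>m<M. p m * cnj (p m)) = of_real \<sigma>"
    unfolding \<sigma>_def of_real_sum complex_norm_square ..
  have lim_f: "(\<lambda>l. (norm (\<Sum>w\<in>S l. c l w * f w))\<^sup>2) \<longlonglongrightarrow> x"
    unfolding x_def by (intro tendsto_intros ev f)
  have "(\<lambda>l. (norm (\<Sum>w\<in>S l. c l w * (b w * h w)))\<^sup>2) \<longlonglongrightarrow> (norm (of_real \<sigma> :: complex))\<^sup>2"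
    unfolding pp[symmetric] by (intro tendsto_intros ev p)
  then have lim_p: "(\<lambda>l. (norm (\<Sum>w\<in>S l. c l w * (b w * h w)))\<^sup>2) \<longlonglongrightarrow> \<sigma>\<^sup>2"
    by simp
  have le_h: "(norm (\<Sum>w\<in>S l. c l w * (b w * h w)))\<^sup>2 \<le> B * szego_form (S l) (\<lambda>w. c l w * b w)" for l
    using evaluation_le_szego_form[OF S(1)[of l] S(2)[of l] h, where c = "\<lambda>w. c l w * b w"] by (simp add: mult.assoc)
  have le_f: "(norm (\<Sum>w\<in>S l. c l w * f w))\<^sup>2
      \<le> Re (ip f f) * (szego_form (S l) (c l) - szego_form (S l) (\<lambda>w. c l w * b w))" for l
    by (rule dbr_evaluation_le[OF R f(1) S])
  have "B * (norm (\<Sum>w\<in>S l. c l w * f w))\<^sup>2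
      \<le> Re (ip f f) * (B * szego_form (S l) (c l) - (norm (\<Sum>w\<in>S l. c l w * (b w * h w)))\<^sup>2)" for l
  proof -
    have "B * (norm (\<Sum>w\<in>S l. c l w * f w))\<^sup>2
      \<le> B * (Re (ip f f) * (szego_form (S l) (c l) - szego_form (S l) (\<lambda>w. c l w * b w)))"
      by (intro mult_left_mono le_f B0)
    also have "\<dots> = Re (ip f f) * (B * szego_form (S l) (c l) - B * szego_form (S l) (\<lambda>w. c l w * b w))"
      by (simp add: algebra_simps)
    also have "\<dots> \<le> Re (ip f f) * (B * szego_form (S l) (c l) - (norm (\<Sum>w\<in>S l. c l w * (b w * h w)))\<^sup>2)"
      by (intro mult_left_mono A0 diff_left_mono le_h)
    finally show ?thesis .
  qed
  then have 1: "B * x \<le> Re (ip f f) * (B * \<sigma> - \<sigma>\<^sup>2)"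
    by (intro LIMSEQ_le[of "\<lambda>l. B * (norm (\<Sum>w\<in>S l. c l w * f w))\<^sup>2" _
         "\<lambda>l. Re (ip f f) * (B * szego_form (S l) (c l) - (norm (\<Sum>w\<in>S l. c l w * (b w * h w)))\<^sup>2)"]
         tendsto_intros lim_f lim_p Q) auto
  have "(norm (\<Sum>w\<in>S l. c l w * f w))\<^sup>2 \<le> Re (ip f f) * szego_form (S l) (c l)" for l
  proof -
    have "0 \<le> szego_form (S l) (\<lambda>w. c l w * b w)"
      using szego_form_sums(1)[OF S] by (auto simp: szego_form_def sums_iff intro!: suminf_nonneg)
    then show ?thesis
      using le_f[of l] mult_left_mono[OF _ A0, of "szego_form (S l) (c l) - szego_form (S l) (\<lambda>w. c l w * b w)"
          "szego_form (S l) (c l)"] by linarith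
  qed
  then have 2: "x \<le> Re (ip f f) * \<sigma>"
    by (intro LIMSEQ_le[OF lim_f tendsto_mult_left[OF Q]]) auto
  have "x \<le> Re (ip f f) * (B - \<sigma>)"
  proof (cases "\<sigma> = 0 \<or> Re (ip f f) = 0")
    case True
    then show ?thesis using 2 A0 B0 by (auto intro: order_trans[of x 0])
  next
    case False
    then have s: "\<sigma> > 0" "Re (ip f f) > 0" using \<sigma>0 A0 by auto
    have "0 \<le> B * x" using B0 by (simp add: x_def)
    then have "0 \<le> Re (ip f f) * (\<sigma> * (B - \<sigma>))" using 1 by (simp add: algebra_simps power2_eq_square)
    then have le: "\<sigma> \<le> B" using s by (simp add: zero_le_mult_iff)
    then have B: "B > 0" using s by simp
    have "B * x \<le> (Re (ip f f) * (B - \<sigma>)) * \<sigma>" using 1 by (simp add: algebra_simps power2_eq_square)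
    also have "\<dots> \<le> (Re (ip f f) * (B - \<sigma>)) * B" using le A0 by (intro mult_left_mono) auto
    finally show ?thesis using B by (simp add: mult.commute[of B])
  qed
  then show ?thesis by (simp add: x_def \<sigma>_def)
qed

section \<open>A factor that is nearly 1 and its companion\<close>

text \<open>Chebyshev's inequality for a geometric sum with \<open>K\<close> terms in \<open>\<zeta>\<^sup>N\<close>: its mean square is \<open>K\<close> whatever \<open>N\<close>
is, and it is at least \<open>K / 2\<close> on the set in question.\<close>

lemma circle_measure_near_roots:
  assumes N: "0 < N" and K: "0 < K"
  shows "measure circle_measure {\<zeta>. norm (\<zeta> ^ N - 1) \<le> 1 / real K} \<le> 4 / real K"
proof -
  define E where "E = {\<zeta>::complex. norm (\<zeta> ^ N - 1) \<le> 1 / real K}"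
  define D where "D = (\<lambda>\<zeta>::complex. \<Sum>m\<in>(\<lambda>j. N * j) ` {..<K}. 1 * \<zeta> ^ m)"
  have Dj: "D \<zeta> = (\<Sum>j<K. (\<zeta> ^ N) ^ j)" for \<zeta>
    unfolding D_def using N by (subst sum.reindex) (auto simp: inj_on_def power_mult)
  have E: "E \<in> sets borel"
    unfolding E_def by (intro borel_closed closed_Collect_le continuous_intros)
  have "(\<integral>\<zeta>. (norm (D \<zeta>))\<^sup>2 \<partial>circle_measure) = (\<Sum>m\<in>(\<lambda>j. N * j) ` {..<K}. (norm (1::complex))\<^sup>2)"
    unfolding D_def by (rule circle_integral_norm_poly) simp
  also have "\<dots> = real K"
    using N by (simp add: card_image inj_on_def)
  finally have I: "(\<integral>\<zeta>. (norm (D \<zeta>))\<^sup>2 \<partial>circle_measure) = real K" .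
  have Di: "integrable circle_measure (\<lambda>\<zeta>. (norm (D \<zeta>))\<^sup>2)"
    unfolding D_def by (intro circle_integrable_continuous continuous_intros)
  have big: "real K / 2 \<le> norm (D \<zeta>)" if "norm \<zeta> = 1" "\<zeta> \<in> E" for \<zeta>
  proof -
    have n1: "norm (\<zeta> ^ N) = 1" using that by (simp add: norm_power)
    have "D \<zeta> - of_nat K = (\<Sum>j<K. (\<zeta> ^ N) ^ j - 1 ^ j)" by (simp add: Dj sum_subtractf)
    also have "norm \<dots> \<le> (\<Sum>j<K. real j * (1 / real K))"
    proof (rule sum_norm_le)
      fix j
      have "norm ((\<zeta> ^ N) ^ j - 1 ^ j) \<le> real j * norm (\<zeta> ^ N - 1)"
        using n1 by (intro norm_power_diff) auto
      also have "\<dots> \<le> real j * (1 / real K)"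
        using that by (intro mult_left_mono) (auto simp: E_def)
      finally show "norm ((\<zeta> ^ N) ^ j - 1 ^ j) \<le> real j * (1 / real K)" .
    qed
    also have "\<dots> = (\<Sum>j<K. real j) / real K" by (simp add: sum_divide_distrib)
    also have "(\<Sum>j<K. real j) \<le> real K * real K / 2"
    proof (induction K)
      case (Suc K) then show ?case by (simp add: field_simps)
    qed simp
    then have "(\<Sum>j<K. real j) / real K \<le> real K / 2" using K by (simp add: field_simps)
    finally have "norm (D \<zeta> - of_nat K) \<le> real K / 2" by simp
    then show ?thesis
      using norm_triangle_ineq2[of "of_nat K" "of_nat K - D \<zeta>"] by (simp add: norm_minus_commute)
  qed
  have "measure circle_measure E = (\<integral>\<zeta>. indicator E \<zeta> \<partial>circle_measure)"
    using E by simp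
  also have "\<dots> \<le> (\<integral>\<zeta>. (norm (D \<zeta>))\<^sup>2 * (4 / (real K)\<^sup>2) \<partial>circle_measure)"
  proof (rule integral_mono_AE)
    show "integrable circle_measure (indicat_real E)"
      using E by (intro circle_integrable[of _ 1]) (auto simp: indicator_def)
    show "AE \<zeta> in circle_measure. indicator E \<zeta> \<le> (norm (D \<zeta>))\<^sup>2 * (4 / (real K)\<^sup>2)"
      using AE_circle_norm
    proof eventually_elim
      case (elim \<zeta>)
      show ?case
      proof (cases "\<zeta> \<in> E")
        case True
        have "(real K / 2)\<^sup>2 \<le> (norm (D \<zeta>))\<^sup>2" using big[OF elim True] by (intro power_mono) auto
        then show ?thesis using True K by (simp add: field_simps power2_eq_square)
      qed simp
    qed
  qed (use Di in auto)
  also have "\<dots> = real K * (4 / (real K)\<^sup>2)" using I Di by simp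
  also have "\<dots> = 4 / real K" using K by (simp add: field_simps power2_eq_square)
  finally show ?thesis unfolding E_def .
qed

text \<open>\<open>J\<close> times the analytic function whose real part on the circle is the Fejer kernel of order \<open>J\<close>.\<close>

definition fejer_sum :: "nat \<Rightarrow> complex \<Rightarrow> complex" where
  "fejer_sum J w = (\<Sum>j<J. 1 + 2 * (\<Sum>n=1..j. w ^ n))"

lemma fejer_sum_0 [simp]: "fejer_sum J 0 = of_nat J"
  by (simp add: fejer_sum_def power_0_left)

lemma continuous_fejer_sum [continuous_intros]:
  "continuous_on A f \<Longrightarrow> continuous_on A (\<lambda>x. fejer_sum J (f x))"
  unfolding fejer_sum_def by (intro continuous_intros)

lemma holomorphic_fejer_sum: "fejer_sum J holomorphic_on A"
  unfolding fejer_sum_def[abs_def] by (intro holomorphic_intros)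

lemma Re_fejer_sum:
  assumes w: "norm w = 1"
  shows "Re (fejer_sum J w) = (norm (\<Sum>j<J. w ^ j))\<^sup>2"
proof (induction J)
  case (Suc J)
  have cw: "cnj w * w = 1" using complex_norm_square[of w] w by (simp add: mult.commute)
  have "cnj (\<Sum>j<J. w ^ j) * w ^ J = (\<Sum>j<J. w ^ (J - j))"
    unfolding cnj_sum sum_distrib_right
  proof (intro sum.cong refl)
    fix j assume j: "j \<in> {..<J}"
    then have "w ^ J = w ^ j * w ^ (J - j)" by (simp add: power_add[symmetric])
    then show "cnj (w ^ j) * w ^ J = w ^ (J - j)"
      by (simp add: mult.assoc[symmetric] power_mult_distrib[symmetric] cw)
  qed
  also have "\<dots> = (\<Sum>n=1..J. w ^ n)"
    by (rule sum.reindex_bij_witness[of _ "\<lambda>n. J - n" "\<lambda>j. J - j"]) auto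
  finally have e: "cnj (\<Sum>j<J. w ^ j) * w ^ J = (\<Sum>n=1..J. w ^ n)" .
  have "(norm (\<Sum>j<Suc J. w ^ j))\<^sup>2 = (norm (\<Sum>j<J. w ^ j))\<^sup>2 + 2 * Re (cnj (\<Sum>j<J. w ^ j) * w ^ J) + (norm (w ^ J))\<^sup>2"
  proof -
    have "(norm (x + y))\<^sup>2 = (norm x)\<^sup>2 + 2 * Re (cnj x * y) + (norm y)\<^sup>2" for x y :: complex
      by (simp only: cmod_power2) (simp add: power2_eq_square algebra_simps)
    from this[of "\<Sum>j<J. w ^ j" "w ^ J"] show ?thesis by (simp only: sum.lessThan_Suc)
  qed
  also have "\<dots> = (norm (\<Sum>j<J. w ^ j))\<^sup>2 + 2 * Re (\<Sum>n=1..J. w ^ n) + 1"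
    unfolding e using w by (simp add: norm_power)
  finally show ?case using Suc by (simp add: fejer_sum_def)
qed (simp add: fejer_sum_def)

lemma Re_fejer_sum_le:
  assumes w: "norm w = 1" and r: "0 < r" "r \<le> norm (1 - w)"
  shows "Re (fejer_sum J w) \<le> 4 / r\<^sup>2"
proof -
  have "w \<noteq> 1" using r by auto
  then have "norm (\<Sum>j<J. w ^ j) = norm (1 - w ^ J) / norm (1 - w)"
    by (simp add: sum_gp_strict norm_divide)
  also have "\<dots> \<le> 2 / r"
    using r norm_triangle_ineq4[of 1 "w ^ J"] w by (intro frac_le) (auto simp: norm_power)
  finally have "(norm (\<Sum>j<J. w ^ j))\<^sup>2 \<le> (2 / r)\<^sup>2" by (intro power_mono) auto
  then show ?thesis by (simp add: Re_fejer_sum[OF w] power_divide)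
qed

lemma norm_fejer_sum_le:
  assumes w: "norm w \<le> 1" and r: "0 < r" "r \<le> norm (1 - w)"
  shows "norm (fejer_sum J w) \<le> real J * (4 / r)"
proof -
  have "norm (1 + 2 * (\<Sum>n=1..j. w ^ n)) \<le> 4 / r" for j
  proof -
    have "(1 - w) * (\<Sum>n=1..j. w ^ n) = w - w ^ Suc j"
      using sum_gp_multiplied[of 1 j w] by (cases "j = 0") (auto simp: power_Suc)
    moreover have "(1 - w) * (1 + 2 * S) = (1 - w) + 2 * ((1 - w) * S)" for S
      by (simp add: algebra_simps)
    ultimately have "(1 - w) * (1 + 2 * (\<Sum>n=1..j. w ^ n)) = 1 + w - 2 * w ^ Suc j"
      by simp
    then have "norm (1 - w) * norm (1 + 2 * (\<Sum>n=1..j. w ^ n)) = norm (1 + w - 2 * w ^ Suc j)"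
      by (metis norm_mult)
    also have "\<dots> \<le> norm (1 + w) + norm (2 * w ^ Suc j)" by (rule norm_triangle_ineq4)
    also have "norm (1 + w) \<le> 2" using norm_triangle_ineq[of 1 w] w by simp
    also have "norm (2 * w ^ Suc j) \<le> 2"
      using power_le_one[of "norm w" "Suc j"] w by (simp only: norm_mult norm_power) simp
    finally have "norm (1 - w) * norm (1 + 2 * (\<Sum>n=1..j. w ^ n)) \<le> 4" by simp
    moreover have "r * norm (1 + 2 * (\<Sum>n=1..j. w ^ n)) \<le> norm (1 - w) * norm (1 + 2 * (\<Sum>n=1..j. w ^ n))"
      using r by (intro mult_right_mono) auto
    ultimately show ?thesis using r by (simp add: field_simps)
  qed
  then have "norm (fejer_sum J w) \<le> (\<Sum>j<J. 4 / r)"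
    unfolding fejer_sum_def by (intro sum_norm_le)
  then show ?thesis by simp
qed

lemma circle_power_integral: "(\<integral>\<zeta>. cnj \<zeta> ^ n \<partial>circle_measure) = (if n = 0 then 1 else 0)"
  using circle_orthonormal[of 0 n] by (cases "n = 0") auto

lemma circle_integral_fejer:
  fixes \<phi> :: "complex \<Rightarrow> complex"
  assumes \<phi>: "\<phi> \<in> borel_measurable borel" "\<And>\<zeta>. norm \<zeta> = 1 \<Longrightarrow> norm (\<phi> \<zeta>) \<le> B"
  defines "e \<equiv> \<lambda>n. \<integral>\<zeta>. \<phi> \<zeta> * cnj \<zeta> ^ n \<partial>circle_measure"
  shows "(\<integral>\<zeta>. \<phi> \<zeta> * fejer_sum J (cnj \<zeta> * z) \<partial>circle_measure)
    = (\<Sum>j<J. e 0 + 2 * (\<Sum>n=1..j. e n * z ^ n))"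
proof -
  have i: "integrable circle_measure (\<lambda>\<zeta>. \<phi> \<zeta> * cnj \<zeta> ^ n)" for n
  proof (rule circle_integrable[of _ B])
    have "(\<lambda>\<zeta>::complex. cnj \<zeta> ^ n) \<in> borel_measurable borel"
      by (intro borel_measurable_continuous_onI continuous_intros)
    then show "(\<lambda>\<zeta>. \<phi> \<zeta> * cnj \<zeta> ^ n) \<in> borel_measurable borel" using \<phi> by simp
  qed (use \<phi> in \<open>simp add: norm_mult norm_power\<close>)
  have eq: "(\<lambda>\<zeta>. \<phi> \<zeta> * fejer_sum J (cnj \<zeta> * z))
      = (\<lambda>\<zeta>. \<Sum>j<J. \<phi> \<zeta> * cnj \<zeta> ^ 0 + 2 * (\<Sum>n=1..j. (\<phi> \<zeta> * cnj \<zeta> ^ n) * z ^ n))"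
    by (simp add: fejer_sum_def sum_distrib_left power_mult_distrib algebra_simps)
  show ?thesis
    unfolding e_def eq
    by (simp only: Bochner_Integration.integral_sum Bochner_Integration.integral_add integral_mult_right_zero
        integral_mult_left_zero Bochner_Integration.integrable_sum Bochner_Integration.integrable_add
        integrable_mult_right integrable_mult_left i simp_thms)
qed

text \<open>\<open>\<psi>\<close> is the analytic completion of the Fejer mean of the indicator function of \<open>E\<close>, the circle without a tiny
arc around \<open>1\<close>, normalized. Fejer means keep the real part nonnegative and give a polynomial.
\<open>Q\<close> is the exponential of a multiple of an analytic Fejer kernel, so that it is small outside a still
smaller arc. The order matters: the arc first, then \<open>Q\<close>, whose bound \<open>M\<close> blows up as the arc shrinks,
and only then the order \<open>J\<close> of the Fejer mean, which makes \<open>Re \<psi>\<close> on the small arc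
so tiny that it beats \<open>|Q|\<^sup>2\<close>.\<close>

lemma block_pair:
  assumes \<epsilon>: "0 < \<epsilon>"
  shows "\<exists>(\<psi>::complex poly) Q. poly \<psi> 0 = 1 \<and>
      (\<forall>z. norm z = 1 \<longrightarrow> 0 \<le> Re (poly \<psi> z) \<and> Re (poly \<psi> z) \<le> 1 + \<epsilon>) \<and>
      (\<forall>z. norm z \<le> 1 \<longrightarrow> \<epsilon> \<le> norm (z - 1) \<longrightarrow> norm (poly \<psi> z - 1) \<le> \<epsilon>) \<and>
      Q holomorphic_on UNIV \<and> Q 0 = 1 \<and>
      (\<forall>z. norm z = 1 \<longrightarrow> Re (poly \<psi> z) * (norm (Q z))\<^sup>2 \<le> \<epsilon>)"
proof -
  define \<delta> where "\<delta> = min \<epsilon> 1"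
  have \<delta>: "0 < \<delta>" "\<delta> \<le> 1" "\<delta> \<le> \<epsilon>" using \<epsilon> by (auto simp: \<delta>_def)
  \<comment> \<open>\<open>s = 1 / K\<close> is the radius of the removed arc; its measure is then at most \<open>\<delta>\<^sup>2 / 32\<close>\<close>
  obtain K :: nat where K: "128 / \<delta>\<^sup>2 < real K" using reals_Archimedean2 by blast
  have K128: "128 / \<delta>\<^sup>2 \<ge> 128 / \<delta>" using \<delta> by (simp add: field_simps power2_eq_square)
  have K0: "0 < K" using K \<delta> by (metis divide_pos_pos less_trans of_nat_0_less_iff zero_less_numeral zero_less_power)
  define s where "s = 1 / real K"
  have s: "0 < s" "s \<le> \<delta> / 2"
  proof -
    show "0 < s" using K0 by (simp add: s_def)
    have "128 / \<delta> < real K" using K K128 by linarith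
    then show "s \<le> \<delta> / 2" using \<delta> K0 by (simp add: s_def field_simps)
  qed
  define E where "E = {\<zeta>::complex. s \<le> norm (\<zeta> - 1)}"
  have E: "E \<in> sets borel" unfolding E_def by (intro borel_closed closed_Collect_le continuous_intros)
  define \<mu> where "\<mu> = measure circle_measure (- E)"
  have \<mu>: "0 \<le> \<mu>" "\<mu> \<le> \<delta>\<^sup>2 / 32"
  proof -
    show "0 \<le> \<mu>" by (simp add: \<mu>_def)
    have "\<mu> \<le> measure circle_measure {\<zeta>. norm (\<zeta> ^ 1 - 1) \<le> 1 / real K}"
      unfolding \<mu>_def
    proof (rule circle.finite_measure_mono)
      show "- E \<subseteq> {\<zeta>. norm (\<zeta> ^ 1 - 1) \<le> 1 / real K}" by (auto simp: E_def s_def)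
      have "{\<zeta>::complex. norm (\<zeta> ^ 1 - 1) \<le> 1 / real K} \<in> sets borel"
        by (intro borel_closed closed_Collect_le continuous_intros)
      then show "{\<zeta>. norm (\<zeta> ^ 1 - 1) \<le> 1 / real K} \<in> sets circle_measure" by simp
    qed
    also have "\<dots> \<le> 4 / real K" using K0 by (intro circle_measure_near_roots) auto
    also have "\<dots> \<le> \<delta>\<^sup>2 / 32" using K \<delta> K0 by (simp add: field_simps)
    finally show "\<mu> \<le> \<delta>\<^sup>2 / 32" .
  qed
  have \<delta>2: "\<delta>\<^sup>2 \<le> \<delta>" using \<delta> by (simp add: power2_eq_square mult_left_le)
  have \<mu>1: "\<mu> \<le> 1 / 32" using \<mu>(2) \<delta>2 \<delta>(2) by linarith
  define c where "c = 1 / (1 - \<mu>)"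
  have c: "1 \<le> c" "c \<le> 2" "c - 1 \<le> 2 * \<mu>" "c * (1 - \<mu>) = 1"
  proof -
    show "1 \<le> c" "c \<le> 2" "c * (1 - \<mu>) = 1" using \<mu>1 \<mu>(1) by (simp_all add: c_def field_simps)
    have "\<mu> * (2 * \<mu>) \<le> \<mu> * 1" using \<mu>1 \<mu>(1) by (intro mult_left_mono) auto
    then show "c - 1 \<le> 2 * \<mu>" using \<mu>1 by (simp add: c_def field_simps)
  qed
  obtain J' :: nat where J': "32 / s\<^sup>2 < real J'" using reals_Archimedean2 by blast
  have J'0: "0 < real J'" using J' s by (meson divide_pos_pos less_trans zero_less_numeral zero_less_power)
  \<comment> \<open>so that \<open>exp (- A)\<close>, the bound of \<open>|Q|\<^sup>2\<close> away from 1, times 2, the bound of \<open>Re \<psi>\<close>, is \<open>\<delta>\<close>\<close>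
  define A where "A = ln (2 / \<delta>)"
  have A: "0 \<le> A" "2 * exp (- A) = \<delta>" using \<delta> by (simp_all add: A_def exp_minus)
  define Q where "Q = (\<lambda>z. exp (of_real A * (fejer_sum J' z / of_nat J' - 1)))"
  have Qh: "Q holomorphic_on UNIV" unfolding Q_def by (intro holomorphic_intros holomorphic_fejer_sum) (use J'0 in auto)
  have Q0: "Q 0 = 1" using J'0 by (simp add: Q_def)
  have Qfar: "(norm (Q z))\<^sup>2 \<le> exp (- A)" if z: "norm z = 1" "s / 2 \<le> norm (z - 1)" for z
  proof -
    have "Re (fejer_sum J' z) \<le> 4 / (s / 2)\<^sup>2"
      using z s by (intro Re_fejer_sum_le) (auto simp: norm_minus_commute)
    also have "\<dots> \<le> real J' / 2" using J' s by (simp add: field_simps power2_eq_square)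
    finally have "Re (fejer_sum J' z) / real J' \<le> 1 / 2" using J'0 by (simp add: field_simps)
    then have "Re (fejer_sum J' z) / real J' - 1 \<le> - (1/2)" by linarith
    then have "2 * (A * (Re (fejer_sum J' z) / real J' - 1)) \<le> 2 * (A * (- (1/2)))"
      using A(1) by (intro mult_left_mono) auto
    moreover have "(norm (Q z))\<^sup>2 = exp (2 * (A * (Re (fejer_sum J' z) / real J' - 1)))"
      by (simp add: Q_def exp_double power2_eq_square[symmetric] Re_divide_of_nat)
    ultimately show ?thesis by simp
  qed
  have "compact (Q ` sphere 0 1)"
    using holomorphic_on_imp_continuous_on[OF Qh]
    by (intro compact_continuous_image) (auto intro: continuous_on_subset)
  then obtain M where M: "\<And>z. norm z = 1 \<Longrightarrow> norm (Q z) \<le> M"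
    by (metis bounded_iff compact_imp_bounded imageI mem_sphere_0)
  have M0: "0 \<le> M" using order_trans[OF norm_ge_zero M[of 1]] by simp
  \<comment> \<open>the Fejer mean must be so fine that it compensates the bound \<open>M\<close> of \<open>Q\<close>\<close>
  obtain J :: nat where J: "32 * M\<^sup>2 / (\<delta> * s\<^sup>2) < real J" using reals_Archimedean2 by blast
  have J0: "0 < real J"
  proof -
    have "0 \<le> 32 * M\<^sup>2 / (\<delta> * s\<^sup>2)" using \<delta> by simp
    then show ?thesis using J by linarith
  qed
  define e where "e = (\<lambda>n. \<integral>\<zeta>. indicator E \<zeta> * cnj \<zeta> ^ n \<partial>circle_measure)"
  define \<psi> where "\<psi> = smult (of_real c / of_nat J) (\<Sum>j<J. [:e 0:] + smult 2 (\<Sum>n=1..j. monom (e n) n))"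
  have \<psi>: "poly \<psi> z = of_real c / of_nat J * (\<integral>\<zeta>. indicator E \<zeta> * fejer_sum J (cnj \<zeta> * z) \<partial>circle_measure)" for z
    using E by (subst circle_integral_fejer[of _ 1])
      (auto simp: \<psi>_def e_def poly_sum poly_monom indicator_def intro!: borel_measurable_indicator)
  have int_fejer: "integrable circle_measure (\<lambda>\<zeta>. fejer_sum J (cnj \<zeta> * z))" for z
    by (intro circle_integrable_continuous continuous_intros)
  have int_ind: "integrable circle_measure (\<lambda>\<zeta>. indicator F \<zeta> * fejer_sum J (cnj \<zeta> * z))" if "F \<in> sets borel" for z F
  proof -
    have "integrable circle_measure (\<lambda>\<zeta>. indicator F \<zeta> *\<^sub>R fejer_sum J (cnj \<zeta> * z))"
      using that by (intro integrable_mult_indicator int_fejer) simp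
    moreover have "(\<lambda>\<zeta>. indicat_real F \<zeta> *\<^sub>R fejer_sum J (cnj \<zeta> * z)) = (\<lambda>\<zeta>. indicator F \<zeta> * fejer_sum J (cnj \<zeta> * z))"
      by (auto simp: indicator_def fun_eq_iff)
    ultimately show ?thesis by simp
  qed
  have whole: "(\<integral>\<zeta>. fejer_sum J (cnj \<zeta> * z) \<partial>circle_measure) = of_nat J" for z
    using circle_integral_fejer[of "\<lambda>_. 1" 1 J z] by (simp add: circle_power_integral)
  have Re\<psi>: "Re (poly \<psi> z) = c / real J * (\<integral>\<zeta>. indicator E \<zeta> * Re (fejer_sum J (cnj \<zeta> * z)) \<partial>circle_measure)" for z
  proof -
    have "Re (poly \<psi> z) = c / real J * Re (\<integral>\<zeta>. indicator E \<zeta> * fejer_sum J (cnj \<zeta> * z) \<partial>circle_measure)"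
      unfolding \<psi> by (simp add: Re_divide_of_nat)
    also have "Re (\<integral>\<zeta>. indicator E \<zeta> * fejer_sum J (cnj \<zeta> * z) \<partial>circle_measure)
        = (\<integral>\<zeta>. indicator E \<zeta> * Re (fejer_sum J (cnj \<zeta> * z)) \<partial>circle_measure)"
      unfolding integral_Re[OF int_ind[OF E], symmetric]
      by (intro Bochner_Integration.integral_cong) (auto simp: indicator_def)
    finally show ?thesis .
  qed
  have unit: "norm (cnj \<zeta> * z) = norm z" "norm (1 - cnj \<zeta> * z) = norm (\<zeta> - z)" if "norm \<zeta> = 1" for \<zeta> z
  proof -
    show "norm (cnj \<zeta> * z) = norm z" using that by (simp add: norm_mult)
    have "\<zeta> * cnj \<zeta> = 1" using complex_norm_square[of \<zeta>] that by simp
    then have "\<zeta> - z = \<zeta> * (1 - cnj \<zeta> * z)" by (simp add: algebra_simps)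
    then show "norm (1 - cnj \<zeta> * z) = norm (\<zeta> - z)" using that by (simp add: norm_mult)
  qed
  have Refe: "0 \<le> Re (fejer_sum J (cnj \<zeta> * z))" if "norm \<zeta> = 1" "norm z = 1" for \<zeta> z
    using that by (subst Re_fejer_sum) (auto simp: unit)
  have int_ReE: "integrable circle_measure (\<lambda>\<zeta>. indicator E \<zeta> * Re (fejer_sum J (cnj \<zeta> * z)))" for z
  proof -
    have "(\<lambda>\<zeta>. Re (indicator E \<zeta> * fejer_sum J (cnj \<zeta> * z))) = (\<lambda>\<zeta>. indicator E \<zeta> * Re (fejer_sum J (cnj \<zeta> * z)))"
      by (auto simp: indicator_def fun_eq_iff)
    then show ?thesis using integrable_Re[OF int_ind[OF E, of z]] by simp
  qed
  have pos: "0 \<le> Re (poly \<psi> z)" if z: "norm z = 1" for z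
  proof -
    have "0 \<le> (\<integral>\<zeta>. indicator E \<zeta> * Re (fejer_sum J (cnj \<zeta> * z)) \<partial>circle_measure)"
      using AE_circle_norm by (intro integral_nonneg_AE) (auto elim!: eventually_mono simp: indicator_def Refe z)
    then show ?thesis unfolding Re\<psi> using c J0 by (intro mult_nonneg_nonneg) auto
  qed
  have up: "Re (poly \<psi> z) \<le> c" if z: "norm z = 1" for z
  proof -
    have "(\<integral>\<zeta>. indicator E \<zeta> * Re (fejer_sum J (cnj \<zeta> * z)) \<partial>circle_measure)
       \<le> (\<integral>\<zeta>. Re (fejer_sum J (cnj \<zeta> * z)) \<partial>circle_measure)"
      using AE_circle_norm by (intro integral_mono_AE int_ReE integrable_Re int_fejer)
        (auto elim!: eventually_mono simp: indicator_def Refe z)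
    also have "\<dots> = real J" by (simp add: integral_Re[OF int_fejer] whole)
    finally have "c / real J * (\<integral>\<zeta>. indicator E \<zeta> * Re (fejer_sum J (cnj \<zeta> * z)) \<partial>circle_measure) \<le> c / real J * real J"
      using c J0 by (intro mult_left_mono) auto
    then show ?thesis unfolding Re\<psi> using J0 by simp
  qed
  have near: "Re (poly \<psi> z) \<le> 32 / (real J * s\<^sup>2)" if z: "norm z = 1" "norm (z - 1) \<le> s / 2" for z
  proof -
    have "(\<integral>\<zeta>. indicator E \<zeta> * Re (fejer_sum J (cnj \<zeta> * z)) \<partial>circle_measure)
       \<le> (\<integral>\<zeta>. 16 / s\<^sup>2 \<partial>circle_measure)"
    proof (intro integral_mono_AE int_ReE)
      show "AE \<zeta> in circle_measure. indicator E \<zeta> * Re (fejer_sum J (cnj \<zeta> * z)) \<le> 16 / s\<^sup>2"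
        using AE_circle_norm
      proof eventually_elim
        case (elim \<zeta>)
        have "Re (fejer_sum J (cnj \<zeta> * z)) \<le> 4 / (s / 2)\<^sup>2" if "\<zeta> \<in> E"
        proof (rule Re_fejer_sum_le)
          have "norm (\<zeta> - 1) \<le> norm (\<zeta> - z) + norm (z - 1)" by (metis dist_norm dist_triangle)
          then show "s / 2 \<le> norm (1 - cnj \<zeta> * z)" using z that by (simp add: unit[OF elim] E_def)
        qed (use unit[OF elim] z s in auto)
        then show ?case by (simp add: indicator_def power_divide)
      qed
    qed simp
    then have "Re (poly \<psi> z) \<le> c / real J * (16 / s\<^sup>2)"
      unfolding Re\<psi> using c J0 by (intro mult_left_mono) auto
    also have "\<dots> \<le> 2 / real J * (16 / s\<^sup>2)"
      using c J0 by (intro mult_right_mono divide_right_mono) auto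
    finally show ?thesis by simp
  qed
  have far: "norm (poly \<psi> z - 1) \<le> \<delta>" if z: "norm z \<le> 1" "\<delta> \<le> norm (z - 1)" for z
  proof -
    let ?I = "\<integral>\<zeta>. indicator (- E) \<zeta> * fejer_sum J (cnj \<zeta> * z) \<partial>circle_measure"
    have nE: "- E \<in> sets borel" using E by simp
    have "of_nat J = (\<integral>\<zeta>. indicator E \<zeta> * fejer_sum J (cnj \<zeta> * z) + indicator (- E) \<zeta> * fejer_sum J (cnj \<zeta> * z) \<partial>circle_measure)"
      unfolding whole[of z, symmetric] by (intro Bochner_Integration.integral_cong) (auto simp: indicator_def)
    also have "\<dots> = (\<integral>\<zeta>. indicator E \<zeta> * fejer_sum J (cnj \<zeta> * z) \<partial>circle_measure) + ?I"
      by (intro Bochner_Integration.integral_add int_ind E nE)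
    finally have X: "(\<integral>\<zeta>. indicator E \<zeta> * fejer_sum J (cnj \<zeta> * z) \<partial>circle_measure) = of_nat J - ?I" by simp
    then have eq: "poly \<psi> z - 1 = of_real (c - 1) - of_real c / of_nat J * ?I"
      unfolding \<psi> X using J0 by (simp add: right_diff_distrib)
    have "norm ?I \<le> (\<integral>\<zeta>. norm (indicator (- E) \<zeta> * fejer_sum J (cnj \<zeta> * z)) \<partial>circle_measure)"
      by (rule integral_norm_bound)
    also have "\<dots> \<le> (\<integral>\<zeta>. indicator (- E) \<zeta> * (real J * (8 / \<delta>)) \<partial>circle_measure)"
    proof (rule integral_mono_AE)
      show "integrable circle_measure (\<lambda>\<zeta>. norm (indicator (- E) \<zeta> * fejer_sum J (cnj \<zeta> * z)))"
        by (intro integrable_norm int_ind nE)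
      show "integrable circle_measure (\<lambda>\<zeta>. indicator (- E) \<zeta> * (real J * (8 / \<delta>)))"
        using nE by (intro integrable_mult_left integrable_real_indicator) (auto simp: circle.emeasure_eq_measure)
      show "AE \<zeta> in circle_measure. norm (indicator (- E) \<zeta> * fejer_sum J (cnj \<zeta> * z)) \<le> indicator (- E) \<zeta> * (real J * (8 / \<delta>))"
        using AE_circle_norm
      proof eventually_elim
        case (elim \<zeta>)
        have "norm (fejer_sum J (cnj \<zeta> * z)) \<le> real J * (4 / (\<delta> / 2))" if "\<zeta> \<notin> E"
        proof (rule norm_fejer_sum_le)
          have "norm (z - 1) \<le> norm (\<zeta> - z) + norm (\<zeta> - 1)"
            using norm_triangle_ineq4[of "\<zeta> - 1" "\<zeta> - z"] by simp
          then show "\<delta> / 2 \<le> norm (1 - cnj \<zeta> * z)" using z that s by (simp add: unit[OF elim] E_def)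
        qed (use unit[OF elim] z \<delta> in auto)
        then show ?case by (auto simp: indicator_def)
      qed
    qed
    also have "\<dots> = \<mu> * (real J * (8 / \<delta>))"
      using E by (simp add: \<mu>_def)
    finally have I: "norm ?I \<le> \<mu> * (real J * (8 / \<delta>))" .
    have "norm (poly \<psi> z - 1) \<le> norm (of_real (c - 1) :: complex) + norm (of_real c / of_nat J * ?I)"
      unfolding eq by (rule norm_triangle_ineq4)
    also have "norm (of_real (c - 1) :: complex) = c - 1"
      using c(1) unfolding norm_of_real by simp
    also have "norm (of_real c / of_nat J * ?I) \<le> c / real J * (\<mu> * (real J * (8 / \<delta>)))"
      using c J0 I unfolding norm_mult norm_divide by (intro mult_mono) auto
    also have "\<dots> = c * (8 * \<mu> / \<delta>)" using J0 by simp
    also have "\<dots> \<le> 2 * (8 * \<mu> / \<delta>)" using c \<mu> \<delta> by (intro mult_right_mono) auto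
    also have "8 * \<mu> / \<delta> \<le> \<delta> / 4" using \<mu> \<delta> by (simp add: field_simps power2_eq_square)
    finally have "norm (poly \<psi> z - 1) \<le> 2 * \<mu> + \<delta> / 2" using c(3) by simp
    also have "\<dots> \<le> \<delta>" using \<mu>(2) \<delta>2 \<delta> by simp
    finally show ?thesis .
  qed
  have prod: "Re (poly \<psi> z) * (norm (Q z))\<^sup>2 \<le> \<epsilon>" if z: "norm z = 1" for z
  proof (cases "norm (z - 1) \<le> s / 2")
    case True
    have "Re (poly \<psi> z) * (norm (Q z))\<^sup>2 \<le> 32 / (real J * s\<^sup>2) * M\<^sup>2"
      using near[OF z True] pos[OF z] M[OF z] J0 by (intro mult_mono power_mono) auto
    also have "\<dots> \<le> \<delta>" using J J0 \<delta> s by (simp add: field_simps)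
    finally show ?thesis using \<delta> by simp
  next
    case False
    have "Re (poly \<psi> z) * (norm (Q z))\<^sup>2 \<le> 2 * exp (- A)"
      using up[OF z] c Qfar[OF z] False pos[OF z] by (intro mult_mono) auto
    then show ?thesis using A \<delta> by simp
  qed
  have one: "poly \<psi> 0 = 1"
  proof -
    have "1 - \<mu> = measure circle_measure E"
      using circle.finite_measure_compl[of E] E by (simp add: \<mu>_def Compl_eq_Diff_UNIV)
    moreover have "(\<integral>\<zeta>. indicator E \<zeta> * fejer_sum J (cnj \<zeta> * 0) \<partial>circle_measure) = of_real (measure circle_measure E) * of_nat J"
    proof -
      have "(\<integral>\<zeta>. indicator E \<zeta> * fejer_sum J (cnj \<zeta> * 0) \<partial>circle_measure)
          = (\<integral>\<zeta>. complex_of_real (indicator E \<zeta>) * of_nat J \<partial>circle_measure)"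
        by (intro Bochner_Integration.integral_cong) (auto simp: indicator_def)
      then show ?thesis using E by (simp add: integral_complex_of_real)
    qed
    ultimately have "poly \<psi> 0 = of_real (c * (1 - \<mu>))" unfolding \<psi> using J0 by simp
    then show ?thesis using c(4) by simp
  qed
  have upe: "c \<le> 1 + \<epsilon>" using c(3) \<mu>(2) \<delta>2 \<delta> by linarith
  have far': "norm (poly \<psi> z - 1) \<le> \<epsilon>" if "norm z \<le> 1" "\<epsilon> \<le> norm (z - 1)" for z
    using far[of z] that \<delta>(3) by linarith
  show ?thesis
    using one pos up upe far' Qh Q0 prod
    by (intro exI[of _ \<psi>] exI[of _ Q]) (auto intro: order_trans)
qed

section \<open>The Riesz product\<close>

text \<open>On the circle \<open>cnj z = 1 / z\<close>, so up to the factor \<open>z ^ degree F\<close> the conjugate of \<open>F\<close> is the reflected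
polynomial with conjugated coefficients.\<close>

lemma poly_times_real_part:
  fixes F :: "complex poly"
  obtains R where "\<And>z. norm z = 1 \<Longrightarrow> poly R z = z ^ degree F * of_real (Re (poly F z))"
proof (rule that)
  fix z :: complex assume z: "norm z = 1"
  have z0: "z \<noteq> 0" using z by auto
  have "z * cnj z = 1" using complex_norm_square[of z] z by simp
  then have inv: "inverse z = cnj z" by (simp add: inverse_unique)
  have "poly (smult (1/2) (monom 1 (degree F) * F + reflect_poly (map_poly cnj F))) z
     = z ^ degree F * ((poly F z + cnj (poly F z)) / 2)"
    using z0 by (simp add: poly_monom poly_reflect_poly_nz inv degree_map_poly algebra_simps)
  also have "(poly F z + cnj (poly F z)) / 2 = of_real (Re (poly F z))"
    by (simp add: complex_eq_iff)
  finally show "poly (smult (1/2) (monom 1 (degree F) * F + reflect_poly (map_poly cnj F))) z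
     = z ^ degree F * of_real (Re (poly F z))" .
qed

lemma poly_maximum_modulus:
  assumes "\<And>z. norm z = r \<Longrightarrow> norm (poly p z) \<le> B" and "norm w \<le> r"
  shows "norm (poly (p :: complex poly) w) \<le> B"
proof (cases "r = 0")
  case True
  then show ?thesis using assms by auto
next
  case False
  then have r: "0 < r" using assms(2) norm_ge_zero[of w] by linarith
  show ?thesis
  proof (rule maximum_modulus_frontier[of "poly p" "cball 0 r"])
    show "poly p holomorphic_on interior (cball 0 r)" by (intro holomorphic_intros)
    show "continuous_on (closure (cball 0 r)) (poly p)" by (intro continuous_intros)
    show "norm (poly p z) \<le> B" if "z \<in> frontier (cball 0 r)" for z
      using that r assms(1)[of z] by (simp add: frontier_cball)
  qed (use assms in auto)
qed

text \<open>Multiplying \<open>Re F\<close> by the real part of \<open>\<psi>(z\<^sup>N)\<close> adds the real part of \<open>(Re F) (\<psi>(z\<^sup>N) - 1)\<close> on the circle.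
There \<open>Re F\<close> is a Laurent polynomial with exponents of modulus at most \<open>degree F\<close>, and every
term of \<open>\<psi>(z\<^sup>N) - 1\<close> has degree at least \<open>N\<close>, so the product is a polynomial without constant term.\<close>

lemma riesz_step:
  fixes F \<psi> :: "complex poly"
  assumes \<psi>0: "poly \<psi> 0 = 1" and \<epsilon>: "\<epsilon> \<le> 1/2"
    and \<psi>: "\<And>w. norm w \<le> 1 \<Longrightarrow> \<epsilon> \<le> norm (w - 1) \<Longrightarrow> norm (poly \<psi> w - 1) \<le> \<epsilon>"
    and N: "degree F < N"
  shows "\<exists>H. poly H 0 = 0 \<and>
    (\<forall>z. norm z = 1 \<longrightarrow> poly H z = of_real (Re (poly F z)) * (poly \<psi> (z ^ N) - 1)) \<and>
    (\<forall>C. (\<forall>\<zeta>. norm \<zeta> = 1 \<longrightarrow> \<bar>Re (poly F \<zeta>)\<bar> \<le> C) \<longrightarrow>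
       (\<forall>z. norm z \<le> 1 \<longrightarrow> \<epsilon> \<le> norm (z ^ N - 1) \<longrightarrow> norm (poly H z) \<le> C * (2 * \<epsilon>)))"
proof -
  have "[:-0, 1:] dvd (\<psi> - 1)" using \<psi>0 by (simp only: poly_eq_0_iff_dvd[symmetric]) simp
  then obtain \<theta> where "\<psi> - 1 = [:-0, 1:] * \<theta>" by blast
  then have "poly (\<psi> - 1) w = poly ([:-0, 1:] * \<theta>) w" for w by simp
  then have \<theta>: "poly \<psi> w - 1 = w * poly \<theta> w" for w by simp
  have half: "norm (poly \<theta> w) \<le> 2 * \<epsilon>" if w: "norm w \<le> 1" "1/2 \<le> norm w" "\<epsilon> \<le> norm (w - 1)" for w
  proof -
    have "1/2 * norm (poly \<theta> w) \<le> norm w * norm (poly \<theta> w)" using w by (intro mult_right_mono) auto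
    also have "\<dots> = norm (poly \<psi> w - 1)" by (simp add: \<theta> norm_mult)
    also have "\<dots> \<le> \<epsilon>" using w by (intro \<psi>)
    finally show ?thesis by simp
  qed
  \<comment> \<open>dividing \<open>\<psi> - 1\<close> by \<open>w\<close> costs a factor 2 for \<open>|w| \<ge> 1/2\<close>; inside, the maximum principle takes over\<close>
  have chi: "norm (poly \<theta> w) \<le> 2 * \<epsilon>" if w: "norm w \<le> 1" "\<epsilon> \<le> norm (w - 1)" for w
  proof (cases "1/2 \<le> norm w")
    case False
    show ?thesis
    proof (rule poly_maximum_modulus)
      show "norm w \<le> 1/2" using False by simp
      fix z :: complex assume z: "norm z = 1/2"
      have "norm (1 - z) \<ge> 1/2" using norm_triangle_ineq2[of 1 z] z by simp
      then show "norm (poly \<theta> z) \<le> 2 * \<epsilon>" using z \<epsilon> by (intro half) (auto simp: norm_minus_commute)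
    qed
  qed (use half w in auto)
  obtain R where R: "\<And>z. norm z = 1 \<Longrightarrow> poly R z = z ^ degree F * of_real (Re (poly F z))"
    using poly_times_real_part by blast
  define G where "G = R * monom 1 (N - degree F)"
  define H where "H = G * pcompose \<theta> (monom 1 N)"
  have H: "poly H z = poly R z * z ^ (N - degree F) * poly \<theta> (z ^ N)" for z
    by (simp add: H_def G_def poly_pcompose poly_monom)
  have G: "poly G z = of_real (Re (poly F z)) * z ^ N" if "norm z = 1" for z
    using N by (simp add: G_def R[OF that] poly_monom power_add[symmetric])
  show ?thesis
  proof (intro exI[of _ H] conjI allI impI)
    show "poly H 0 = 0" using N by (simp add: H power_0_left)
    show "poly H z = of_real (Re (poly F z)) * (poly \<psi> (z ^ N) - 1)" if "norm z = 1" for z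
      using G[OF that] by (simp add: H_def poly_pcompose poly_monom \<theta>)
    fix C and z :: complex
    assume C': "\<forall>\<zeta>. norm \<zeta> = 1 \<longrightarrow> \<bar>Re (poly F \<zeta>)\<bar> \<le> C" and z: "norm z \<le> 1" "\<epsilon> \<le> norm (z ^ N - 1)"
    have C: "\<bar>Re (poly F \<zeta>)\<bar> \<le> C" if "norm \<zeta> = 1" for \<zeta> using C' that by blast
    have "norm (poly G z) \<le> C"
    proof (rule poly_maximum_modulus[OF _ z(1)])
      show "norm (poly G \<zeta>) \<le> C" if "norm \<zeta> = 1" for \<zeta>
        using C[OF that] that by (simp add: G norm_mult norm_power)
    qed
    moreover have "norm (poly \<theta> (z ^ N)) \<le> 2 * \<epsilon>"
      using z by (intro chi) (simp_all add: norm_power power_le_one)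
    moreover have "0 \<le> C" using C[of 1] by simp
    ultimately show "norm (poly H z) \<le> C * (2 * \<epsilon>)"
      by (simp add: H_def poly_pcompose poly_monom norm_mult mult_mono)
  qed
qed

text \<open>\<open>F n\<close> is the polynomial with value \<open>1\<close> at \<open>0\<close> whose real part on the circle is the product of the first
\<open>n\<close> factors. The bound on the increments is conditional because it relies on a bound for the real part that
only follows from the other assumptions, by induction.\<close>

locale riesz_product =
  fixes \<psi> F :: "nat \<Rightarrow> complex poly" and N :: "nat \<Rightarrow> nat"
  assumes F_start: "F 0 = 1"
    and F_zero: "poly (F n) 0 = 1"
    and F_step: "norm z = 1 \<Longrightarrow>
      poly (F (Suc n)) z = poly (F n) z + of_real (Re (poly (F n) z)) * (poly (\<psi> n) (z ^ N n) - 1)"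
    and F_far: "(\<And>\<zeta>. norm \<zeta> = 1 \<Longrightarrow> \<bar>Re (poly (F n) \<zeta>)\<bar> \<le> 2) \<Longrightarrow> norm z \<le> 1 \<Longrightarrow>
      (1/4) ^ Suc n \<le> norm (z ^ N n - 1) \<Longrightarrow> norm (poly (F (Suc n)) z - poly (F n) z) \<le> (1/4) ^ n"
    and factor_Re: "norm z = 1 \<Longrightarrow> 0 \<le> Re (poly (\<psi> n) z) \<and> Re (poly (\<psi> n) z) \<le> 1 + (1/4) ^ Suc n"
    and N_gt: "n < N n"

text \<open>At every step the frequency is chosen last, so it can exceed the degree of the polynomial built so far
as well as any bound \<open>r n\<close> fixed in advance.\<close>

lemma riesz_product_exists:
  fixes \<psi> :: "nat \<Rightarrow> complex poly" and r :: "nat \<Rightarrow> nat"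
  assumes \<psi>0: "\<And>n. poly (\<psi> n) 0 = 1"
    and Re: "\<And>n z. norm z = 1 \<Longrightarrow> 0 \<le> Re (poly (\<psi> n) z) \<and> Re (poly (\<psi> n) z) \<le> 1 + (1/4) ^ Suc n"
    and far: "\<And>n w. norm w \<le> 1 \<Longrightarrow> (1/4) ^ Suc n \<le> norm (w - 1) \<Longrightarrow> norm (poly (\<psi> n) w - 1) \<le> (1/4) ^ Suc n"
  obtains F N where "riesz_product \<psi> F N" "\<And>n. r n \<le> N n"
proof -
  define N' where "N' = (\<lambda>n (G::complex poly). max (r n) (degree G) + n + 1)"
  define good where "good = (\<lambda>n G H. poly H 0 = 0 \<and>
      (\<forall>z. norm z = 1 \<longrightarrow> poly H z = of_real (Re (poly G z)) * (poly (\<psi> n) (z ^ N' n G) - 1)) \<and>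
      ((\<forall>\<zeta>. norm \<zeta> = 1 \<longrightarrow> \<bar>Re (poly G \<zeta>)\<bar> \<le> 2) \<longrightarrow>
       (\<forall>z. norm z \<le> 1 \<longrightarrow> (1/4) ^ Suc n \<le> norm (z ^ N' n G - 1) \<longrightarrow> norm (poly H z) \<le> (1/4) ^ n)))"
  have "\<exists>H. good n G H" for n G
  proof -
    have e: "(1/4::real) ^ Suc n \<le> 1/2" using power_le_one[of "1/4::real" n] by simp
    have d: "degree G < N' n G" by (simp add: N'_def)
    have "\<exists>H. poly H 0 = 0 \<and>
      (\<forall>z. norm z = 1 \<longrightarrow> poly H z = of_real (Re (poly G z)) * (poly (\<psi> n) (z ^ N' n G) - 1)) \<and>
      (\<forall>C. (\<forall>\<zeta>. norm \<zeta> = 1 \<longrightarrow> \<bar>Re (poly G \<zeta>)\<bar> \<le> C) \<longrightarrow> (\<forall>z. norm z \<le> 1 \<longrightarrow>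
         (1/4) ^ Suc n \<le> norm (z ^ N' n G - 1) \<longrightarrow> norm (poly H z) \<le> C * (2 * (1/4) ^ Suc n)))"
      by (rule riesz_step[OF \<psi>0 e _ d]) (rule far)
    then obtain H where H: "poly H 0 = 0"
      "\<forall>z. norm z = 1 \<longrightarrow> poly H z = of_real (Re (poly G z)) * (poly (\<psi> n) (z ^ N' n G) - 1)"
      "\<forall>C. (\<forall>\<zeta>. norm \<zeta> = 1 \<longrightarrow> \<bar>Re (poly G \<zeta>)\<bar> \<le> C) \<longrightarrow> (\<forall>z. norm z \<le> 1 \<longrightarrow>
         (1/4) ^ Suc n \<le> norm (z ^ N' n G - 1) \<longrightarrow> norm (poly H z) \<le> C * (2 * (1/4) ^ Suc n))"
      by (elim exE conjE) (rule that)
    show ?thesis unfolding good_def using H(1,2) H(3)[rule_format, of 2] by (intro exI[of _ H]) auto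
  qed
  then obtain H where "\<And>n G. good n G (H n G)" by metis
  then have H: "\<And>n G. poly (H n G) 0 = 0"
      "\<And>n G z. norm z = 1 \<Longrightarrow> poly (H n G) z = of_real (Re (poly G z)) * (poly (\<psi> n) (z ^ N' n G) - 1)"
      "\<And>n G z. (\<forall>\<zeta>. norm \<zeta> = 1 \<longrightarrow> \<bar>Re (poly G \<zeta>)\<bar> \<le> 2) \<Longrightarrow> norm z \<le> 1 \<Longrightarrow>
         (1/4) ^ Suc n \<le> norm (z ^ N' n G - 1) \<Longrightarrow> norm (poly (H n G) z) \<le> (1/4) ^ n"
    unfolding good_def by blast+
  define F where "F = rec_nat 1 (\<lambda>n G. G + H n G)"
  have F: "F 0 = 1" "\<And>n. F (Suc n) = F n + H n (F n)" by (simp_all add: F_def)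
  have "riesz_product \<psi> F (\<lambda>n. N' n (F n))"
  proof
    show "poly (F n) 0 = 1" for n by (induction n) (simp_all add: F H(1))
    show "poly (F (Suc n)) z = poly (F n) z + of_real (Re (poly (F n) z)) * (poly (\<psi> n) (z ^ N' n (F n)) - 1)"
      if "norm z = 1" for n z using H(2)[OF that, of n "F n"] by (simp add: F)
    show "norm (poly (F (Suc n)) z - poly (F n) z) \<le> (1/4) ^ n"
      if "\<And>\<zeta>. norm \<zeta> = 1 \<Longrightarrow> \<bar>Re (poly (F n) \<zeta>)\<bar> \<le> 2" "norm z \<le> 1" "(1/4) ^ Suc n \<le> norm (z ^ N' n (F n) - 1)" for n z
      using H(3)[of "F n" z n] that by (simp add: F)
  qed (use F Re in \<open>auto simp: N'_def\<close>)
  then show ?thesis using that[of F "\<lambda>n. N' n (F n)"] by (simp add: N'_def)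
qed

lemma one_minus_power_le:
  fixes x :: real
  assumes "0 \<le> x" "x \<le> 1"
  shows "(1 - x) ^ n \<le> 1 / (1 + real n * x)"
proof -
  have "(1 - x) ^ n * (1 + real n * x) \<le> (1 - x) ^ n * (1 + x) ^ n"
    using Bernoulli_inequality[of x n] assms by (intro mult_left_mono) auto
  also have "\<dots> = (1 - x\<^sup>2) ^ n" by (simp add: power_mult_distrib[symmetric] power2_eq_square algebra_simps)
  also have "\<dots> \<le> 1" using assms by (intro power_le_one) (auto simp: power_le_one)
  finally show ?thesis using assms by (simp add: field_simps add_pos_nonneg)
qed

text \<open>If \<open>z\<^sup>N\<close> is within \<open>s\<close> of \<open>1\<close>, then \<open>1 - |z|\<close> is at most \<open>2 s / N\<close>, so a Stolz region puts \<open>\<zeta>\<close> within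
\<open>2 \<alpha> s / N\<close> of \<open>z\<close>. Hence a boundary point whose Stolz region meets the bad set is itself almost bad.\<close>

lemma stolz_power_near_one:
  assumes \<zeta>: "norm \<zeta> = 1" and z: "z \<in> stolz_region \<zeta> \<alpha>" and \<alpha>: "0 < \<alpha>"
    and s: "norm (z ^ N - 1) \<le> s" "s \<le> 1/2"
  shows "norm (\<zeta> ^ N - 1) \<le> (2 * \<alpha> + 1) * s"
proof -
  define x where "x = 1 - norm z"
  have x: "0 \<le> x" "x \<le> 1" and d: "norm (z - \<zeta>) \<le> \<alpha> * x"
    using z by (auto simp: stolz_region_def x_def)
  have s0: "0 \<le> s" using order_trans[OF norm_ge_zero s(1)] .
  have "1 - s \<le> norm (z ^ N)"
    using norm_triangle_ineq2[of 1 "1 - z ^ N"] s(1) by (simp add: norm_minus_commute)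
  also have "\<dots> = (1 - x) ^ N" by (simp add: x_def norm_power)
  also have "\<dots> \<le> 1 / (1 + real N * x)" by (rule one_minus_power_le[OF x])
  finally have "1 - s \<le> 1 / (1 + real N * x)" .
  moreover have "0 < 1 + real N * x" using x by (simp add: add_pos_nonneg)
  ultimately have 1: "(1 - s) * (1 + real N * x) \<le> 1" by (simp add: pos_le_divide_eq)
  have "(1 / 2) * (real N * x) \<le> (1 - s) * (real N * x)" using s(2) x by (intro mult_right_mono) auto
  then have Nx: "real N * x \<le> 2 * s" using 1 by (simp add: algebra_simps)
  have "norm (\<zeta> ^ N - z ^ N) \<le> real N * norm (\<zeta> - z)"
    using \<zeta> z by (intro norm_power_diff) (auto simp: stolz_region_def)
  also have "\<dots> \<le> real N * (\<alpha> * x)" using d by (intro mult_left_mono) (auto simp: norm_minus_commute)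
  also have "\<dots> = \<alpha> * (real N * x)" by simp
  also have "\<dots> \<le> \<alpha> * (2 * s)" using Nx \<alpha> by (intro mult_left_mono) auto
  finally have "norm (\<zeta> ^ N - z ^ N) \<le> \<alpha> * (2 * s)" .
  then show ?thesis
    using norm_triangle_ineq[of "\<zeta> ^ N - z ^ N" "z ^ N - 1"] s(1) by (simp add: algebra_simps)
qed

text \<open>Expanding the kernel in powers of \<open>z cnj(\<zeta>)\<close> picks out the Fourier coefficients of \<open>Re F\<close> of nonnegative
order, which are half the coefficients of \<open>F\<close> except at \<open>0\<close>.\<close>

lemma poly_Schwarz_formula:
  fixes F :: "complex poly"
  assumes z: "norm z < 1" and F0: "poly F 0 = 1"
  shows "(\<integral>\<zeta>. (\<zeta> + z) / (\<zeta> - z) * of_real (Re (poly F \<zeta>)) \<partial>circle_measure) = poly F z"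
proof -
  define \<phi> where "\<phi> = (\<lambda>\<zeta>. complex_of_real (Re (poly F \<zeta>)))"
  define f where "f = (\<lambda>j. \<integral>\<zeta>. \<phi> \<zeta> * cnj \<zeta> ^ j \<partial>circle_measure)"
  have \<phi>c: "continuous_on UNIV \<phi>" unfolding \<phi>_def by (intro continuous_intros)
  have "compact (\<phi> ` sphere 0 1)"
    using \<phi>c by (intro compact_continuous_image) (auto intro: continuous_on_subset)
  then obtain B where B: "\<And>\<zeta>. norm \<zeta> = 1 \<Longrightarrow> norm (\<phi> \<zeta>) \<le> B"
    by (metis bounded_iff compact_imp_bounded imageI mem_sphere_0)
  have B0: "0 \<le> B" using order_trans[OF norm_ge_zero B[of 1]] by simp
  have coeff: "f j = (poly.coeff F j + (if j = 0 then 1 else 0)) / 2" for j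
  proof -
    have c0: "poly.coeff F 0 = 1" using F0 by (simp add: poly_0_coeff_0)
    have e: "\<phi> \<zeta> * cnj \<zeta> ^ j = (\<Sum>m\<le>degree F. poly.coeff F m / 2 * (\<zeta> ^ m * cnj \<zeta> ^ j))
        + (\<Sum>m\<le>degree F. cnj (poly.coeff F m) / 2 * cnj \<zeta> ^ (m + j))" for \<zeta>
    proof -
      have "\<phi> \<zeta> = (poly F \<zeta> + cnj (poly F \<zeta>)) / 2" by (simp add: \<phi>_def complex_eq_iff)
      then show ?thesis
        by (simp add: poly_altdef sum_distrib_left sum_distrib_right sum_divide_distrib add_divide_distrib power_add algebra_simps)
    qed
    have "f j = (\<Sum>m\<le>degree F. poly.coeff F m / 2 * (if m = j then 1 else 0))
        + (\<Sum>m\<le>degree F. cnj (poly.coeff F m) / 2 * (if m + j = 0 then 1 else 0))"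
    proof -
      have "integrable circle_measure (\<lambda>\<zeta>. c * (\<zeta> ^ m * cnj \<zeta> ^ j))"
        "integrable circle_measure (\<lambda>\<zeta>. c * cnj \<zeta> ^ (m + j))" for c and m :: nat
        by (intro circle_integrable_continuous continuous_intros)+
      then show ?thesis
        unfolding f_def e
        by (simp only: Bochner_Integration.integral_add Bochner_Integration.integral_sum
            Bochner_Integration.integrable_sum integral_mult_right_zero circle_orthonormal circle_power_integral)
    qed
    also have "(\<Sum>m\<le>degree F. poly.coeff F m / 2 * (if m = j then 1 else 0)) = poly.coeff F j / 2"
      by (simp add: if_distrib[of "\<lambda>x. _ * x"] sum.delta coeff_eq_0 cong: if_cong)
    also have "(\<Sum>m\<le>degree F. cnj (poly.coeff F m) / 2 * (if m + j = 0 then 1 else 0)) = (if j = 0 then 1 / 2 else 0)"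
      using c0 by (auto simp: if_distrib[of "\<lambda>x. _ * x"] sum.delta cong: if_cong)
    finally show ?thesis by (simp add: add_divide_distrib)
  qed
  have meas: "(\<lambda>\<zeta>. \<phi> \<zeta> * inverse (1 - z * cnj \<zeta>)) \<in> borel_measurable borel"
  proof -
    have "\<phi> \<in> borel_measurable borel" "(\<lambda>\<zeta>. 1 - z * cnj \<zeta>) \<in> borel_measurable borel"
      by (intro borel_measurable_continuous_onI \<phi>c continuous_intros)+
    then show ?thesis by simp
  qed
  have den: "norm (inverse (1 - z * cnj \<zeta>)) \<le> 1 / (1 - norm z)" if "norm \<zeta> = 1" for \<zeta>
  proof -
    have "1 - norm z \<le> norm (1 - z * cnj \<zeta>)"
      using norm_triangle_ineq2[of 1 "z * cnj \<zeta>"] that by (simp add: norm_mult)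
    then show ?thesis using z by (simp add: inverse_eq_divide norm_divide frac_le)
  qed
  have nz: "1 - z * cnj \<zeta> \<noteq> 0" if "norm \<zeta> = 1" for \<zeta>
    using z that by (metis complex_mod_cnj eq_iff_diff_eq_0 less_irrefl mult.right_neutral norm_mult norm_one)
  have intk: "integrable circle_measure (\<lambda>\<zeta>. \<phi> \<zeta> * inverse (1 - z * cnj \<zeta>))"
  proof (rule circle_integrable[OF meas])
    show "norm (\<phi> \<zeta> * inverse (1 - z * cnj \<zeta>)) \<le> B * (1 / (1 - norm z))" if "norm \<zeta> = 1" for \<zeta>
      unfolding norm_mult using B[OF that] den[OF that] B0 by (intro mult_mono) auto
  qed
  define I where "I = (\<integral>\<zeta>. \<phi> \<zeta> * inverse (1 - z * cnj \<zeta>) \<partial>circle_measure)"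
  have diff: "norm (I - (\<Sum>j<n. z ^ j * f j)) \<le> norm z ^ n * (B * (1 / (1 - norm z)))" for n
  proof -
    have ci: "integrable circle_measure (\<lambda>\<zeta>. \<phi> \<zeta> * (\<Sum>j<n. (z * cnj \<zeta>) ^ j))"
      by (intro circle_integrable_continuous continuous_intros \<phi>c)
    have "(\<integral>\<zeta>. \<phi> \<zeta> * (\<Sum>j<n. (z * cnj \<zeta>) ^ j) \<partial>circle_measure)
        = (\<integral>\<zeta>. (\<Sum>j<n. z ^ j * (\<phi> \<zeta> * cnj \<zeta> ^ j)) \<partial>circle_measure)"
      by (intro Bochner_Integration.integral_cong)
         (auto simp: sum_distrib_left power_mult_distrib mult_ac)
    also have "\<dots> = (\<Sum>j<n. z ^ j * f j)"
      unfolding f_def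
      by (subst Bochner_Integration.integral_sum,
          intro integrable_mult_right circle_integrable_continuous continuous_intros \<phi>c) simp
    finally have "I - (\<Sum>j<n. z ^ j * f j)
       = (\<integral>\<zeta>. \<phi> \<zeta> * inverse (1 - z * cnj \<zeta>) - \<phi> \<zeta> * (\<Sum>j<n. (z * cnj \<zeta>) ^ j) \<partial>circle_measure)"
      unfolding I_def using Bochner_Integration.integral_diff[OF intk ci] by simp
    also have "norm \<dots> \<le> norm z ^ n * (B * (1 / (1 - norm z)))"
    proof (rule circle_integral_bound)
      show "AE \<zeta> in circle_measure. norm (\<phi> \<zeta> * inverse (1 - z * cnj \<zeta>) - \<phi> \<zeta> * (\<Sum>j<n. (z * cnj \<zeta>) ^ j))
          \<le> norm z ^ n * (B * (1 / (1 - norm z)))"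
        using AE_circle_norm
      proof eventually_elim
        case (elim \<zeta>)
        have "(\<Sum>j<n. (z * cnj \<zeta>) ^ j) = (1 - (z * cnj \<zeta>) ^ n) * inverse (1 - z * cnj \<zeta>)"
          using nz[OF elim] by (simp add: sum_gp_strict divide_inverse)
        then have "\<phi> \<zeta> * inverse (1 - z * cnj \<zeta>) - \<phi> \<zeta> * (\<Sum>j<n. (z * cnj \<zeta>) ^ j)
           = (z * cnj \<zeta>) ^ n * (\<phi> \<zeta> * inverse (1 - z * cnj \<zeta>))"
          by (simp only: left_diff_distrib right_diff_distrib) (simp add: mult_ac)
        also have "norm \<dots> = norm z ^ n * (norm (\<phi> \<zeta>) * norm (inverse (1 - z * cnj \<zeta>)))"
          using elim by (simp add: norm_mult norm_power)
        also have "\<dots> \<le> norm z ^ n * (B * (1 / (1 - norm z)))"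
          using B[OF elim] den[OF elim] B0 by (intro mult_left_mono mult_mono) auto
        finally show ?case .
      qed
    qed (use B0 z in auto)
    finally show ?thesis .
  qed
  have "(\<lambda>n. norm z ^ n * (B * (1 / (1 - norm z)))) \<longlonglongrightarrow> 0"
    using z by (intro tendsto_mult_left_zero LIMSEQ_power_zero) simp
  then have "(\<lambda>n. I - (\<Sum>j<n. z ^ j * f j)) \<longlonglongrightarrow> 0"
    by (rule Lim_null_comparison[rotated]) (intro always_eventually allI diff)
  from tendsto_diff[OF tendsto_const[of I] this]
  have I1: "(\<lambda>j. z ^ j * f j) sums I" by (simp add: sums_def)
  have "(\<lambda>j. poly.coeff F j * z ^ j) sums (\<Sum>j\<le>degree F. poly.coeff F j * z ^ j)"
    by (intro sums_finite) (auto simp: coeff_eq_0)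
  moreover have "(\<lambda>j. (if j = 0 then 1 else 0) * z ^ j) sums (\<Sum>j\<le>0. (if j = 0 then 1 else 0) * z ^ j)"
    by (intro sums_finite) auto
  ultimately have "(\<lambda>j. (poly.coeff F j * z ^ j + (if j = 0 then 1 else 0) * z ^ j) / 2) sums ((poly F z + 1) / 2)"
    by (intro sums_divide sums_add) (simp_all add: poly_altdef)
  moreover have "(poly.coeff F j * z ^ j + (if j = 0 then 1 else 0) * z ^ j) / 2 = z ^ j * f j" for j
    by (simp add: coeff algebra_simps)
  ultimately have I: "I = (poly F z + 1) / 2" using I1 sums_unique2 by fastforce
  have f0: "(\<integral>\<zeta>. \<phi> \<zeta> \<partial>circle_measure) = 1"
    using coeff[of 0] F0 by (simp add: f_def poly_0_coeff_0)
  have "(\<integral>\<zeta>. (\<zeta> + z) / (\<zeta> - z) * of_real (Re (poly F \<zeta>)) \<partial>circle_measure)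
     = (\<integral>\<zeta>. 2 * (\<phi> \<zeta> * inverse (1 - z * cnj \<zeta>)) - \<phi> \<zeta> \<partial>circle_measure)"
  proof (rule integral_cong_AE)
    show "(\<lambda>\<zeta>. (\<zeta> + z) / (\<zeta> - z) * of_real (Re (poly F \<zeta>))) \<in> borel_measurable circle_measure"
    proof -
      have "\<phi> \<in> borel_measurable borel" by (intro borel_measurable_continuous_onI \<phi>c)
      then show ?thesis unfolding \<phi>_def by simp
    qed
    show "(\<lambda>\<zeta>. 2 * (\<phi> \<zeta> * inverse (1 - z * cnj \<zeta>)) - \<phi> \<zeta>) \<in> borel_measurable circle_measure"
      using meas borel_measurable_continuous_onI[OF \<phi>c] by simp
    show "AE \<zeta> in circle_measure. (\<zeta> + z) / (\<zeta> - z) * of_real (Re (poly F \<zeta>)) = 2 * (\<phi> \<zeta> * inverse (1 - z * cnj \<zeta>)) - \<phi> \<zeta>"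
      using AE_circle_norm
    proof eventually_elim
      case (elim \<zeta>)
      have u: "\<zeta> * cnj \<zeta> = 1" using complex_norm_square[of \<zeta>] elim by simp
      have d: "\<zeta> - z = \<zeta> * (1 - z * cnj \<zeta>)" using u by (simp add: algebra_simps)
      have "\<zeta> \<noteq> 0" using elim by auto
      then have eq: "(\<zeta> + z) / (\<zeta> - z) = 2 * inverse (1 - z * cnj \<zeta>) - 1"
        using nz[OF elim] u unfolding d by (simp add: field_simps)
      show ?case unfolding eq \<phi>_def by (simp only: left_diff_distrib) (simp add: mult_ac)
    qed
  qed
  also have "\<dots> = 2 * I - 1"
  proof -
    have "integrable circle_measure \<phi>" by (intro circle_integrable_continuous \<phi>c)
    then show ?thesis using intk f0 by (simp add: I_def)
  qed
  finally show ?thesis by (simp add: I add_divide_distrib)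
qed

context riesz_product
begin

lemma Re_step: "norm z = 1 \<Longrightarrow> Re (poly (F (Suc n)) z) = Re (poly (F n) z) * Re (poly (\<psi> n) (z ^ N n))"
  by (simp add: F_step algebra_simps)

lemma factor_Re_power: "norm z = 1 \<Longrightarrow> 0 \<le> Re (poly (\<psi> n) (z ^ N n)) \<and> Re (poly (\<psi> n) (z ^ N n)) \<le> 1 + (1/4) ^ Suc n"
  by (intro factor_Re) (simp add: norm_power)

text \<open>The bounds \<open>2 - 2\<^sup>-\<^sup>n\<close> leave room for one more factor \<open>1 + 4\<^sup>-\<^sup>(\<^sup>n\<^sup>+\<^sup>1\<^sup>)\<close> at each step, so all partial
products stay below 2.\<close>

lemma growth_step:
  fixes x y :: real
  assumes "x \<le> 2 - (1/2) ^ n" "0 \<le> x" "0 \<le> y" "y \<le> 1 + (1/4) ^ Suc n"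
  shows "x * y \<le> 2 - (1/2) ^ Suc n"
proof -
  define t :: real where "t = (1/2) ^ n"
  have t: "0 < t" "t \<le> 1" by (simp_all add: t_def power_le_one)
  have q: "(1/4::real) ^ n = t * t" by (simp add: t_def power_mult_distrib[symmetric])
  have "x * y \<le> (2 - t) * (1 + t * t / 4)"
    using assms t by (intro mult_mono) (auto simp: t_def[symmetric] q)
  also have "\<dots> = 2 - t + t * t / 2 - t * t * t / 4" by (simp add: field_simps)
  also have "\<dots> \<le> 2 - t / 2"
  proof -
    have "t * t \<le> t * 1" using t by (intro mult_left_mono) auto
    moreover have "0 \<le> t * t * t" using t by simp
    ultimately show ?thesis by linarith
  qed
  finally show ?thesis by (simp add: t_def)
qed

lemma Re_bounds:
  assumes z: "norm z = 1"
  shows "0 \<le> Re (poly (F n) z) \<and> Re (poly (F n) z) \<le> 2 - (1/2) ^ n"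
proof (induction n)
  case (Suc n)
  then show ?case
    using factor_Re_power[OF z, of n] growth_step[of "Re (poly (F n) z)" n] by (simp only: Re_step[OF z]) auto
qed (simp add: F_start)

lemma Re_bounds_2:
  assumes z: "norm z = 1" shows "0 \<le> Re (poly (F n) z)" "Re (poly (F n) z) \<le> 2"
proof -
  have "0 \<le> (1/2::real) ^ n" by simp
  then show "0 \<le> Re (poly (F n) z)" "Re (poly (F n) z) \<le> 2" using Re_bounds[OF z, of n] by linarith+
qed

text \<open>All factors other than the \<open>n\<close>-th together contribute less than 2, so the product is small where any
single factor is.\<close>

lemma Re_le_factor:
  assumes z: "norm z = 1"
  shows "Re (poly (F (Suc (n + k))) z) \<le> (2 - (1/2) ^ Suc (n + k)) * Re (poly (\<psi> n) (z ^ N n))"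
proof (induction k)
  case 0
  have "Re (poly (F (Suc n)) z) \<le> (2 - (1/2) ^ n) * Re (poly (\<psi> n) (z ^ N n))"
    unfolding Re_step[OF z] using Re_bounds[OF z, of n] factor_Re_power[OF z, of n] by (intro mult_right_mono) auto
  also have "\<dots> \<le> (2 - (1/2) ^ Suc n) * Re (poly (\<psi> n) (z ^ N n))"
    using factor_Re_power[OF z, of n] by (intro mult_right_mono) auto
  finally show ?case by simp
next
  case (Suc k)
  let ?y = "Re (poly (\<psi> (Suc (n + k))) (z ^ N (Suc (n + k))))"
  let ?p = "Re (poly (\<psi> n) (z ^ N n))"
  have half: "(1/2::real) ^ j \<le> 1" for j by (simp add: power_le_one)
  have "Re (poly (F (Suc (Suc (n + k)))) z) \<le> ((2 - (1/2) ^ Suc (n + k)) * ?p) * ?y"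
    unfolding Re_step[OF z, of "Suc (n + k)"] using Suc factor_Re_power[OF z, of "Suc (n + k)"] by (intro mult_right_mono) auto
  also have "\<dots> = ((2 - (1/2) ^ Suc (n + k)) * ?y) * ?p" by (simp add: mult_ac)
  also have "\<dots> \<le> (2 - (1/2) ^ Suc (Suc (n + k))) * ?p"
    using factor_Re_power[OF z, of "Suc (n + k)"] factor_Re_power[OF z, of n] half[of "Suc (n + k)"]
    by (intro mult_right_mono growth_step) (simp_all del: power_Suc)
  finally show ?case by simp
qed

lemma F_increment:
  assumes "norm z \<le> 1" "(1/4) ^ Suc n \<le> norm (z ^ N n - 1)"
  shows "norm (poly (F (Suc n)) z - poly (F n) z) \<le> (1/4) ^ n"
proof (rule F_far[OF _ assms])
  fix \<zeta> :: complex assume "norm \<zeta> = 1"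
  then show "\<bar>Re (poly (F n) \<zeta>)\<bar> \<le> 2" using Re_bounds_2[of \<zeta> n] by linarith
qed

definition F_lim :: "complex \<Rightarrow> complex" where "F_lim z = lim (\<lambda>n. poly (F n) z)"

lemma uniform_limit_F:
  assumes S: "\<And>z n. z \<in> S \<Longrightarrow> n0 \<le> n \<Longrightarrow> norm z \<le> 1 \<and> (1/4) ^ Suc n \<le> norm (z ^ N n - 1)"
  shows "uniform_limit S (\<lambda>n z. poly (F n) z) F_lim sequentially"
proof -
  have tail: "norm (poly (F (n + k)) z - poly (F n) z) \<le> (\<Sum>i<k. (1/4) ^ (n + i))" if "z \<in> S" "n0 \<le> n" for z n k
  proof (induction k)
    case (Suc k)
    have "norm (poly (F (Suc (n + k))) z - poly (F (n + k)) z) \<le> (1/4) ^ (n + k)"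
      using S[OF that(1), of "n + k"] that(2) by (intro F_increment) auto
    then show ?case
      using Suc norm_triangle_ineq[of "poly (F (Suc (n + k))) z - poly (F (n + k)) z" "poly (F (n + k)) z - poly (F n) z"]
      by simp
  qed simp
  have geo: "(\<Sum>i<k. (1/4::real) ^ (n + i)) \<le> 2 * (1/4) ^ n" for n k
  proof -
    have "(\<Sum>i<k. (1/4::real) ^ i) \<le> (\<Sum>i. (1/4) ^ i)"
      by (intro sum_le_suminf summable_geometric) auto
    also have "\<dots> = 1 / (1 - 1/4)" by (intro suminf_geometric) simp
    finally have "(\<Sum>i<k. (1/4::real) ^ i) \<le> 2" by simp
    then have "(1/4) ^ n * (\<Sum>i<k. (1/4::real) ^ i) \<le> (1/4) ^ n * 2" by (intro mult_left_mono) auto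
    then show ?thesis by (simp add: power_add sum_distrib_left mult.commute)
  qed
  have d: "dist (poly (F m) z) (poly (F n) z) \<le> 2 * (1/4) ^ n" if "z \<in> S" "n0 \<le> n" "n \<le> m" for z m n
    using tail[OF that(1,2), of "m - n"] geo[where k = "m - n" and n = n] that(3) by (simp add: dist_norm)
  have "uniformly_Cauchy_on S (\<lambda>n z. poly (F n) z)"
    unfolding uniformly_Cauchy_on_def
  proof (intro allI impI)
    fix e :: real assume e: "0 < e"
    have "(\<lambda>n. 2 * (1/4::real) ^ n) \<longlonglongrightarrow> 0"
      by (intro tendsto_mult_right_zero LIMSEQ_power_zero) simp
    then have "eventually (\<lambda>n. 2 * (1/4::real) ^ n < e) sequentially" using e by (rule order_tendstoD)
    then obtain n1 where n1: "\<And>n. n1 \<le> n \<Longrightarrow> 2 * (1/4::real) ^ n < e"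
      by (auto simp: eventually_sequentially)
    have "dist (poly (F m) z) (poly (F n) z) < e" if "z \<in> S" "max n0 n1 \<le> m" "max n0 n1 \<le> n" for z m n
    proof (cases "n \<le> m")
      case True
      then show ?thesis using d[of z n m] n1[of n] that by auto
    next
      case False
      then show ?thesis using d[of z m n] n1[of m] that by (auto simp: dist_commute)
    qed
    then show "\<exists>M. \<forall>x\<in>S. \<forall>m\<ge>M. \<forall>n\<ge>M. dist (poly (F m) x) (poly (F n) x) < e" by blast
  qed
  from Cauchy_uniformly_convergent[OF this] show ?thesis
    unfolding uniformly_convergent_uniform_limit_iff F_lim_def[abs_def] .
qed

lemma uniform_limit_disc:
  assumes \<rho>: "0 \<le> \<rho>" "\<rho> < 1"
  shows "uniform_limit (cball 0 \<rho>) (\<lambda>n z. poly (F n) z) F_lim sequentially"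
proof -
  have "(\<lambda>n. \<rho> ^ n) \<longlonglongrightarrow> 0" using \<rho> by (intro LIMSEQ_power_zero) simp
  then have "eventually (\<lambda>n. \<rho> ^ n < 1/2) sequentially" by (rule order_tendstoD) simp
  then obtain n0 where n0: "\<And>n. n0 \<le> n \<Longrightarrow> \<rho> ^ n < 1/2" by (auto simp: eventually_sequentially)
  show ?thesis
  proof (rule uniform_limit_F)
    fix z :: complex and n assume z: "z \<in> cball 0 \<rho>" and n: "n0 \<le> n"
    have "norm (z ^ N n) \<le> \<rho> ^ N n" using z by (simp add: norm_power power_mono)
    also have "\<dots> < 1/2" using N_gt[of n] n by (intro n0) simp
    finally have "1/2 \<le> norm (z ^ N n - 1)"
      using norm_triangle_ineq2[of 1 "z ^ N n"] by (simp add: norm_minus_commute)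
    moreover have "(1/4::real) ^ Suc n \<le> 1/2" using power_le_one[of "1/4::real" n] by simp
    ultimately show "norm z \<le> 1 \<and> (1/4) ^ Suc n \<le> norm (z ^ N n - 1)" using z \<rho> by simp
  qed
qed

lemma F_tendsto:
  assumes "norm z < 1" shows "(\<lambda>n. poly (F n) z) \<longlonglongrightarrow> F_lim z"
  using tendsto_uniform_limitI[OF uniform_limit_disc[of "norm z"]] assms by simp

lemma F_lim_zero: "F_lim 0 = 1"
  using F_tendsto[of 0] by (simp add: F_zero LIMSEQ_const_iff)

lemma F_lim_holomorphic: "F_lim holomorphic_on ball 0 1"
proof (rule holomorphic_uniform_sequence[of _ "\<lambda>n. poly (F n)"])
  fix x :: complex assume "x \<in> ball 0 1"
  then have x: "norm x < 1" by simp
  define d where "d = (1 - norm x) / 2"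
  have sub: "cball x d \<subseteq> cball 0 ((1 + norm x) / 2)"
  proof
    fix y assume "y \<in> cball x d"
    then show "y \<in> cball 0 ((1 + norm x) / 2)"
      using norm_triangle_ineq2[of y x] by (simp add: d_def dist_norm norm_minus_commute field_simps)
  qed
  have "uniform_limit (cball x d) (\<lambda>n z. poly (F n) z) F_lim sequentially"
    using uniform_limit_disc[of "(1 + norm x) / 2"] x by (intro uniform_limit_on_subset[OF _ sub]) auto
  moreover have "cball x d \<subseteq> ball 0 1" using sub x by force
  moreover have "0 < d" using x by (simp add: d_def)
  ultimately show "\<exists>d>0. cball x d \<subseteq> ball 0 1 \<and> uniform_limit (cball x d) (\<lambda>n. poly (F n)) F_lim sequentially" by blast
qed (auto intro: holomorphic_intros)

text \<open>By Borel--Cantelli almost every \<open>\<zeta>\<close> has \<open>|\<zeta>\<^bsup>N n\<^esup> - 1| > 2\<^sup>-\<^sup>n\<close> for all large \<open>n\<close>. The increments are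
small unless \<open>z\<^bsup>N n\<^esup>\<close> is within \<open>4\<^sup>-\<^sup>(\<^sup>n\<^sup>+\<^sup>1\<^sup>)\<close> of \<open>1\<close>, which is so much less that, for every
aperture, it eventually does not happen in the Stolz region at \<open>\<zeta>\<close>.\<close>

lemma AE_stolz_limit:
  "AE \<zeta> in circle_measure. norm \<zeta> = 1 \<and> (\<lambda>n. poly (F n) \<zeta>) \<longlonglongrightarrow> F_lim \<zeta> \<and>
     (\<forall>\<alpha>>1. (F_lim \<longlongrightarrow> F_lim \<zeta>) (at \<zeta> within stolz_region \<zeta> \<alpha>))"
proof -
  define A where "A = (\<lambda>n. {\<zeta>::complex. norm (\<zeta> ^ N n - 1) \<le> 1 / real (2 ^ n)})"
  have As: "A n \<in> sets borel" for n
    unfolding A_def by (intro borel_closed closed_Collect_le continuous_intros)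
  have Am: "measure circle_measure (A n) \<le> 4 * (1/2) ^ n" for n
    using circle_measure_near_roots[of "N n" "2 ^ n"] N_gt[of n]
    unfolding A_def by (simp add: power_one_over divide_simps)
  have "AE \<zeta> in circle_measure. \<forall>\<^sub>F n in sequentially. \<zeta> \<in> space circle_measure - A n"
  proof (rule borel_cantelli_AE1)
    show "A n \<in> sets circle_measure" for n using As by simp
    show "emeasure circle_measure (A n) < \<infinity>" for n by (simp add: circle.emeasure_eq_measure)
    show "summable (\<lambda>n. measure circle_measure (A n))"
    proof (rule summable_comparison_test[of _ "\<lambda>n. 4 * (1/2) ^ n"])
      show "\<exists>M. \<forall>n\<ge>M. norm (measure circle_measure (A n)) \<le> 4 * (1/2) ^ n" using Am by simp
      show "summable (\<lambda>n. 4 * (1/2::real) ^ n)" by (intro summable_mult summable_geometric) simp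
    qed
  qed
  then show ?thesis
    using AE_circle_norm
  proof eventually_elim
    case (elim \<zeta>)
    then obtain n1 where n1: "\<And>n. n1 \<le> n \<Longrightarrow> 1 / 2 ^ n < norm (\<zeta> ^ N n - 1)"
      by (auto simp: A_def eventually_sequentially not_le)
    have ul: "uniform_limit (insert \<zeta> (stolz_region \<zeta> \<alpha>)) (\<lambda>n z. poly (F n) z) F_lim sequentially" if \<alpha>: "1 < \<alpha>" for \<alpha>
    proof -
      have "(\<lambda>n. (2 * \<alpha> + 1) * (1/2::real) ^ n) \<longlonglongrightarrow> 0"
        by (intro tendsto_mult_right_zero LIMSEQ_power_zero) simp
      then have "eventually (\<lambda>n. (2 * \<alpha> + 1) * (1/2::real) ^ n < 1) sequentially" by (rule order_tendstoD) simp
      then obtain n2 where n2: "\<And>n. n2 \<le> n \<Longrightarrow> (2 * \<alpha> + 1) * (1/2::real) ^ n < 1" by (auto simp: eventually_sequentially)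
      show ?thesis
      proof (rule uniform_limit_F)
        fix z n assume z: "z \<in> insert \<zeta> (stolz_region \<zeta> \<alpha>)" and n: "max n1 n2 \<le> n"
        have q: "(1/4::real) ^ Suc n \<le> 1 / 2 ^ n"
        proof -
          have "(1/4::real) ^ Suc n \<le> (1/4) ^ n" by simp
          also have "\<dots> \<le> (1/2) ^ n" by (intro power_mono) auto
          finally show ?thesis by (simp add: power_one_over)
        qed
        have s: "(1/4::real) ^ Suc n \<le> 1/2" using power_le_one[of "1/4::real" n] by simp
        have "norm z \<le> 1" using z elim by (auto simp: stolz_region_def)
        moreover have "(1/4) ^ Suc n \<le> norm (z ^ N n - 1)"
        proof (cases "z = \<zeta>")
          case True
          then show ?thesis using n1[of n] n q by simp
        next
          case False
          show ?thesis
          proof (rule ccontr)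
            assume "\<not> ?thesis"
            then have "norm (\<zeta> ^ N n - 1) \<le> (2 * \<alpha> + 1) * (1/4) ^ Suc n"
              using z False elim \<alpha> s by (intro stolz_power_near_one[of \<zeta> z]) auto
            also have "\<dots> \<le> (2 * \<alpha> + 1) * (1/4) ^ n" using \<alpha> by (intro mult_left_mono) auto
            also have "\<dots> = ((2 * \<alpha> + 1) * (1/2) ^ n) * (1/2) ^ n" by (simp add: power_mult_distrib[symmetric] mult.assoc)
            also have "\<dots> \<le> 1 * (1/2) ^ n" using n2[of n] n by (intro mult_right_mono) auto
            finally show False using n1[of n] n by (simp add: power_one_over)
          qed
        qed
        ultimately show "norm z \<le> 1 \<and> (1/4) ^ Suc n \<le> norm (z ^ N n - 1)" by simp
      qed
    qed
    have "(\<lambda>n. poly (F n) \<zeta>) \<longlonglongrightarrow> F_lim \<zeta>"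
      using tendsto_uniform_limitI[OF ul[of 2]] by simp
    moreover have "(F_lim \<longlongrightarrow> F_lim \<zeta>) (at \<zeta> within stolz_region \<zeta> \<alpha>)" if \<alpha>: "1 < \<alpha>" for \<alpha>
    proof -
      have "continuous_on (insert \<zeta> (stolz_region \<zeta> \<alpha>)) F_lim"
        by (rule uniform_limit_theorem[OF _ ul[OF \<alpha>]]) (auto intro!: always_eventually continuous_intros)
      then have "(F_lim \<longlongrightarrow> F_lim \<zeta>) (at \<zeta> within insert \<zeta> (stolz_region \<zeta> \<alpha>))"
        by (simp add: continuous_on)
      then show ?thesis by (rule tendsto_within_subset) auto
    qed
    ultimately show ?case using elim by simp
  qed
qed

lemma F_lim_measurable: "F_lim \<in> borel_measurable borel"
  unfolding F_lim_def
  by (intro borel_measurable_lim_metric borel_measurable_continuous_onI continuous_intros)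

lemma AE_Re_F_lim: "AE \<zeta> in circle_measure. 0 \<le> Re (F_lim \<zeta>) \<and> Re (F_lim \<zeta>) \<le> 2"
  using AE_stolz_limit
proof eventually_elim
  case (elim \<zeta>)
  then have l: "(\<lambda>n. Re (poly (F n) \<zeta>)) \<longlonglongrightarrow> Re (F_lim \<zeta>)" by (auto intro: tendsto_Re)
  have "0 \<le> Re (poly (F n) \<zeta>) \<and> Re (poly (F n) \<zeta>) \<le> 2" for n
    using Re_bounds_2[of \<zeta> n] elim by auto
  then show ?case using LIMSEQ_le_const[OF l] LIMSEQ_le_const2[OF l] by blast
qed

lemma F_lim_herglotz:
  assumes z: "norm z < 1"
  shows "F_lim z = (\<integral>\<zeta>. (\<zeta> + z) / (\<zeta> - z) * of_real (Re (F_lim \<zeta>)) \<partial>circle_measure)"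
proof -
  have ker: "norm ((\<zeta> + z) / (\<zeta> - z)) \<le> 2 / (1 - norm z)" if "norm \<zeta> = 1" for \<zeta>
  proof -
    have "norm (\<zeta> + z) \<le> 2" using norm_triangle_ineq[of \<zeta> z] that z by simp
    moreover have "1 - norm z \<le> norm (\<zeta> - z)" using norm_triangle_ineq2[of \<zeta> z] that by simp
    ultimately show ?thesis using z by (simp add: norm_divide frac_le)
  qed
  have "(\<lambda>n. \<integral>\<zeta>. (\<zeta> + z) / (\<zeta> - z) * of_real (Re (poly (F n) \<zeta>)) \<partial>circle_measure)
     \<longlonglongrightarrow> (\<integral>\<zeta>. (\<zeta> + z) / (\<zeta> - z) * of_real (Re (F_lim \<zeta>)) \<partial>circle_measure)"
  proof (rule integral_dominated_convergence[where w = "\<lambda>_. 2 / (1 - norm z) * 2"])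
    show "(\<lambda>\<zeta>. (\<zeta> + z) / (\<zeta> - z) * of_real (Re (F_lim \<zeta>))) \<in> borel_measurable circle_measure"
      using F_lim_measurable by simp
    show "(\<lambda>\<zeta>. (\<zeta> + z) / (\<zeta> - z) * of_real (Re (poly (F n) \<zeta>))) \<in> borel_measurable circle_measure" for n
    proof -
      have "poly (F n) \<in> borel_measurable borel"
        by (intro borel_measurable_continuous_onI continuous_intros)
      then show ?thesis by simp
    qed
    show "AE \<zeta> in circle_measure. (\<lambda>n. (\<zeta> + z) / (\<zeta> - z) * of_real (Re (poly (F n) \<zeta>)))
        \<longlonglongrightarrow> (\<zeta> + z) / (\<zeta> - z) * of_real (Re (F_lim \<zeta>))"
      using AE_stolz_limit by eventually_elim (intro tendsto_mult tendsto_of_real tendsto_Re tendsto_const, simp)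
    show "AE \<zeta> in circle_measure. norm ((\<zeta> + z) / (\<zeta> - z) * of_real (Re (poly (F n) \<zeta>))) \<le> 2 / (1 - norm z) * 2" for n
      using AE_circle_norm
    proof eventually_elim
      case (elim \<zeta>)
      have "\<bar>Re (poly (F n) \<zeta>)\<bar> \<le> 2"
        using Re_bounds_2[OF elim, of n] by auto
      then show ?case using ker[OF elim] z unfolding norm_mult norm_of_real
        by (intro mult_mono) auto
    qed
  qed simp
  then show ?thesis
    unfolding poly_Schwarz_formula[OF z F_zero] by (rule LIMSEQ_unique[OF F_tendsto[OF z]])
qed

text \<open>\<open>exp (- F_lim)\<close> is bounded by 1, being a limit of functions that are so bounded on the circle; it cannot
attain modulus 1 inside, since it is not constant of modulus 1: its value at \<open>0\<close> is \<open>exp (- 1)\<close>.\<close>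

lemma Re_F_lim_pos:
  assumes z: "norm z < 1"
  shows "0 < Re (F_lim z)"
proof -
  have le: "norm (exp (- F_lim w)) \<le> 1" if w: "norm w < 1" for w
  proof -
    have "norm (exp (- poly (F n) w)) \<le> 1" for n
    proof (rule maximum_modulus_frontier[of "\<lambda>w. exp (- poly (F n) w)" "cball 0 1"])
      show "norm (exp (- poly (F n) z)) \<le> 1" if "z \<in> frontier (cball 0 1)" for z
        using that Re_bounds_2[of z n] by (simp add: frontier_cball)
    qed (use w in \<open>auto intro!: holomorphic_intros continuous_intros\<close>)
    moreover have "(\<lambda>n. norm (exp (- poly (F n) w))) \<longlonglongrightarrow> norm (exp (- F_lim w))"
      by (intro tendsto_intros F_tendsto w)
    ultimately show ?thesis by (intro LIMSEQ_le_const2) auto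
  qed
  have "Re (F_lim z) \<noteq> 0"
  proof
    assume 0: "Re (F_lim z) = 0"
    have "(\<lambda>w. exp (- F_lim w)) constant_on ball 0 1"
    proof (rule maximum_modulus_principle[of _ _ "ball 0 1" z])
      show "(\<lambda>w. exp (- F_lim w)) holomorphic_on ball 0 1" by (intro holomorphic_intros F_lim_holomorphic)
      show "norm (exp (- F_lim w)) \<le> norm (exp (- F_lim z))" if "w \<in> ball 0 1" for w
        using le[of w] that 0 by simp
    qed (use z in auto)
    then have "exp (- F_lim z) = exp (- F_lim 0)" using z unfolding constant_on_def by (metis centre_in_ball mem_ball_0 zero_less_one)
    then have "norm (exp (- F_lim z)) = norm (exp (- F_lim 0))" by simp
    then show False using 0 by (simp add: F_lim_zero)
  qed
  moreover have "0 \<le> Re (F_lim z)" using le[OF z] by simp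
  ultimately show ?thesis by simp
qed

lemma outer_exp_F_lim: "outer_function (\<lambda>z. exp (- F_lim z))"
  unfolding outer_function_def
proof (intro conjI exI[of _ "\<lambda>z. exp (- F_lim z)"])
  show "(\<lambda>z. exp (- F_lim z)) holomorphic_on ball 0 1"
    by (intro holomorphic_intros F_lim_holomorphic)
  show "bounded ((\<lambda>z. exp (- F_lim z)) ` ball 0 1)"
    unfolding bounded_iff using Re_F_lim_pos by (intro exI[of _ 1]) (auto intro!: less_imp_le)
  show "AE \<zeta> in circle_measure. has_nontangential_limit (\<lambda>z. exp (- F_lim z)) (exp (- F_lim \<zeta>)) \<zeta>"
    using AE_stolz_limit by eventually_elim (auto simp: has_nontangential_limit_def intro!: tendsto_intros)
  show "AE \<zeta> in circle_measure. exp (- F_lim \<zeta>) \<noteq> 0" by simp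
  have Rem: "(\<lambda>\<zeta>. - Re (F_lim \<zeta>)) \<in> borel_measurable circle_measure" using F_lim_measurable by simp
  have "integrable circle_measure (\<lambda>\<zeta>. - Re (F_lim \<zeta>))"
  proof (rule circle.integrable_const_bound[of _ 2, OF _ Rem])
    show "AE \<zeta> in circle_measure. norm (- Re (F_lim \<zeta>)) \<le> 2"
      using AE_Re_F_lim by eventually_elim simp
  qed
  then show "integrable circle_measure (\<lambda>\<zeta>. ln (norm (exp (- F_lim \<zeta>))))" by simp
  show "\<forall>z\<in>ball 0 1. exp (- F_lim z) =
      exp (\<integral>\<zeta>. (\<zeta> + z) / (\<zeta> - z) * of_real (ln (norm (exp (- F_lim \<zeta>)))) \<partial>circle_measure)"
    using F_lim_herglotz by simp
qed

end

section \<open>Smooth functions in the space\<close>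

lemma entire_coeffs:
  fixes g :: "complex \<Rightarrow> complex"
  assumes "g holomorphic_on UNIV"
  obtains q where "\<And>z. (\<lambda>i. q i * z ^ i) sums g z"
proof (rule that)
  fix z :: complex
  have "g holomorphic_on ball 0 (norm z + 1)" using assms by (rule holomorphic_on_subset) simp
  from holomorphic_power_series[OF this, of z]
  show "(\<lambda>i. (deriv ^^ i) g 0 / fact i * z ^ i) sums g z" by simp
qed

text \<open>Dividing \<open>p\<close> by \<open>exp (- F_lim)\<close> hardly increases the norm: \<open>exp (2 u) \<le> 1 + 2 u exp 4\<close> for \<open>0 \<le> u \<le> 2\<close>,
and \<open>u |p|\<^sup>2\<close> is at most \<open>2 \<delta>\<close> on the circle. The estimate is made for the polynomials \<open>F m\<close>, where
the circle is available, and carried over to smaller circles in the limit.\<close>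

lemma (in riesz_product) reciprocal_multiplier_coeffs:
  assumes Q: "\<And>z. norm z = 1 \<Longrightarrow> Re (poly (\<psi> n) z) * (norm (Q z))\<^sup>2 \<le> \<delta>"
    and p: "p holomorphic_on UNIV" "\<And>z. norm z < 2 \<Longrightarrow> (\<lambda>j. a j * z ^ j) sums p z"
    and pQ: "\<And>z. norm z = 1 \<Longrightarrow> norm (p z) = norm (Q (z ^ N n))"
    and h: "\<And>z. norm z < 1 \<Longrightarrow> (\<lambda>j. e j * z ^ j) sums (p z * exp (F_lim z))"
  shows "(\<Sum>j<M. (norm (e j))\<^sup>2) \<le> (\<Sum>j. (norm (a j))\<^sup>2) + 4 * exp 4 * \<delta>"
proof -
  let ?B = "(\<Sum>j. (norm (a j))\<^sup>2) + 4 * exp 4 * \<delta>"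
  have approx: "\<exists>c. (\<forall>z. norm z < 2 \<longrightarrow> (\<lambda>j. c j * z ^ j) sums (p z * exp (poly (F m) z))) \<and>
      summable (\<lambda>j. (norm (c j))\<^sup>2) \<and> (\<Sum>j. (norm (c j))\<^sup>2) \<le> ?B" if m: "n < m" for m
  proof -
    have "(\<lambda>z. p z * exp (poly (F m) z)) holomorphic_on ball 0 2"
      using p(1) by (intro holomorphic_intros) (auto intro: holomorphic_on_subset)
    then obtain c where c: "\<And>z. norm z < 2 \<Longrightarrow> (\<lambda>j. c j * z ^ j) sums (p z * exp (poly (F m) z))"
      using power_series_coeffs by blast
    have "(norm (p z * exp (poly (F m) z)))\<^sup>2 \<le> (norm (p z))\<^sup>2 + 4 * exp 4 * \<delta>" if z: "norm z = 1" for z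
    proof -
      define u where "u = Re (poly (F m) z)"
      have u: "0 \<le> u" "u \<le> 2" using Re_bounds_2[OF z, of m] by (auto simp: u_def)
      have \<psi>0: "0 \<le> Re (poly (\<psi> n) (z ^ N n))" using factor_Re_power[OF z] by simp
      obtain k where k: "m = Suc (n + k)" using m less_iff_Suc_add by blast
      have "u \<le> (2 - (1/2) ^ m) * Re (poly (\<psi> n) (z ^ N n))"
        using Re_le_factor[OF z, of n k] by (simp add: u_def k)
      also have "\<dots> \<le> 2 * Re (poly (\<psi> n) (z ^ N n))" using \<psi>0 by (intro mult_right_mono) auto
      finally have "u * (norm (p z))\<^sup>2 \<le> (2 * Re (poly (\<psi> n) (z ^ N n))) * (norm (p z))\<^sup>2"
        by (intro mult_right_mono) auto
      also have "\<dots> \<le> 2 * \<delta>" using Q[of "z ^ N n"] z by (simp add: pQ[OF z] norm_power)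
      finally have uQ: "u * (norm (p z))\<^sup>2 \<le> 2 * \<delta>" .
      have "exp (2 * u) \<le> 1 + 2 * u * exp (2 * u)"
      proof -
        have "exp (2 * u) * (1 + - (2 * u)) \<le> exp (2 * u) * exp (- (2 * u))"
          by (intro mult_left_mono exp_ge_add_one_self) auto
        then show ?thesis by (simp add: exp_minus algebra_simps)
      qed
      also have "\<dots> \<le> 1 + 2 * u * exp 4" using u by (intro add_left_mono mult_left_mono) auto
      finally have ex: "exp (2 * u) \<le> 1 + 2 * u * exp 4" .
      have "(norm (p z * exp (poly (F m) z)))\<^sup>2 = (norm (p z))\<^sup>2 * exp (2 * u)"
        by (simp add: norm_mult power_mult_distrib u_def exp_double)
      also have "\<dots> \<le> (norm (p z))\<^sup>2 * (1 + 2 * u * exp 4)" using ex by (intro mult_left_mono) auto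
      also have "\<dots> = (norm (p z))\<^sup>2 + 2 * exp 4 * (u * (norm (p z))\<^sup>2)" by (simp add: algebra_simps)
      also have "\<dots> \<le> (norm (p z))\<^sup>2 + 2 * exp 4 * (2 * \<delta>)" using uQ by (intro add_left_mono mult_left_mono) auto
      finally show ?thesis by simp
    qed
    note this = parseval_compare[of 2 c _ a p 1, OF c p(2) _ _ this]
    then show ?thesis using c by (intro exI[of _ c]) auto
  qed
  show ?thesis
  proof (rule sum_le_of_radii)
    fix \<rho> :: real assume \<rho>: "0 < \<rho>" "\<rho> < 1"
    let ?X = "\<Sum>j. (norm (e j))\<^sup>2 * \<rho> ^ (2 * j)"
    have main: "summable (\<lambda>j. (norm (e j))\<^sup>2 * \<rho> ^ (2 * j)) \<and> ?X \<le> exp (2 * \<eta>) * ?B" if \<eta>: "0 < \<eta>" for \<eta>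
    proof -
      have "\<forall>\<^sub>F m in sequentially. \<forall>z\<in>cball 0 \<rho>. dist (poly (F m) z) (F_lim z) < \<eta>"
        using uniform_limit_disc[of \<rho>] \<rho> \<eta> by (auto simp: uniform_limit_iff)
      then obtain m where m: "n < m" "\<And>z. norm z \<le> \<rho> \<Longrightarrow> dist (poly (F m) z) (F_lim z) < \<eta>"
        unfolding eventually_sequentially by (metis le_SucI le_less_Suc_eq less_Suc_eq_le linorder_linear mem_cball_0 nat_less_le)
      obtain c where c: "\<And>z. norm z < 2 \<Longrightarrow> (\<lambda>j. c j * z ^ j) sums (p z * exp (poly (F m) z))"
        "summable (\<lambda>j. (norm (c j))\<^sup>2)" "(\<Sum>j. (norm (c j))\<^sup>2) \<le> ?B"
        using approx[OF m(1)] by blast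
      have c': "(\<lambda>j. (of_real (exp \<eta>) * c j) * z ^ j) sums (of_real (exp \<eta>) * (p z * exp (poly (F m) z)))" if "norm z < 1" for z
        unfolding mult.assoc by (intro sums_mult c) (use that in simp)
      have "(norm (p z * exp (F_lim z)))\<^sup>2 \<le> (norm (of_real (exp \<eta>) * (p z * exp (poly (F m) z))))\<^sup>2 + 0" if z: "norm z = \<rho>" for z
      proof -
        have "Re (F_lim z) \<le> \<eta> + Re (poly (F m) z)"
          using m(2)[of z] z abs_Re_le_cmod[of "poly (F m) z - F_lim z"] by (simp add: dist_norm)
        then have "exp (Re (F_lim z)) \<le> exp \<eta> * exp (Re (poly (F m) z))" by (simp add: exp_add[symmetric])
        then have "norm (p z) * exp (Re (F_lim z)) \<le> norm (p z) * (exp \<eta> * exp (Re (poly (F m) z)))"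
          by (intro mult_left_mono) auto
        then show ?thesis by (simp add: norm_mult power_mono mult_ac)
      qed
      then have *: "summable (\<lambda>j. (norm (e j))\<^sup>2 * \<rho> ^ (2 * j))"
        "?X \<le> (\<Sum>j. (norm (of_real (exp \<eta>) * c j))\<^sup>2 * \<rho> ^ (2 * j)) + 0"
        "summable (\<lambda>j. (norm (of_real (exp \<eta>) * c j))\<^sup>2 * \<rho> ^ (2 * j))"
        using parseval_compare[of 1 e "\<lambda>z. p z * exp (F_lim z)" "\<lambda>j. of_real (exp \<eta>) * c j"
            "\<lambda>z. of_real (exp \<eta>) * (p z * exp (poly (F m) z))" \<rho> 0] h c' \<rho> by auto
      have sq: "(norm (of_real (exp \<eta>) * c j))\<^sup>2 = exp (2 * \<eta>) * (norm (c j))\<^sup>2" for j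
        by (simp add: norm_mult power_mult_distrib exp_double)
      have "(\<Sum>j. (norm (of_real (exp \<eta>) * c j))\<^sup>2 * \<rho> ^ (2 * j)) \<le> (\<Sum>j. exp (2 * \<eta>) * (norm (c j))\<^sup>2)"
        using *(3) c(2) \<rho> by (intro suminf_le) (auto simp: sq mult_left_le power_le_one)
      also have "\<dots> = exp (2 * \<eta>) * (\<Sum>j. (norm (c j))\<^sup>2)" using c(2) by (rule suminf_mult)
      also have "\<dots> \<le> exp (2 * \<eta>) * ?B" using c(3) by (intro mult_left_mono) auto
      finally show ?thesis using * by simp
    qed
    have "((\<lambda>\<eta>. exp (2 * \<eta>) * ?B) \<longlongrightarrow> exp (2 * 0) * ?B) (at_right 0)" by (intro tendsto_intros)
    moreover have "\<forall>\<^sub>F \<eta> in at_right 0. ?X \<le> exp (2 * \<eta>) * ?B"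
      using eventually_at_right_less[of "0::real"] by eventually_elim (use main in blast)
    ultimately have "?X \<le> exp (2 * 0) * ?B" by (intro tendsto_lowerbound[of _ _ "at_right (0::real)"]) auto
    then show "summable (\<lambda>j. (norm (e j))\<^sup>2 * \<rho> ^ (2 * j)) \<and> ?X \<le> ?B" using main[of 1] by simp
  qed simp
qed

text \<open>The condition in \<open>Lambda_a\<close> bounds a quotient by \<open>\<omega>\<close>. Since division by \<open>0\<close> yields \<open>0\<close>, it says
something about the numerator only where \<open>\<omega>\<close> does not vanish.\<close>

lemma modulus_pos:
  assumes \<omega>: "modulus_of_continuity \<omega>" and t: "0 < t"
  shows "0 < \<omega> t"
proof -
  have "\<forall>\<^sub>F s in at_right 0. 1 \<le> \<omega> s / s"
    using \<omega> unfolding modulus_of_continuity_def filterlim_at_top by blast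
  moreover have "\<forall>\<^sub>F s in at_right 0. s \<in> {0<..<t}" by (rule eventually_at_right_real[OF t])
  ultimately have "\<forall>\<^sub>F s in at_right (0::real). 1 \<le> \<omega> s / s \<and> s \<in> {0<..<t}" by eventually_elim simp
  from eventually_happens[OF this] obtain s where "1 \<le> \<omega> s / s \<and> s \<in> {0<..<t}" by auto
  then have s: "1 \<le> \<omega> s / s" "0 < s" "s < t" by auto
  then have "0 < \<omega> s" by (simp add: field_simps)
  also have "\<omega> s \<le> \<omega> t" using \<omega> s by (auto simp: modulus_of_continuity_def mono_on_def)
  finally show ?thesis .
qed

text \<open>With \<open>r = 1 - 1/N\<close> the function \<open>f(z) - f(r z)\<close> is bounded by a multiple of \<open>\<omega>(1/N)\<close>, and its coefficients
are those of \<open>f\<close> times \<open>1 - r\<^sup>j\<close>, a factor at least \<open>1/2\<close> for \<open>j \<ge> N\<close>.\<close>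

lemma Lambda_coeff_tail:
  assumes \<omega>: "modulus_of_continuity \<omega>" and f: "f \<in> Lambda_a \<omega>"
    and a: "\<And>z. norm z < 1 \<Longrightarrow> (\<lambda>j. a j * z ^ j) sums f z"
  obtains C where "0 \<le> C" "\<And>N M. 0 < N \<Longrightarrow> (\<Sum>j=N..<M. (norm (a j))\<^sup>2) \<le> (C * \<omega> (1 / real N))\<^sup>2"
proof -
  define W where "W = (\<lambda>g::complex \<Rightarrow> complex. {norm (g z - g w) / \<omega> (norm (z - w)) | z w.
    z \<in> cball 0 1 \<and> w \<in> cball 0 1 \<and> z \<noteq> w})"
  from f have "\<exists>g. continuous_on (cball 0 1) g \<and> (\<forall>z\<in>ball 0 1. g z = f z) \<and> bdd_above (W g)"
    unfolding Lambda_a_def W_def mem_Collect_eq by (elim conjE)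
  then obtain g where g: "\<forall>z\<in>ball 0 1. g z = f z" and "bdd_above (W g)" by (elim exE conjE) (rule that)
  then obtain B where B': "\<forall>x\<in>W g. x \<le> B" by (auto simp: bdd_above_def)
  have B: "norm (g z - g w) / \<omega> (norm (z - w)) \<le> B" if "z \<in> cball 0 1" "w \<in> cball 0 1" "z \<noteq> w" for z w
  proof (rule bspec[OF B'])
    show "norm (g z - g w) / \<omega> (norm (z - w)) \<in> W g"
      unfolding W_def using that by (intro CollectI exI[of _ z] exI[of _ w]) simp
  qed
  have lip: "norm (f z - f w) \<le> \<bar>B\<bar> * \<omega> t" if "norm z < 1" "norm w < 1" "norm (z - w) \<le> t" for z w t
  proof (cases "z = w")
    case True
    have "0 \<le> \<omega> t" using \<omega> that order_trans[OF norm_ge_zero that(3)] by (auto simp: modulus_of_continuity_def)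
    then show ?thesis using True by simp
  next
    case False
    have pos: "0 < \<omega> (norm (z - w))" using False by (intro modulus_pos[OF \<omega>]) simp
    have "norm (f z - f w) / \<omega> (norm (z - w)) \<le> B" using B[of z w] that False g by simp
    then have "norm (f z - f w) \<le> B * \<omega> (norm (z - w))" using pos by (simp add: pos_divide_le_eq)
    also have "\<dots> \<le> \<bar>B\<bar> * \<omega> (norm (z - w))" using pos by (intro mult_right_mono) auto
    also have "\<dots> \<le> \<bar>B\<bar> * \<omega> t"
      using \<omega> that order_trans[OF norm_ge_zero that(3)]
      by (intro mult_left_mono) (auto simp: modulus_of_continuity_def mono_on_def)
    finally show ?thesis .
  qed
  show ?thesis
  proof (rule that[of "2 * \<bar>B\<bar>"])
    fix N M :: nat assume N: "0 < N"
    define r where "r = 1 - 1 / real N"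
    have r: "0 \<le> r" "r < 1" using N by (auto simp: r_def)
    let ?E = "(\<bar>B\<bar> * \<omega> (1 / real N))\<^sup>2"
    define c where "c = (\<lambda>j. a j * of_real (1 - r ^ j))"
    have c: "(\<lambda>j. c j * z ^ j) sums (f z - f (r * z))" if z: "norm z < 1" for z :: complex
    proof -
      have "norm (of_real r * z) < 1"
        using z r mult_left_le_one_le[of "norm z" r] by (simp add: norm_mult)
      from sums_diff[OF a[OF z] a[OF this]] show ?thesis
        by (simp add: c_def power_mult_distrib algebra_simps)
    qed
    have "(\<Sum>j<M. (norm (c j))\<^sup>2) \<le> ?E"
    proof (rule sum_le_of_radii)
      fix \<rho> :: real assume \<rho>: "0 < \<rho>" "\<rho> < 1"
      have "(norm (f z - f (r * z)))\<^sup>2 \<le> (norm (0::complex))\<^sup>2 + ?E" if z: "norm z = \<rho>" for z :: complex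
      proof -
        have "norm (of_real r * z) < 1"
          using mult_strict_mono'[of r 1 \<rho> 1] z \<rho> r by (simp add: norm_mult)
        moreover have "z - of_real r * z = of_real (1 / real N) * z" by (simp add: r_def algebra_simps)
        then have "norm (z - of_real r * z) \<le> 1 / real N"
          using z \<rho> N by (simp add: norm_mult norm_divide divide_right_mono)
        ultimately have "norm (f z - f (r * z)) \<le> \<bar>B\<bar> * \<omega> (1 / real N)"
          using z \<rho> by (intro lip) auto
        then show ?thesis by (simp add: power_mono)
      qed
      from parseval_compare[of 1 c "\<lambda>z::complex. f z - f (r * z)" "\<lambda>_. 0" "\<lambda>_. 0" \<rho>, OF c _ _ _ this]
      show "summable (\<lambda>j. (norm (c j))\<^sup>2 * \<rho> ^ (2 * j)) \<and> (\<Sum>j. (norm (c j))\<^sup>2 * \<rho> ^ (2 * j)) \<le> ?E"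
        using \<rho> by simp
    qed simp
    moreover have "(\<Sum>j=N..<M. (norm (a j))\<^sup>2 / 4) \<le> (\<Sum>j<M. (norm (c j))\<^sup>2)"
    proof -
      have "(norm (a j))\<^sup>2 / 4 \<le> (norm (c j))\<^sup>2" if j: "N \<le> j" for j
      proof -
        have "r ^ j \<le> r ^ N" using r j by (intro power_decreasing) auto
        also have "\<dots> \<le> 1 / (1 + real N * (1 / real N))"
          unfolding r_def using N by (intro one_minus_power_le) auto
        finally have "1 / 2 \<le> \<bar>1 - r ^ j\<bar>" using N by simp
        then have "norm (a j) * (1 / 2) \<le> norm (c j)"
          unfolding c_def norm_mult norm_of_real by (intro mult_left_mono) auto
        then have "(norm (a j) * (1 / 2))\<^sup>2 \<le> (norm (c j))\<^sup>2" by (intro power_mono) auto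
        then show ?thesis by (simp add: power_mult_distrib power_divide)
      qed
      then have "(\<Sum>j=N..<M. (norm (a j))\<^sup>2 / 4) \<le> (\<Sum>j=N..<M. (norm (c j))\<^sup>2)"
        by (intro sum_mono) auto
      also have "\<dots> \<le> (\<Sum>j<M. (norm (c j))\<^sup>2)" by (intro sum_mono2) auto
      finally show ?thesis .
    qed
    ultimately have "(\<Sum>j=N..<M. (norm (a j))\<^sup>2 / 4) \<le> ?E" by linarith
    then show "(\<Sum>j=N..<M. (norm (a j))\<^sup>2) \<le> (2 * \<bar>B\<bar> * \<omega> (1 / real N))\<^sup>2"
      by (simp add: sum_divide_distrib[symmetric] power_mult_distrib)
  qed simp
qed

lemma lacunary_coeffs:
  fixes k N :: nat
  assumes q: "\<And>w. (\<lambda>i. q i * w ^ i) sums Q w" and N: "0 < N"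
  defines "p \<equiv> \<lambda>j. if k \<le> j \<and> N dvd (j - k) then q ((j - k) div N) else (0::complex)"
  shows "(\<lambda>j. p j * z ^ j) sums (z ^ k * Q (z ^ N))"
proof -
  have "(\<lambda>i. p (k + N * i) * z ^ (k + N * i)) sums (z ^ k * Q (z ^ N))"
  proof -
    have "p (k + N * i) * z ^ (k + N * i) = z ^ k * (q i * (z ^ N) ^ i)" for i
      using N by (simp add: p_def power_add power_mult mult.left_commute)
    then show ?thesis using sums_mult[OF q[of "z ^ N"], of "z ^ k"] by simp
  qed
  moreover have "p j * z ^ j = 0" if "j \<notin> range (\<lambda>i. k + N * i)" for j
  proof -
    have "\<not> (k \<le> j \<and> N dvd (j - k))"
    proof
      assume "k \<le> j \<and> N dvd (j - k)"
      then obtain i where "j - k = N * i" "k \<le> j" by blast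
      then have "j = k + N * i" by simp
      then show False using that by blast
    qed
    then show ?thesis by (auto simp: p_def)
  qed
  moreover have "strict_mono (\<lambda>i. k + N * i)" using N by (auto simp: strict_mono_def)
  ultimately show ?thesis using sums_mono_reindex[of "\<lambda>i. k + N * i" "\<lambda>j. p j * z ^ j"] by simp
qed

text \<open>Pair \<open>f\<close> with \<open>P(z) = z\<^sup>k Q(z\<^bsup>N n\<^esup>)\<close>. The first summand bounds this pairing, which is
controlled because \<open>P\<close> is \<open>exp (- F_lim)\<close> times a function with hardly larger norm; the second bounds
the terms of order at least \<open>N n\<close>, and the only other one is \<open>a k\<close>.\<close>

lemma (in riesz_product) dbr_coeff_le:
  assumes R: "reproducing_kernel_hilbert_space (ball 0 1) H ip (dbr_kernel (\<lambda>z. exp (- F_lim z)))"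
    and f: "f \<in> H" and a: "\<And>z. norm z < 1 \<Longrightarrow> (\<lambda>m. a m * z ^ m) sums f z"
    and Q: "Q holomorphic_on UNIV" "Q 0 = 1" "\<And>z. norm z = 1 \<Longrightarrow> norm (Q z) \<le> B"
    and small: "\<And>z. norm z = 1 \<Longrightarrow> Re (poly (\<psi> n) z) * (norm (Q z))\<^sup>2 \<le> \<delta>"
    and tail: "\<And>M. (\<Sum>j=N n..<M. (norm (a j))\<^sup>2) \<le> \<tau>\<^sup>2" "0 \<le> \<tau>"
    and k: "k < N n"
  shows "norm (a k) \<le> sqrt (Re (ip f f) * (4 * exp 4 * \<delta>)) + \<tau> * B"
proof -
  have N0: "0 < N n" using k by simp
  have B0: "0 \<le> B" using order_trans[OF norm_ge_zero Q(3)[of 1]] by simp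
  obtain q where q: "\<And>w. (\<lambda>i. q i * w ^ i) sums Q w" using entire_coeffs[OF Q(1)] by blast
  have q0: "q 0 = 1" using q[of 0] powser_sums_zero[of q] Q(2) sums_unique2 by fastforce
  define p where "p = (\<lambda>j. if k \<le> j \<and> N n dvd (j - k) then q ((j - k) div N n) else 0)"
  define P where "P = (\<lambda>z. z ^ k * Q (z ^ N n))"
  have p: "(\<lambda>j. p j * z ^ j) sums P z" for z
    unfolding p_def P_def by (rule lacunary_coeffs[OF q N0])
  have Ph: "P holomorphic_on UNIV"
  proof -
    have "(Q \<circ> (\<lambda>z. z ^ N n)) holomorphic_on UNIV"
      by (rule holomorphic_on_compose_gen[OF _ Q(1)]) (auto intro: holomorphic_intros)
    then show ?thesis unfolding P_def by (intro holomorphic_intros) (simp add: o_def)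
  qed
  have pk: "p k = 1" by (simp add: p_def q0)
  have p_small: "p j = 0" if "j < N n" "j \<noteq> k" for j
    using that by (auto simp: p_def dest!: dvd_imp_le)
  have Psum: "summable (\<lambda>j. (norm (p j))\<^sup>2)" "(\<Sum>j. (norm (p j))\<^sup>2) \<le> B\<^sup>2"
  proof -
    have "(norm (P z))\<^sup>2 \<le> (norm (0::complex))\<^sup>2 + B\<^sup>2" if "norm z = 1" for z
      using Q(3)[of "z ^ N n"] that by (simp add: P_def norm_mult norm_power power_mono)
    from parseval_compare[of 2 p P "\<lambda>_. 0" "\<lambda>_. 0" 1, OF p _ _ _ this]
    show "summable (\<lambda>j. (norm (p j))\<^sup>2)" "(\<Sum>j. (norm (p j))\<^sup>2) \<le> B\<^sup>2" by simp_all
  qed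
  have "(\<lambda>z. P z * exp (F_lim z)) holomorphic_on ball 0 1"
    using Ph by (intro holomorphic_intros F_lim_holomorphic) (auto intro: holomorphic_on_subset)
  then obtain e where e: "\<And>z. norm z < 1 \<Longrightarrow> (\<lambda>j. e j * z ^ j) sums (P z * exp (F_lim z))"
    using power_series_coeffs by blast
  have eB: "(\<Sum>j<M. (norm (e j))\<^sup>2) \<le> (\<Sum>j. (norm (p j))\<^sup>2) + 4 * exp 4 * \<delta>" for M
    by (rule reciprocal_multiplier_coeffs[OF small Ph p _ e]) (simp_all add: P_def norm_mult norm_power)
  have bP: "exp (- F_lim z) * (P z * exp (F_lim z)) = P z" for z by (simp add: exp_minus)
  let ?bound = "\<lambda>S. sqrt (Re (ip f f) * (((\<Sum>j. (norm (p j))\<^sup>2) + 4 * exp 4 * \<delta>) - S))"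
  have pair: "(norm (\<Sum>j<M. a j * cnj (p j)))\<^sup>2
      \<le> Re (ip f f) * (((\<Sum>j. (norm (p j))\<^sup>2) + 4 * exp 4 * \<delta>) - (\<Sum>j<M. (norm (p j))\<^sup>2))" for M
    by (rule dbr_pairing_le[OF R f a e eB]) (simp_all add: bP p)
  have le: "norm (a k) \<le> ?bound (\<Sum>j<M. (norm (p j))\<^sup>2) + \<tau> * B" if M: "N n \<le> M" for M
  proof -
    have "{..<M} = {..<N n} \<union> {N n..<M}" using M by auto
    then have "(\<Sum>j<M. a j * cnj (p j)) = (\<Sum>j<N n. a j * cnj (p j)) + (\<Sum>j=N n..<M. a j * cnj (p j))"
      by (simp add: sum.union_disjoint ivl_disj_int)
    also have "(\<Sum>j<N n. a j * cnj (p j)) = (\<Sum>j\<in>{k}. a j * cnj (p j))"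
      using k p_small by (intro sum.mono_neutral_right) auto
    finally have split: "a k = (\<Sum>j<M. a j * cnj (p j)) - (\<Sum>j=N n..<M. a j * cnj (p j))" by (simp add: pk)
    have "norm (\<Sum>j=N n..<M. a j * cnj (p j)) \<le> \<tau> * B"
    proof (rule power2_le_imp_le)
      have "(norm (\<Sum>j=N n..<M. a j * cnj (p j)))\<^sup>2 \<le> (\<Sum>j=N n..<M. norm (a j) * norm (p j))\<^sup>2"
        by (intro power_mono sum_norm_le) (auto simp: norm_mult)
      also have "\<dots> \<le> (\<Sum>j=N n..<M. (norm (a j))\<^sup>2) * (\<Sum>j=N n..<M. (norm (p j))\<^sup>2)"
        by (rule Cauchy_Schwarz_ineq_sum)
      also have "\<dots> \<le> \<tau>\<^sup>2 * B\<^sup>2"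
      proof (rule mult_mono[OF tail(1)])
        have "(\<Sum>j=N n..<M. (norm (p j))\<^sup>2) \<le> (\<Sum>j. (norm (p j))\<^sup>2)"
          by (intro sum_le_suminf Psum) auto
        then show "(\<Sum>j=N n..<M. (norm (p j))\<^sup>2) \<le> B\<^sup>2" using Psum(2) by linarith
      qed (auto intro: sum_nonneg)
      finally show "(norm (\<Sum>j=N n..<M. a j * cnj (p j)))\<^sup>2 \<le> (\<tau> * B)\<^sup>2"
        by (simp add: power_mult_distrib)
      show "0 \<le> \<tau> * B" using tail(2) B0 by simp
    qed
    moreover have "norm (\<Sum>j<M. a j * cnj (p j)) \<le> ?bound (\<Sum>j<M. (norm (p j))\<^sup>2)"
      by (intro real_le_rsqrt pair)
    ultimately show ?thesis
      using norm_triangle_ineq4[of "\<Sum>j<M. a j * cnj (p j)" "\<Sum>j=N n..<M. a j * cnj (p j)"]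
      unfolding split[symmetric] by linarith
  qed
  have "(\<lambda>M. ?bound (\<Sum>j<M. (norm (p j))\<^sup>2) + \<tau> * B) \<longlonglongrightarrow> ?bound (\<Sum>j. (norm (p j))\<^sup>2) + \<tau> * B"
    by (intro tendsto_intros summable_LIMSEQ Psum)
  then have "norm (a k) \<le> ?bound (\<Sum>j. (norm (p j))\<^sup>2) + \<tau> * B"
    using le by (intro LIMSEQ_le_const) auto
  then show ?thesis by simp
qed

text \<open>This is where the frequencies learn about \<open>\<omega>\<close>: the tail of order \<open>\<omega>(1/N)\<close> has to beat the bound \<open>B\<close> of \<open>Q\<close>.\<close>

lemma modulus_eventually_small:
  assumes \<omega>: "modulus_of_continuity \<omega>" and e: "0 < e"
  shows "\<exists>r. \<forall>N\<ge>r. \<omega> (1 / real N) * B \<le> e"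
proof -
  have "\<forall>x\<in>{0..}. ((\<lambda>t. \<omega> t) \<longlongrightarrow> \<omega> x) (at x within {0..})"
    using \<omega> unfolding modulus_of_continuity_def continuous_on by (elim conjE)
  then have "((\<lambda>t. \<omega> t) \<longlongrightarrow> \<omega> 0) (at 0 within {0..})" by (rule bspec) simp
  then have "((\<lambda>t. \<omega> t) \<longlongrightarrow> 0) (at 0 within {0..})" using \<omega> by (simp add: modulus_of_continuity_def)
  moreover have "filterlim (\<lambda>N. 1 / real (Suc N)) (at 0 within {0..}) sequentially"
    unfolding filterlim_at using LIMSEQ_Suc[OF lim_1_over_n] by auto
  ultimately have "(\<lambda>N. \<omega> (1 / real (Suc N))) \<longlonglongrightarrow> 0" by (rule filterlim_compose)
  then have "(\<lambda>N. \<omega> (1 / real (Suc N)) * B) \<longlonglongrightarrow> 0" by (rule tendsto_mult_left_zero)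
  then have "\<forall>\<^sub>F N in sequentially. \<omega> (1 / real (Suc N)) * B < e"
    using e by (rule order_tendstoD)
  then obtain r where r: "\<And>N. r \<le> N \<Longrightarrow> \<omega> (1 / real (Suc N)) * B < e"
    by (auto simp: eventually_sequentially)
  have "\<omega> (1 / real N) * B \<le> e" if "Suc r \<le> N" for N
    using r[of "N - 1"] that by (cases N) auto
  then show ?thesis by blast
qed

theorem proposition4p1:
  fixes \<omega> :: "real \<Rightarrow> real"
  assumes "modulus_of_continuity \<omega>"
  shows "\<exists>b :: complex \<Rightarrow> complex.
           outer_function b \<and> b ` ball 0 1 \<subseteq> ball 0 1 \<and>
           Lambda_a \<omega> \<inter> de_branges_rovnyak b = {\<lambda>_. 0}"
proof -
  define \<epsilon> where "\<epsilon> = (\<lambda>n. (1/4::real) ^ Suc n)"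
  have "\<exists>\<psi> Q. poly \<psi> 0 = 1 \<and>
      (\<forall>z. norm z = 1 \<longrightarrow> 0 \<le> Re (poly \<psi> z) \<and> Re (poly \<psi> z) \<le> 1 + \<epsilon> n) \<and>
      (\<forall>z. norm z \<le> 1 \<longrightarrow> \<epsilon> n \<le> norm (z - 1) \<longrightarrow> norm (poly \<psi> z - 1) \<le> \<epsilon> n) \<and>
      Q holomorphic_on UNIV \<and> Q 0 = 1 \<and>
      (\<forall>z. norm z = 1 \<longrightarrow> Re (poly \<psi> z) * (norm (Q z))\<^sup>2 \<le> \<epsilon> n)" for n
    by (rule block_pair) (simp add: \<epsilon>_def)
  then obtain \<psi> Q where block: "\<And>n. poly (\<psi> n) 0 = 1 \<and>
      (\<forall>z. norm z = 1 \<longrightarrow> 0 \<le> Re (poly (\<psi> n) z) \<and> Re (poly (\<psi> n) z) \<le> 1 + \<epsilon> n) \<and>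
      (\<forall>z. norm z \<le> 1 \<longrightarrow> \<epsilon> n \<le> norm (z - 1) \<longrightarrow> norm (poly (\<psi> n) z - 1) \<le> \<epsilon> n) \<and>
      Q n holomorphic_on UNIV \<and> Q n 0 = 1 \<and>
      (\<forall>z. norm z = 1 \<longrightarrow> Re (poly (\<psi> n) z) * (norm (Q n z))\<^sup>2 \<le> \<epsilon> n)"
    by metis
  have Qh: "Q n holomorphic_on UNIV" and Q0: "Q n 0 = 1"
    and Qs: "\<And>z. norm z = 1 \<Longrightarrow> Re (poly (\<psi> n) z) * (norm (Q n z))\<^sup>2 \<le> \<epsilon> n" for n
    using block[of n] by auto
  have "\<exists>B. \<forall>z. norm z = 1 \<longrightarrow> norm (Q n z) \<le> B" for n
  proof -
    have "compact (Q n ` sphere 0 1)"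
      using holomorphic_on_imp_continuous_on[OF Qh[of n]]
      by (intro compact_continuous_image) (auto intro: continuous_on_subset)
    then have "bounded (Q n ` sphere 0 1)" by (rule compact_imp_bounded)
    then obtain c where "\<forall>y\<in>Q n ` sphere 0 1. norm y \<le> c" unfolding bounded_iff ..
    then show ?thesis by (intro exI[of _ c]) simp
  qed
  then obtain B where B: "\<And>n z. norm z = 1 \<Longrightarrow> norm (Q n z) \<le> B n" by metis
  have "\<exists>r. \<forall>N\<ge>r. \<omega> (1 / real N) * B n \<le> (1/2) ^ n" for n
    by (rule modulus_eventually_small[OF assms]) simp
  then obtain r where r: "\<And>n N. r n \<le> N \<Longrightarrow> \<omega> (1 / real N) * B n \<le> (1/2) ^ n" by metis
  \<comment> \<open>the frequencies outgrow \<open>r n\<close>, which depends on \<open>\<omega>\<close> and on the size of \<open>Q n\<close>\<close>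
  obtain F N where RP: "riesz_product \<psi> F N" and rN: "\<And>n. r n \<le> N n"
    by (rule riesz_product_exists[of \<psi> r]) (use block in \<open>auto simp: \<epsilon>_def\<close>)
  interpret riesz_product \<psi> F N by (rule RP)
  define b where "b = (\<lambda>z. exp (- F_lim z))"
  have outer: "outer_function b" unfolding b_def by (rule outer_exp_F_lim)
  have disc: "b ` ball 0 1 \<subseteq> ball 0 1" using Re_F_lim_pos by (auto simp: b_def)
  have bh: "b holomorphic_on ball 0 1" using outer by (simp add: outer_function_def)
  have "(\<lambda>_. 0) \<in> de_branges_rovnyak b" by (rule zero_mem_de_branges_rovnyak[OF bh disc])
  moreover have "(\<lambda>_. 0) \<in> Lambda_a \<omega>"
    unfolding Lambda_a_def by (auto intro!: exI[of _ "\<lambda>_. 0"] bdd_aboveI[of _ 0])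
  moreover have "f = (\<lambda>_. 0)" if fL: "f \<in> Lambda_a \<omega>" and fH: "f \<in> de_branges_rovnyak b" for f
  proof -
    obtain H ip where R: "reproducing_kernel_hilbert_space (ball 0 1) H ip (dbr_kernel b)" and fH: "f \<in> H"
      using fH unfolding de_branges_rovnyak_def by blast
    have "f holomorphic_on ball 0 1" and f_out: "\<And>z. z \<notin> ball 0 1 \<Longrightarrow> f z = 0"
      using fL by (auto simp: Lambda_a_def)
    then obtain a where a: "\<And>z. norm z < 1 \<Longrightarrow> (\<lambda>m. a m * z ^ m) sums f z"
      using power_series_coeffs by blast
    obtain C where C: "0 \<le> C" "\<And>N M. 0 < N \<Longrightarrow> (\<Sum>j=N..<M. (norm (a j))\<^sup>2) \<le> (C * \<omega> (1 / real N))\<^sup>2"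
      using Lambda_coeff_tail[OF assms fL a] by blast
    have "a k = 0" for k
    proof -
      have main: "norm (a k) \<le> sqrt (Re (ip f f) * (4 * exp 4 * \<epsilon> n)) + C * (1/2) ^ n" if n: "k \<le> n" for n
      proof -
        have Nk: "k < N n" using N_gt[of n] n by simp
        have "0 \<le> C * \<omega> (1 / real (N n))" using C(1) assms by (simp add: modulus_of_continuity_def)
        then have "norm (a k) \<le> sqrt (Re (ip f f) * (4 * exp 4 * \<epsilon> n)) + C * \<omega> (1 / real (N n)) * B n"
          using Nk by (intro dbr_coeff_le[OF R[unfolded b_def] fH a Qh Q0 B Qs] C(2)) auto
        also have "C * \<omega> (1 / real (N n)) * B n \<le> C * (1/2) ^ n"
          using r[OF rN] C(1) by (simp add: mult.assoc mult_left_mono)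
        finally show ?thesis by simp
      qed
      have "(\<lambda>n. sqrt (Re (ip f f) * (4 * exp 4 * \<epsilon> n)) + C * (1/2) ^ n)
          \<longlonglongrightarrow> sqrt (Re (ip f f) * (4 * exp 4 * 0)) + C * 0"
        unfolding \<epsilon>_def by (intro tendsto_intros LIMSEQ_Suc LIMSEQ_power_zero) auto
      then have "norm (a k) \<le> sqrt (Re (ip f f) * (4 * exp 4 * 0)) + C * 0"
        using main by (intro LIMSEQ_le_const) auto
      then show ?thesis by simp
    qed
    then have "f z = 0" if "norm z < 1" for z
      using sums_unique2[of "\<lambda>_. 0" "f z" 0] a[OF that] by simp
    then show "f = (\<lambda>_. 0)" using f_out by (fastforce simp: fun_eq_iff)
  qed
  ultimately show ?thesis using outer disc by blast
qed

end
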